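(* Let $m, \ell \in \mathbb{N}$. Let $K$ be a field and let $E$ be the natural $2$-dimensional representation of $\mathrm{GL}_2(K)$, with canonical basis $\{X,Y\}$. There is an isomorphism of $\mathrm{GL}_2(K)$-representations $$\mathrm{Sym}_m \mathrm{Sym}^\ell E \otimes (\det E)^{\otimes m(m-1)/2} \cong \bigwedge\nolimits^m \mathrm{Sym}^{\ell + m - 1}E$$ given by restriction (to $\mathrm{Sym}_m\mathrm{Sym}^\ell E\subseteq(\mathrm{Sym}^\ell E)^{\otimes m}$) of the $K$-linear map $(\mathrm{Sym}^\ell E)^{\otimes m} \rightarrow \bigwedge^m \mathrm{Sym}^{\ell+m-1} E$ defined on the canonical basis of $(\mathrm{Sym}^\ell E)^{\otimes m}$ by $$\bigotimes_{j=1}^m X^{i_j} Y^{\ell-i_j} \mapsto \bigwedge_{j=1}^m X^{i_j+m-j} Y^{\ell-i_j+j-1},\qquad i_1,\ldots,i_m\in\{0,\ldots,\ell\}.$$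
   Context: For a $K$-vector space $V$, the symmetric group $S_r$ acts on $V^{\otimes r}$ by place permutation. $\mathrm{Sym}_r V=(V^{\otimes r})^{S_r}$ is the space of invariants, and $\mathrm{Sym}^r V$ is the usual symmetric power (coinvariants: the quotient of $V^{\otimes r}$ by the span of all $w\cdot\sigma-w$). $\bigwedge^r V$ is the usual exterior power. $\det E=\bigwedge^2E$ is the determinant representation. As a vector space, $\mathrm{Sym}_m \mathrm{Sym}^\ell E \otimes (\det E)^{\otimes m(m-1)/2}$ is identified with $\mathrm{Sym}_m \mathrm{Sym}^\ell E$. $\mathrm{Sym}^r E$ has basis $X^iY^{r-i}$, $0\le i\le r$. *)

theory Defs
  imports
    "HOL-Analysis.Cartesian_Space"
    "HOL-Combinatorics.Permutations"
    "HOL-Library.Poly_Mapping"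
    "HOL-Algebra.QuotRing"
    "HOL-Algebra.Module"
begin

section \<open>Representations over a field\<close>

text \<open>The field \<open>K\<close> is a type of class \<^class>\<open>field\<close>; \<open>scalars\<close> is the same field as a record, so
  that \<^locale>\<open>Module.module\<close> and \<^locale>\<open>submodule\<close> over it are vector spaces and subspaces.\<close>

definition scalars :: "'k::field ring" where
  "scalars = \<lparr>carrier = UNIV, mult = (*), one = 1, zero = 0, add = (+)\<rparr>"

text \<open>A vector space together with the action of a group on it. The record fields \<open>mult\<close> and
  \<open>one\<close>, which a module inherits from rings, play no role and are left undefined below.\<close>

record ('k, 'v, 'g) rep = "('k, 'v) module" +
  act :: "'g \<Rightarrow> 'v \<Rightarrow> 'v"

locale representation = group G + V?: Module.module scalars V
  for G :: "('g, 'c) monoid_scheme" and V :: "('k::field, 'v, 'g) rep" (structure) +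
  assumes act_closed: "g \<in> carrier G \<Longrightarrow> v \<in> carrier V \<Longrightarrow> act V g v \<in> carrier V"
    and act_add: "g \<in> carrier G \<Longrightarrow> v \<in> carrier V \<Longrightarrow> w \<in> carrier V \<Longrightarrow>
      act V g (v \<oplus>\<^bsub>V\<^esub> w) = act V g v \<oplus>\<^bsub>V\<^esub> act V g w"
    and act_smult: "g \<in> carrier G \<Longrightarrow> v \<in> carrier V \<Longrightarrow>
      act V g (c \<odot>\<^bsub>V\<^esub> v) = c \<odot>\<^bsub>V\<^esub> act V g v"
    and act_one: "v \<in> carrier V \<Longrightarrow> act V \<one>\<^bsub>G\<^esub> v = v"
    and act_mult: "g \<in> carrier G \<Longrightarrow> h \<in> carrier G \<Longrightarrow> v \<in> carrier V \<Longrightarrow>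
      act V (g \<otimes>\<^bsub>G\<^esub> h) v = act V g (act V h v)"

definition linear_maps :: "('k::field, 'v, 'g) rep \<Rightarrow> ('k, 'w, 'g) rep \<Rightarrow> ('v \<Rightarrow> 'w) set" where
  "linear_maps V W = {f \<in> carrier V \<rightarrow> carrier W.
     (\<forall>v\<in>carrier V. \<forall>w\<in>carrier V. f (v \<oplus>\<^bsub>V\<^esub> w) = f v \<oplus>\<^bsub>W\<^esub> f w) \<and>
     (\<forall>c. \<forall>v\<in>carrier V. f (c \<odot>\<^bsub>V\<^esub> v) = c \<odot>\<^bsub>W\<^esub> f v)}"

definition rep_iso ::
  "('g, 'c) monoid_scheme \<Rightarrow> ('k::field, 'v, 'g) rep \<Rightarrow> ('k, 'w, 'g) rep \<Rightarrow> ('v \<Rightarrow> 'w) \<Rightarrow> bool" where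
  "rep_iso G V W f \<longleftrightarrow>
     representation G V \<and> representation G W \<and>
     f \<in> linear_maps V W \<and> bij_betw f (carrier V) (carrier W) \<and>
     (\<forall>g\<in>carrier G. \<forall>v\<in>carrier V. f (act V g v) = act W g (f v))"


section \<open>Spans, quotients and free vector spaces\<close>

definition lin_span :: "('k::field, 'v, 'g) rep \<Rightarrow> 'v set \<Rightarrow> 'v set" where
  "lin_span V S = \<Inter>{H. submodule H scalars V \<and> S \<subseteq> H}"

text \<open>The vector space \<open>V/W\<close> of cosets. The image of a coset \<open>v + W\<close> under the map induced by
  \<open>h\<close> is written as the union of the cosets \<open>h a + W\<close> over all \<open>a \<in> v + W\<close>; when \<open>h\<close> is linear
  and maps \<open>W\<close> into \<open>W\<close>, these are all the same coset.\<close>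

definition quot_rep :: "('k::field, 'v, 'g) rep \<Rightarrow> 'v set \<Rightarrow> ('k, 'v set, 'g) rep" where
  "quot_rep V W =
    \<lparr>carrier = a_rcosets\<^bsub>V\<^esub> W, mult = undefined, one = undefined, zero = W, add = set_add V,
     smult = (\<lambda>c A. \<Union>a\<in>A. W +>\<^bsub>V\<^esub> (c \<odot>\<^bsub>V\<^esub> a)),
     act = (\<lambda>g A. \<Union>a\<in>A. W +>\<^bsub>V\<^esub> act V g a)\<rparr>"

text \<open>The linear extension of a map of bases to the free vector spaces.\<close>

definition push :: "('a \<Rightarrow> 'b) \<Rightarrow> ('a \<Rightarrow>\<^sub>0 'k::field) \<Rightarrow> ('b \<Rightarrow>\<^sub>0 'k)" where
  "push h F = (\<Sum>x\<in>Poly_Mapping.keys F. Poly_Mapping.single (h x) (Poly_Mapping.lookup F x))"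

text \<open>The free vector space on \<open>B\<close>, the group acting through its action \<open>\<alpha>\<close> on \<open>B\<close>.\<close>

definition free_rep :: "'b set \<Rightarrow> ('g \<Rightarrow> 'b \<Rightarrow> 'b) \<Rightarrow> ('k::field, 'b \<Rightarrow>\<^sub>0 'k, 'g) rep" where
  "free_rep B \<alpha> =
    \<lparr>carrier = {F. Poly_Mapping.keys F \<subseteq> B}, mult = undefined, one = undefined,
     zero = 0, add = (+), smult = (\<lambda>c. Poly_Mapping.map ((*) c)), act = (\<lambda>g. push (\<alpha> g))\<rparr>"


section \<open>Tensor products\<close>

text \<open>\<open>V\<^bsup>\<otimes>r\<^esup>\<close> is the free vector space on the \<open>r\<close>-tuples of vectors modulo multilinearity.\<close>

definition tuples :: "nat \<Rightarrow> ('k::field, 'v, 'g) rep \<Rightarrow> 'v list set" where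
  "tuples r V = {xs. length xs = r \<and> set xs \<subseteq> carrier V}"

definition free_tuples :: "nat \<Rightarrow> ('k::field, 'v, 'g) rep \<Rightarrow> ('k, 'v list \<Rightarrow>\<^sub>0 'k, 'g) rep" where
  "free_tuples r V = free_rep (tuples r V) (\<lambda>g. map (act V g))"

definition multilinear_rels :: "nat \<Rightarrow> ('k::field, 'v, 'g) rep \<Rightarrow> ('v list \<Rightarrow>\<^sub>0 'k) set" where
  "multilinear_rels r V = lin_span (free_tuples r V)
     ({Poly_Mapping.single (xs[i := x \<oplus>\<^bsub>V\<^esub> y]) 1
        - Poly_Mapping.single (xs[i := x]) 1 - Poly_Mapping.single (xs[i := y]) 1 | xs i x y.
        xs \<in> tuples r V \<and> i < r \<and> x \<in> carrier V \<and> y \<in> carrier V} \<union>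
      {Poly_Mapping.single (xs[i := c \<odot>\<^bsub>V\<^esub> x]) 1 - Poly_Mapping.single (xs[i := x]) c | xs i c x.
        xs \<in> tuples r V \<and> i < r \<and> x \<in> carrier V})"

definition tensor_power ::
  "nat \<Rightarrow> ('k::field, 'v, 'g) rep \<Rightarrow> ('k, ('v list \<Rightarrow>\<^sub>0 'k) set, 'g) rep" where
  "tensor_power r V = quot_rep (free_tuples r V) (multilinear_rels r V)"

text \<open>\<open>v\<^sub>1 \<otimes> \<dots> \<otimes> v\<^sub>r\<close>\<close>

definition tensor :: "('k::field, 'v, 'g) rep \<Rightarrow> 'v list \<Rightarrow> ('v list \<Rightarrow>\<^sub>0 'k) set" where
  "tensor V xs =
     multilinear_rels (length xs) V +>\<^bsub>free_tuples (length xs) V\<^esub> Poly_Mapping.single xs 1"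

definition bilinear_rels ::
  "('k::field, 'v, 'g) rep \<Rightarrow> ('k, 'w, 'g) rep \<Rightarrow> ('v \<times> 'w \<Rightarrow>\<^sub>0 'k) set" where
  "bilinear_rels V W =
     lin_span (free_rep (carrier V \<times> carrier W) (\<lambda>g. map_prod (act V g) (act W g)))
     ({Poly_Mapping.single (v \<oplus>\<^bsub>V\<^esub> v', w) 1
        - Poly_Mapping.single (v, w) 1 - Poly_Mapping.single (v', w) 1 | v v' w.
        v \<in> carrier V \<and> v' \<in> carrier V \<and> w \<in> carrier W} \<union>
      {Poly_Mapping.single (v, w \<oplus>\<^bsub>W\<^esub> w') 1
        - Poly_Mapping.single (v, w) 1 - Poly_Mapping.single (v, w') 1 | v w w'.
        v \<in> carrier V \<and> w \<in> carrier W \<and> w' \<in> carrier W} \<union>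
      {Poly_Mapping.single (c \<odot>\<^bsub>V\<^esub> v, w) 1 - Poly_Mapping.single (v, w) c | c v w.
        v \<in> carrier V \<and> w \<in> carrier W} \<union>
      {Poly_Mapping.single (v, c \<odot>\<^bsub>W\<^esub> w) 1 - Poly_Mapping.single (v, w) c | c v w.
        v \<in> carrier V \<and> w \<in> carrier W})"

definition tensor_prod ::
  "('k::field, 'v, 'g) rep \<Rightarrow> ('k, 'w, 'g) rep \<Rightarrow> ('k, ('v \<times> 'w \<Rightarrow>\<^sub>0 'k) set, 'g) rep" where
  "tensor_prod V W =
     quot_rep (free_rep (carrier V \<times> carrier W) (\<lambda>g. map_prod (act V g) (act W g)))
       (bilinear_rels V W)"

text \<open>\<open>v \<otimes> w\<close>\<close>

definition tensor2 ::
  "('k::field, 'v, 'g) rep \<Rightarrow> ('k, 'w, 'g) rep \<Rightarrow> 'v \<Rightarrow> 'w \<Rightarrow> ('v \<times> 'w \<Rightarrow>\<^sub>0 'k) set" where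
  "tensor2 V W v w = bilinear_rels V W
     +>\<^bsub>free_rep (carrier V \<times> carrier W) (\<lambda>g. map_prod (act V g) (act W g))\<^esub>
     Poly_Mapping.single (v, w) 1"


section \<open>Symmetric and exterior powers\<close>

text \<open>The place permutation \<open>w \<mapsto> w \<cdot> \<sigma>\<close> of \<open>V\<^bsup>\<otimes>r\<^esup>\<close>, for \<open>\<sigma>\<close> a permutation of \<open>{..<r}\<close>: the linear
  map with \<open>(v\<^sub>0 \<otimes> \<dots> \<otimes> v\<^sub>r\<^sub>-\<^sub>1) \<cdot> \<sigma> = v\<^bsub>\<sigma>(0)\<^esub> \<otimes> \<dots> \<otimes> v\<^bsub>\<sigma>(r-1)\<^esub>\<close>.\<close>

definition place_perm ::
  "nat \<Rightarrow> ('k::field, 'v, 'g) rep \<Rightarrow> (nat \<Rightarrow> nat) \<Rightarrow>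
     ('v list \<Rightarrow>\<^sub>0 'k) set \<Rightarrow> ('v list \<Rightarrow>\<^sub>0 'k) set" where
  "place_perm r V \<sigma> w =
     (\<Union>F\<in>w. multilinear_rels r V +>\<^bsub>free_tuples r V\<^esub> push (permute_list \<sigma>) F)"

text \<open>\<open>Sym\<^sub>r V\<close>: the invariants of \<open>S\<^sub>r\<close> on \<open>V\<^bsup>\<otimes>r\<^esup>\<close>\<close>

definition sym_lower ::
  "nat \<Rightarrow> ('k::field, 'v, 'g) rep \<Rightarrow> ('k, ('v list \<Rightarrow>\<^sub>0 'k) set, 'g) rep" where
  "sym_lower r V = (tensor_power r V)
     \<lparr>carrier := {w \<in> carrier (tensor_power r V). \<forall>\<sigma>. \<sigma> permutes {..<r} \<longrightarrow> place_perm r V \<sigma> w = w}\<rparr>"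

text \<open>\<open>Sym\<^sup>r V\<close>: the coinvariants\<close>

definition sym_rels :: "nat \<Rightarrow> ('k::field, 'v, 'g) rep \<Rightarrow> ('v list \<Rightarrow>\<^sub>0 'k) set set" where
  "sym_rels r V = lin_span (tensor_power r V)
     {place_perm r V \<sigma> w \<ominus>\<^bsub>tensor_power r V\<^esub> w | \<sigma> w.
        \<sigma> permutes {..<r} \<and> w \<in> carrier (tensor_power r V)}"

definition sym_upper ::
  "nat \<Rightarrow> ('k::field, 'v, 'g) rep \<Rightarrow> ('k, ('v list \<Rightarrow>\<^sub>0 'k) set set, 'g) rep" where
  "sym_upper r V = quot_rep (tensor_power r V) (sym_rels r V)"

text \<open>\<open>v\<^sub>1 \<cdots> v\<^sub>r \<in> Sym\<^sup>r V\<close>\<close>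

definition sym_prod :: "('k::field, 'v, 'g) rep \<Rightarrow> 'v list \<Rightarrow> ('v list \<Rightarrow>\<^sub>0 'k) set set" where
  "sym_prod V xs = sym_rels (length xs) V +>\<^bsub>tensor_power (length xs) V\<^esub> tensor V xs"

definition alt_rels :: "nat \<Rightarrow> ('k::field, 'v, 'g) rep \<Rightarrow> ('v list \<Rightarrow>\<^sub>0 'k) set set" where
  "alt_rels r V = lin_span (tensor_power r V) {tensor V xs | xs. xs \<in> tuples r V \<and> \<not> distinct xs}"

definition ext_power ::
  "nat \<Rightarrow> ('k::field, 'v, 'g) rep \<Rightarrow> ('k, ('v list \<Rightarrow>\<^sub>0 'k) set set, 'g) rep" where
  "ext_power r V = quot_rep (tensor_power r V) (alt_rels r V)"

text \<open>\<open>v\<^sub>1 \<and> \<dots> \<and> v\<^sub>r\<close>\<close>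

definition wedge :: "('k::field, 'v, 'g) rep \<Rightarrow> 'v list \<Rightarrow> ('v list \<Rightarrow>\<^sub>0 'k) set set" where
  "wedge V xs = alt_rels (length xs) V +>\<^bsub>tensor_power (length xs) V\<^esub> tensor V xs"


section \<open>The natural representation of the general linear group of degree two\<close>

definition GL2 :: "('k::field^2^2) monoid" where
  "GL2 = \<lparr>carrier = {A. invertible A}, mult = (**), one = mat 1\<rparr>"

definition natE :: "('k::field, 'k^2, 'k^2^2) rep" where
  "natE = \<lparr>carrier = UNIV, mult = undefined, one = undefined, zero = 0, add = (+),
     smult = (*s), act = (*v)\<rparr>"

definition E_X :: "'k::field^2" where "E_X = axis 1 1"

definition E_Y :: "'k::field^2" where "E_Y = axis 2 1"

text \<open>\<open>X\<^sup>a Y\<^sup>b \<in> Sym\<^bsup>a+b\<^esup> E\<close>\<close>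

definition monomial :: "nat \<Rightarrow> nat \<Rightarrow> (('k::field^2) list \<Rightarrow>\<^sub>0 'k) set set" where
  "monomial a b = sym_prod natE (replicate a E_X @ replicate b E_Y)"

abbreviation detE :: "('k::field, (('k^2) list \<Rightarrow>\<^sub>0 'k) set set, 'k^2^2) rep" where
  "detE \<equiv> ext_power 2 natE"

text \<open>The basis vector \<open>(X \<and> Y)\<^bsup>\<otimes>N\<^esup>\<close> of the one-dimensional space \<open>(det E)\<^bsup>\<otimes>N\<^esup>\<close>: tensoring with it
  is the identification of \<open>V\<close> with \<open>V \<otimes> (det E)\<^bsup>\<otimes>N\<^esup>\<close> as vector spaces.\<close>

definition det_generator :: "nat \<Rightarrow> ((('k::field^2) list \<Rightarrow>\<^sub>0 'k) set set list \<Rightarrow>\<^sub>0 'k) set" where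
  "det_generator N = tensor detE (replicate N (wedge natE [E_X, E_Y]))"

text \<open>For \<open>m = 0\<close> the degree \<open>l + m - 1\<close> below may be truncated; this is harmless, as the zeroth
  exterior power of any space is \<open>K\<close>.\<close>

definition wronskian_map ::
  "nat \<Rightarrow> nat \<Rightarrow>
    (((('k::field^2) list \<Rightarrow>\<^sub>0 'k) set set list \<Rightarrow>\<^sub>0 'k) set \<Rightarrow>
     ((('k^2) list \<Rightarrow>\<^sub>0 'k) set set list \<Rightarrow>\<^sub>0 'k) set set) \<Rightarrow> bool" where
  "wronskian_map m l f \<longleftrightarrow>
     f \<in> linear_maps (tensor_power m (sym_upper l natE))
           (ext_power m (sym_upper (l + m - 1) natE)) \<and>
     (\<forall>i. (\<forall>j\<in>{1..m}. i j \<le> l) \<longrightarrow>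
        f (tensor (sym_upper l natE) (map (\<lambda>j. monomial (i j) (l - i j)) [1..<Suc m])) =
        wedge (sym_upper (l + m - 1) natE)
          (map (\<lambda>j. monomial (i j + m - j) (l - i j + j - 1)) [1..<Suc m]))"

end

theory Submission
  imports
    Defs
    "Jordan_Normal_Form.Determinant"
    "HOL-Combinatorics.Multiset_Permutations"
begin

text \<open>Evaluating at points \<open>(x\<^sub>0, y\<^sub>0), \<dots>, (x\<^sub>m\<^sub>-\<^sub>1, y\<^sub>m\<^sub>-\<^sub>1)\<close> of a commutative ring gives functionals
  \<open>\<theta>\<close> on \<open>(Sym\<^sup>l E)\<^bsup>\<otimes>m\<^esup>\<close>, by \<open>\<theta>(p\<^sub>0 \<otimes> \<dots>) = \<Prod>\<^sub>j p\<^sub>j(x\<^sub>j, y\<^sub>j)\<close>, and \<open>\<Psi>\<close> on the exterior power, by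
  \<open>\<Psi>(q\<^sub>0 \<and> \<dots>) = det (q\<^sub>i(x\<^sub>j, y\<^sub>j))\<close>. Expanding the determinant shows \<open>\<Psi>(f t) = V \<theta>(t)\<close> for symmetric
  tensors \<open>t\<close>, where \<open>V = \<Prod>\<^sub>j\<^sub><\<^sub>k (x\<^sub>j y\<^sub>k - x\<^sub>k y\<^sub>j)\<close> is the homogeneous Vandermonde determinant. At a generic
  point \<open>\<theta>\<close> is injective and \<open>V\<close> is a nonzero element of a domain, so \<open>f\<close> is injective on symmetric
  tensors. It is surjective because the orbit sums of monomial tensors are mapped to monomial wedge
  products unitriangularly. Hence \<open>\<Psi>\<close> is injective at a generic point as well, and \<open>f\<close> is equivariant up
  to the factor by which a linear substitution changes \<open>V\<close>, namely \<open>det\<^bsup>m(m-1)/2\<^esup>\<close>.\<close>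

section \<open>Vector spaces, linear maps and spanning sets\<close>

text \<open>The powers are quotients of enormous free spaces, so neither bases nor dimensions are at
  hand, and bijectivity is not a matter of counting. Two devices take their place: identities and
  membership are checked on spanning sets, and non-vanishing is detected by functionals obtained
  from universal properties. Independence of monomials is never an ingredient; it comes out of the
  functionals. The field is arbitrary, which shapes two choices. It may be finite, so points with
  coordinates in \<open>K\<close> may fail to separate polynomials; the generic point has
  coordinates in \<open>K[T]\<close> instead. Its characteristic may divide m!, so symmetric tensors
  cannot be produced by averaging over permutations; sums over distinct rearrangements do the work.
  The generic point has all \<open>y\<close> equal to 1, but the group moves it to a point with
  \<open>y\<close> equal to \<open>b * x + d\<close>; hence the Vandermonde determinant has to be
  homogeneous. Surjectivity comes before equivariance because injectivity of \<open>\<Psi>\<close>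
  is obtained from preimages.\<close>

lemma scalars_simps [simp]:
  "carrier scalars = UNIV" "mult scalars = (*)" "one scalars = 1" "zero scalars = 0"
  "add scalars = (+)"
  by (simp_all add: scalars_def)

lemma cring_scalars: "cring (scalars :: 'k::field ring)"
proof (intro cringI abelian_groupI comm_monoidI)
  fix x :: 'k
  show "\<exists>y\<in>carrier scalars. y \<oplus>\<^bsub>scalars\<^esub> x = \<zero>\<^bsub>scalars\<^esub>"
    by (rule bexI[of _ "- x"]) auto
qed (auto simp: algebra_simps)

abbreviation vecspace :: "('k::field, 'v, 'g) rep \<Rightarrow> bool" where
  "vecspace V \<equiv> Module.module scalars V"

text \<open>Additive inverses need not be supplied: \<open>-1\<close> times a vector is one, because
  multiplication by 0 is assumed to give the zero vector.\<close>

lemma vecspaceI: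
  fixes V :: "('k::field, 'v, 'g) rep"
  assumes "\<And>x y. x \<in> carrier V \<Longrightarrow> y \<in> carrier V \<Longrightarrow> x \<oplus>\<^bsub>V\<^esub> y \<in> carrier V"
    and "\<zero>\<^bsub>V\<^esub> \<in> carrier V"
    and "\<And>x y z. x \<in> carrier V \<Longrightarrow> y \<in> carrier V \<Longrightarrow> z \<in> carrier V \<Longrightarrow>
      (x \<oplus>\<^bsub>V\<^esub> y) \<oplus>\<^bsub>V\<^esub> z = x \<oplus>\<^bsub>V\<^esub> (y \<oplus>\<^bsub>V\<^esub> z)"
    and "\<And>x y. x \<in> carrier V \<Longrightarrow> y \<in> carrier V \<Longrightarrow> x \<oplus>\<^bsub>V\<^esub> y = y \<oplus>\<^bsub>V\<^esub> x"
    and "\<And>x. x \<in> carrier V \<Longrightarrow> \<zero>\<^bsub>V\<^esub> \<oplus>\<^bsub>V\<^esub> x = x"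
    and "\<And>c x. x \<in> carrier V \<Longrightarrow> c \<odot>\<^bsub>V\<^esub> x \<in> carrier V"
    and distr: "\<And>c d x. x \<in> carrier V \<Longrightarrow> (c + d) \<odot>\<^bsub>V\<^esub> x = c \<odot>\<^bsub>V\<^esub> x \<oplus>\<^bsub>V\<^esub> d \<odot>\<^bsub>V\<^esub> x"
    and "\<And>c x y. x \<in> carrier V \<Longrightarrow> y \<in> carrier V \<Longrightarrow>
      c \<odot>\<^bsub>V\<^esub> (x \<oplus>\<^bsub>V\<^esub> y) = c \<odot>\<^bsub>V\<^esub> x \<oplus>\<^bsub>V\<^esub> c \<odot>\<^bsub>V\<^esub> y"
    and "\<And>c d x. x \<in> carrier V \<Longrightarrow> (c * d) \<odot>\<^bsub>V\<^esub> x = c \<odot>\<^bsub>V\<^esub> (d \<odot>\<^bsub>V\<^esub> x)"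
    and one: "\<And>x. x \<in> carrier V \<Longrightarrow> 1 \<odot>\<^bsub>V\<^esub> x = x"
    and zero: "\<And>x. x \<in> carrier V \<Longrightarrow> 0 \<odot>\<^bsub>V\<^esub> x = \<zero>\<^bsub>V\<^esub>"
  shows "vecspace V"
proof (rule moduleI[OF cring_scalars])
  show "abelian_group V"
  proof (rule abelian_groupI)
    fix x assume x: "x \<in> carrier V"
    have "(-1) \<odot>\<^bsub>V\<^esub> x \<oplus>\<^bsub>V\<^esub> x = \<zero>\<^bsub>V\<^esub>"
      using distr[OF x, of "-1" 1] one[OF x] zero[OF x] by simp
    then show "\<exists>y\<in>carrier V. y \<oplus>\<^bsub>V\<^esub> x = \<zero>\<^bsub>V\<^esub>" using assms(6)[OF x] by blast
  qed (use assms in auto)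
qed (use assms in auto)

lemma linear_mapsI:
  assumes "\<And>v. v \<in> carrier V \<Longrightarrow> f v \<in> carrier W"
    and "\<And>v w. v \<in> carrier V \<Longrightarrow> w \<in> carrier V \<Longrightarrow> f (v \<oplus>\<^bsub>V\<^esub> w) = f v \<oplus>\<^bsub>W\<^esub> f w"
    and "\<And>c v. v \<in> carrier V \<Longrightarrow> f (c \<odot>\<^bsub>V\<^esub> v) = c \<odot>\<^bsub>W\<^esub> f v"
  shows "f \<in> linear_maps V W"
  using assms by (auto simp: linear_maps_def)

lemma linear_maps_closed: "f \<in> linear_maps V W \<Longrightarrow> v \<in> carrier V \<Longrightarrow> f v \<in> carrier W"
  and linear_maps_add: "f \<in> linear_maps V W \<Longrightarrow> v \<in> carrier V \<Longrightarrow> w \<in> carrier V \<Longrightarrow>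
    f (v \<oplus>\<^bsub>V\<^esub> w) = f v \<oplus>\<^bsub>W\<^esub> f w"
  and linear_maps_smult: "f \<in> linear_maps V W \<Longrightarrow> v \<in> carrier V \<Longrightarrow>
    f (c \<odot>\<^bsub>V\<^esub> v) = c \<odot>\<^bsub>W\<^esub> f v"
  by (auto simp: linear_maps_def)

lemma linear_maps_comp:
  "f \<in> linear_maps V W \<Longrightarrow> g \<in> linear_maps W U \<Longrightarrow> (\<lambda>x. g (f x)) \<in> linear_maps V U"
  by (rule linear_mapsI) (simp_all add: linear_maps_closed linear_maps_add linear_maps_smult)

lemma linear_maps_id: "(\<lambda>x. x) \<in> linear_maps V V"
  by (auto simp: linear_maps_def)

lemma vecspace_simps:
  assumes "vecspace V" "v \<in> carrier V"
  shows "0 \<odot>\<^bsub>V\<^esub> v = \<zero>\<^bsub>V\<^esub>" "1 \<odot>\<^bsub>V\<^esub> v = v" "c \<odot>\<^bsub>V\<^esub> v \<in> carrier V"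
    "(c + d) \<odot>\<^bsub>V\<^esub> v = c \<odot>\<^bsub>V\<^esub> v \<oplus>\<^bsub>V\<^esub> d \<odot>\<^bsub>V\<^esub> v"
    "(c * d) \<odot>\<^bsub>V\<^esub> v = c \<odot>\<^bsub>V\<^esub> (d \<odot>\<^bsub>V\<^esub> v)" "\<ominus>\<^bsub>V\<^esub> v = (-1) \<odot>\<^bsub>V\<^esub> v"
proof -
  interpret V: Module.module scalars V by fact
  show "0 \<odot>\<^bsub>V\<^esub> v = \<zero>\<^bsub>V\<^esub>" "1 \<odot>\<^bsub>V\<^esub> v = v" "c \<odot>\<^bsub>V\<^esub> v \<in> carrier V"
    "(c + d) \<odot>\<^bsub>V\<^esub> v = c \<odot>\<^bsub>V\<^esub> v \<oplus>\<^bsub>V\<^esub> d \<odot>\<^bsub>V\<^esub> v"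
    "(c * d) \<odot>\<^bsub>V\<^esub> v = c \<odot>\<^bsub>V\<^esub> (d \<odot>\<^bsub>V\<^esub> v)"
    using assms(2) V.smult_l_null[of v] V.smult_one[of v] V.smult_closed[of c v]
      V.smult_l_distr[of c d v] V.smult_assoc1[of c d v] by simp_all
  have "\<ominus>\<^bsub>scalars\<^esub> (1::'a) = -1"
    using V.R.minus_equality[of "-1" 1] by simp
  then show "\<ominus>\<^bsub>V\<^esub> v = (-1) \<odot>\<^bsub>V\<^esub> v"
    using V.smult_l_minus[of 1 v] V.smult_one[of v] assms by simp
qed

text \<open>Formulas are often known to agree on the carrier only; linearity transfers between them
  because the carrier is closed under sums and multiples.\<close>

lemma linear_maps_cong:
  assumes V: "vecspace V" and f: "f \<in> linear_maps V W" and eq: "\<And>v. v \<in> carrier V \<Longrightarrow> g v = f v"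
  shows "g \<in> linear_maps V W"
proof (rule linear_mapsI)
  interpret V: Module.module scalars V by (rule V)
  fix v c assume v: "v \<in> carrier V"
  show "g v \<in> carrier W" using linear_maps_closed[OF f v] eq[OF v] by simp
  show "g (c \<odot>\<^bsub>V\<^esub> v) = c \<odot>\<^bsub>W\<^esub> g v"
    using linear_maps_smult[OF f v] by (simp only: eq v vecspace_simps(3)[OF V v])
  fix w assume w: "w \<in> carrier V"
  show "g (v \<oplus>\<^bsub>V\<^esub> w) = g v \<oplus>\<^bsub>W\<^esub> g w"
    using linear_maps_add[OF f v w] by (simp only: eq v w V.a_closed)
qed

lemma linear_maps_neg:
  assumes "vecspace V" "vecspace W" "f \<in> linear_maps V W" "v \<in> carrier V"
  shows "f (\<ominus>\<^bsub>V\<^esub> v) = \<ominus>\<^bsub>W\<^esub> f v"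
  using assms by (simp add: vecspace_simps(6) linear_maps_smult linear_maps_closed)

lemma linear_maps_zero:
  assumes "vecspace V" "vecspace W" "f \<in> linear_maps V W"
  shows "f \<zero>\<^bsub>V\<^esub> = \<zero>\<^bsub>W\<^esub>"
proof -
  interpret V: Module.module scalars V by fact
  interpret W: Module.module scalars W by fact
  show ?thesis
    using linear_maps_smult[OF assms(3) V.zero_closed, of 0] vecspace_simps(1)[OF assms(1) V.zero_closed]
      vecspace_simps(1)[OF assms(2) linear_maps_closed[OF assms(3) V.zero_closed]] by simp
qed

lemma vecspace_minus:
  assumes "vecspace V" "v \<in> carrier V" "w \<in> carrier V"
  shows "v \<ominus>\<^bsub>V\<^esub> w = v \<oplus>\<^bsub>V\<^esub> (-1) \<odot>\<^bsub>V\<^esub> w"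
  using assms by (simp add: a_minus_def vecspace_simps(6))

lemma linear_maps_minus:
  assumes "vecspace V" "vecspace W" "f \<in> linear_maps V W" "v \<in> carrier V" "w \<in> carrier V"
  shows "f (v \<ominus>\<^bsub>V\<^esub> w) = f v \<ominus>\<^bsub>W\<^esub> f w"
proof -
  interpret V: Module.module scalars V by fact
  show ?thesis
    using assms V.smult_closed[of "-1" w]
    by (simp add: vecspace_minus linear_maps_closed linear_maps_add linear_maps_smult)
qed

lemma minus_eq_zero_iff:
  assumes "vecspace V" "v \<in> carrier V" "w \<in> carrier V"
  shows "v \<ominus>\<^bsub>V\<^esub> w = \<zero>\<^bsub>V\<^esub> \<longleftrightarrow> v = w"
proof -
  interpret V: Module.module scalars V by fact
  show ?thesis using assms(2,3) V.r_neg[of v] V.add.inv_equality[of v "\<ominus>\<^bsub>V\<^esub> w"] V.minus_minus[of w]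
    by (metis V.a_inv_closed V.minus_eq V.minus_equality)
qed

lemma linear_maps_smult_const:
  assumes "vecspace V" shows "(\<lambda>v. c \<odot>\<^bsub>V\<^esub> v) \<in> linear_maps V V"
proof -
  interpret V: Module.module scalars V by fact
  show ?thesis
  proof (rule linear_mapsI)
    fix v d assume v: "v \<in> carrier V"
    show "c \<odot>\<^bsub>V\<^esub> (d \<odot>\<^bsub>V\<^esub> v) = d \<odot>\<^bsub>V\<^esub> (c \<odot>\<^bsub>V\<^esub> v)"
      by (simp only: vecspace_simps(5)[OF assms v, symmetric] mult.commute)
  qed (simp_all add: V.smult_r_distr)
qed

lemma linear_maps_smult_right:
  assumes "vecspace W" "f \<in> linear_maps V W"
  shows "(\<lambda>v. c \<odot>\<^bsub>W\<^esub> f v) \<in> linear_maps V W"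
  by (rule linear_maps_comp[OF assms(2) linear_maps_smult_const[OF assms(1)]])

lemma linear_maps_finsum_apply:
  assumes "vecspace V" "vecspace W" "f \<in> linear_maps V W" "finite A" "x \<in> A \<rightarrow> carrier V"
  shows "f (\<Oplus>\<^bsub>V\<^esub>a\<in>A. x a) = (\<Oplus>\<^bsub>W\<^esub>a\<in>A. f (x a))"
proof -
  interpret V: Module.module scalars V by fact
  interpret W: Module.module scalars W by fact
  show ?thesis using assms(4,5)
    by (induction A)
      (auto simp: linear_maps_zero[OF assms(1-3)] linear_maps_add[OF assms(3)] Pi_def
        linear_maps_closed[OF assms(3)])
qed

lemma linear_maps_finsum:
  assumes "vecspace V" "vecspace W" "finite A" "\<And>a. a \<in> A \<Longrightarrow> f a \<in> linear_maps V W"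
  shows "(\<lambda>v. \<Oplus>\<^bsub>W\<^esub>a\<in>A. f a v) \<in> linear_maps V W"
proof -
  interpret V: Module.module scalars V by fact
  interpret W: Module.module scalars W by fact
  have cl: "f a v \<in> carrier W" if "a \<in> A" "v \<in> carrier V" for a v
    using assms(4)[OF that(1)] that(2) by (rule linear_maps_closed)
  show ?thesis
  proof (rule linear_mapsI)
    fix v assume v: "v \<in> carrier V"
    then show "(\<Oplus>\<^bsub>W\<^esub>a\<in>A. f a v) \<in> carrier W" using cl by (intro W.finsum_closed) auto
    fix c
    have "c \<odot>\<^bsub>W\<^esub> (\<Oplus>\<^bsub>W\<^esub>a\<in>A. f a v) = (\<Oplus>\<^bsub>W\<^esub>a\<in>A. c \<odot>\<^bsub>W\<^esub> f a v)"
      using assms(3) cl v by (intro W.finsum_smult_ldistr) auto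
    also have "\<dots> = (\<Oplus>\<^bsub>W\<^esub>a\<in>A. f a (c \<odot>\<^bsub>V\<^esub> v))"
      using cl v linear_maps_smult[OF assms(4)] by (intro W.finsum_cong') auto
    finally show "(\<Oplus>\<^bsub>W\<^esub>a\<in>A. f a (c \<odot>\<^bsub>V\<^esub> v)) = c \<odot>\<^bsub>W\<^esub> (\<Oplus>\<^bsub>W\<^esub>a\<in>A. f a v)" by simp
  next
    fix v w assume v: "v \<in> carrier V" "w \<in> carrier V"
    have "(\<Oplus>\<^bsub>W\<^esub>a\<in>A. f a (v \<oplus>\<^bsub>V\<^esub> w)) = (\<Oplus>\<^bsub>W\<^esub>a\<in>A. f a v \<oplus>\<^bsub>W\<^esub> f a w)"
      using cl v linear_maps_add[OF assms(4)] by (intro W.finsum_cong') auto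
    also have "\<dots> = (\<Oplus>\<^bsub>W\<^esub>a\<in>A. f a v) \<oplus>\<^bsub>W\<^esub> (\<Oplus>\<^bsub>W\<^esub>a\<in>A. f a w)"
      using cl v by (intro W.finsum_addf) auto
    finally show "(\<Oplus>\<^bsub>W\<^esub>a\<in>A. f a (v \<oplus>\<^bsub>V\<^esub> w)) = (\<Oplus>\<^bsub>W\<^esub>a\<in>A. f a v) \<oplus>\<^bsub>W\<^esub> (\<Oplus>\<^bsub>W\<^esub>a\<in>A. f a w)" .
  qed
qed

section \<open>Subspaces, their images and preimages\<close>

lemma submodule_vimage:
  assumes "vecspace V" "vecspace W" "f \<in> linear_maps V W" "submodule H scalars W"
  shows "submodule {v \<in> carrier V. f v \<in> H} scalars V"
proof -
  interpret V: Module.module scalars V by fact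
  interpret W: Module.module scalars W by fact
  note H = W.submoduleE[OF assms(4)]
  have z: "\<zero>\<^bsub>W\<^esub> \<in> H" using assms(4) subgroup.one_closed[OF submodule.axioms(1)] by fastforce
  note neg = linear_maps_neg[OF assms(1-3)]
  show ?thesis
    using assms(3) H z by (intro V.submoduleI)
      (auto simp: linear_maps_zero[OF assms(1-3)] linear_maps_add linear_maps_smult neg)
qed

lemma submodule_zero: "vecspace V \<Longrightarrow> submodule {\<zero>\<^bsub>V\<^esub>} scalars V"
proof -
  assume "vecspace V"
  then interpret V: Module.module scalars V .
  show ?thesis by (rule V.submoduleI) auto
qed

lemma submodule_carrier: "vecspace V \<Longrightarrow> submodule (carrier V) scalars V"
proof -
  assume "vecspace V"
  then interpret V: Module.module scalars V .
  show ?thesis by (rule V.submoduleI) auto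
qed

lemma submodule_equalizer:
  assumes "vecspace V" "vecspace W" "f \<in> linear_maps V W" "g \<in> linear_maps V W"
  shows "submodule {v \<in> carrier V. f v = g v} scalars V"
proof -
  interpret V: Module.module scalars V by fact
  interpret W: Module.module scalars W by fact
  show ?thesis
    using assms(3,4) linear_maps_zero[OF assms(1-3)] linear_maps_zero[OF assms(1,2,4)]
      linear_maps_neg[OF assms(1-3)] linear_maps_neg[OF assms(1,2,4)]
    by (intro V.submoduleI) (auto simp: linear_maps_add linear_maps_smult)
qed

lemma submodule_zero_closed:
  "vecspace V \<Longrightarrow> submodule H scalars V \<Longrightarrow> \<zero>\<^bsub>V\<^esub> \<in> H"
  using subgroup.one_closed[OF submodule.axioms(1)] by fastforce

lemma submodule_subset: "submodule H scalars V \<Longrightarrow> H \<subseteq> carrier V"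
  using subgroup.subset[OF submodule.axioms(1)] by fastforce

lemma submodule_minus:
  assumes "vecspace V" "submodule H scalars V" "v \<in> H" "w \<in> H"
  shows "v \<ominus>\<^bsub>V\<^esub> w \<in> H"
proof -
  interpret V: Module.module scalars V by fact
  show ?thesis using V.submoduleE[OF assms(2)] assms(3,4) by (simp add: a_minus_def)
qed

lemma submodule_finsum:
  assumes "vecspace V" "submodule H scalars V" "finite A" "x \<in> A \<rightarrow> H"
  shows "(\<Oplus>\<^bsub>V\<^esub>a\<in>A. x a) \<in> H"
proof -
  interpret V: Module.module scalars V by fact
  note H = V.submoduleE[OF assms(2)]
  show ?thesis using assms(3,4)
  proof (induction A)
    case empty
    then show ?case using submodule_zero_closed[OF assms(1,2)] by simp
  next
    case (insert a A)
    then show ?case using H by (subst V.finsum_insert) auto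
  qed
qed

lemma vecspace_submodule:
  assumes "vecspace V" "submodule H scalars V"
  shows "vecspace (V\<lparr>carrier := H\<rparr>)"
  by (rule submodule.submodule_is_module[OF assms(2,1)])

lemma submodule_image:
  assumes "vecspace V" "vecspace W" "f \<in> linear_maps V W" "submodule H scalars V"
  shows "submodule (f ` H) scalars W"
proof -
  interpret V: Module.module scalars V by fact
  interpret W: Module.module scalars W by fact
  note H = V.submoduleE[OF assms(4)]
  have z: "\<zero>\<^bsub>V\<^esub> \<in> H" using submodule_zero_closed[OF assms(1,4)] .
  note neg = linear_maps_neg[OF assms(1-3)]
  show ?thesis
  proof (rule W.submoduleI)
    show "f ` H \<subseteq> carrier W" using H(1) linear_maps_closed[OF assms(3)] by auto
    show "\<zero>\<^bsub>W\<^esub> \<in> f ` H" using z linear_maps_zero[OF assms(1-3)] by (metis image_eqI)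
    show "\<ominus>\<^bsub>W\<^esub> a \<in> f ` H" if "a \<in> f ` H" for a
    proof -
      from that obtain v where v: "v \<in> H" "a = f v" by blast
      then have "\<ominus>\<^bsub>W\<^esub> a = f (\<ominus>\<^bsub>V\<^esub> v)" using neg H(1) by auto
      then show ?thesis using H(3)[OF v(1)] by blast
    qed
    show "a \<oplus>\<^bsub>W\<^esub> b \<in> f ` H" if "a \<in> f ` H" "b \<in> f ` H" for a b
    proof -
      from that obtain v w where v: "v \<in> H" "a = f v" "w \<in> H" "b = f w" by blast
      then have "a \<oplus>\<^bsub>W\<^esub> b = f (v \<oplus>\<^bsub>V\<^esub> w)"
        using linear_maps_add[OF assms(3), of v w] H(1) by (simp add: subset_iff)
      then show ?thesis using H(5)[OF v(1,3)] by blast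
    qed
    show "a \<odot>\<^bsub>W\<^esub> x \<in> f ` H" if "x \<in> f ` H" for a x
    proof -
      from that obtain v where v: "v \<in> H" "x = f v" by blast
      then have "a \<odot>\<^bsub>W\<^esub> x = f (a \<odot>\<^bsub>V\<^esub> v)" using linear_maps_smult[OF assms(3)] H(1) by auto
      then show ?thesis using H(4)[of a, OF _ v(1)] by simp
    qed
  qed
qed

subsection \<open>Spans\<close>

lemma submodule_lin_span:
  assumes "vecspace V" "S \<subseteq> carrier V"
  shows "submodule (lin_span V S) scalars V"
proof -
  interpret V: Module.module scalars V by fact
  have ne: "carrier V \<in> {H. submodule H scalars V \<and> S \<subseteq> H}"
    using assms submodule_carrier by auto
  show ?thesis
  proof (rule V.submoduleI)
    show "lin_span V S \<subseteq> carrier V" using ne unfolding lin_span_def by blast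
    show "\<zero>\<^bsub>V\<^esub> \<in> lin_span V S"
      using submodule_zero_closed[OF assms(1)] by (simp add: lin_span_def)
    fix a b c assume "a \<in> lin_span V S"
    then have a: "a \<in> H" if "submodule H scalars V" "S \<subseteq> H" for H
      using that unfolding lin_span_def by blast
    show "\<ominus>\<^bsub>V\<^esub> a \<in> lin_span V S" using a V.submoduleE(3) by (simp add: lin_span_def)
    show "c \<odot>\<^bsub>V\<^esub> a \<in> lin_span V S" using a V.submoduleE(4) by (simp add: lin_span_def)
    assume "b \<in> lin_span V S"
    then have b: "b \<in> H" if "submodule H scalars V" "S \<subseteq> H" for H
      using that unfolding lin_span_def by blast
    show "a \<oplus>\<^bsub>V\<^esub> b \<in> lin_span V S" using a b V.submoduleE(5) by (simp add: lin_span_def)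
  qed
qed

lemma lin_span_superset: "S \<subseteq> lin_span V S"
  by (auto simp: lin_span_def)

lemma lin_span_least: "submodule H scalars V \<Longrightarrow> S \<subseteq> H \<Longrightarrow> lin_span V S \<subseteq> H"
  by (auto simp: lin_span_def)

lemma lin_span_image:
  assumes "vecspace V" "vecspace W" "f \<in> linear_maps V W" "submodule H scalars W"
    and "S \<subseteq> carrier V" "f ` S \<subseteq> H" "v \<in> lin_span V S"
  shows "f v \<in> H"
  using lin_span_least[OF submodule_vimage[OF assms(1-4)], of S] assms(5-7) by blast

text \<open>Spanning is encoded by minimality among subspaces rather than by linear combinations, so
  that each use consists in exhibiting one subspace that contains the generators.\<close>

definition spans :: "('k::field, 'v, 'g) rep \<Rightarrow> 'v set \<Rightarrow> bool" where
  "spans V S \<longleftrightarrow> S \<subseteq> carrier V \<and> (\<forall>H. submodule H scalars V \<and> S \<subseteq> H \<longrightarrow> carrier V \<subseteq> H)"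

lemma spans_subset: "spans V S \<Longrightarrow> S \<subseteq> carrier V"
  by (simp add: spans_def)

lemma spans_submodule: "spans V S \<Longrightarrow> submodule H scalars V \<Longrightarrow> S \<subseteq> H \<Longrightarrow> carrier V \<subseteq> H"
  by (simp add: spans_def)

text \<open>The vectors on which two linear maps agree form a subspace. This is the standard way
  below to prove an identity between maps on a quotient without choosing representatives.\<close>

lemma spans_eqI:
  assumes "spans V S" "vecspace V" "vecspace W" "f \<in> linear_maps V W" "g \<in> linear_maps V W"
    and "\<And>s. s \<in> S \<Longrightarrow> f s = g s" and "v \<in> carrier V"
  shows "f v = g v"
  using spans_submodule[OF assms(1) submodule_equalizer[OF assms(2-5)]] spans_subset[OF assms(1)]
    assms(6,7) by blast

lemma spans_image:
  assumes "spans V S" "vecspace V" "vecspace W" "f \<in> linear_maps V W"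
    and "carrier W \<subseteq> f ` carrier V"
  shows "spans W (f ` S)"
  unfolding spans_def
proof (intro conjI allI impI)
  show "f ` S \<subseteq> carrier W"
    using spans_subset[OF assms(1)] linear_maps_closed[OF assms(4)] by auto
  fix H assume H: "submodule H scalars W \<and> f ` S \<subseteq> H"
  then have "carrier V \<subseteq> {v \<in> carrier V. f v \<in> H}"
    using spans_subset[OF assms(1)] H
    by (intro spans_submodule[OF assms(1)] submodule_vimage[OF assms(2-4)]) auto
  then show "carrier W \<subseteq> H" using assms(5) by blast
qed

lemma spans_trans:
  assumes "spans V S" "\<And>H. submodule H scalars V \<Longrightarrow> T \<subseteq> H \<Longrightarrow> S \<subseteq> H" "T \<subseteq> carrier V"
  shows "spans V T"
  unfolding spans_def
proof (intro conjI allI impI)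
  fix H assume H: "submodule H scalars V \<and> T \<subseteq> H"
  then show "carrier V \<subseteq> H" using spans_submodule[OF assms(1)] assms(2) by simp
qed (rule assms(3))

text \<open>Both sides of the unit and product laws are linear in the vector, so these laws are only
  required on a spanning set, such as the pure tensors.\<close>

lemma representationI:
  assumes "group G" "vecspace V" "spans V S"
    and lin: "\<And>g. g \<in> carrier G \<Longrightarrow> act V g \<in> linear_maps V V"
    and one: "\<And>s. s \<in> S \<Longrightarrow> act V \<one>\<^bsub>G\<^esub> s = s"
    and mult: "\<And>g h s. g \<in> carrier G \<Longrightarrow> h \<in> carrier G \<Longrightarrow> s \<in> S \<Longrightarrow>
      act V (g \<otimes>\<^bsub>G\<^esub> h) s = act V g (act V h s)"
  shows "representation G V"
proof -
  interpret G: group G by fact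
  show ?thesis
  proof (rule representation.intro[OF assms(1,2)], unfold_locales)
    fix g v w c assume g: "g \<in> carrier G" and v: "v \<in> carrier V"
    show "act V g v \<in> carrier V" using lin[OF g] v by (rule linear_maps_closed)
    show "act V g (c \<odot>\<^bsub>V\<^esub> v) = c \<odot>\<^bsub>V\<^esub> act V g v" using lin[OF g] v by (rule linear_maps_smult)
    assume "w \<in> carrier V"
    then show "act V g (v \<oplus>\<^bsub>V\<^esub> w) = act V g v \<oplus>\<^bsub>V\<^esub> act V g w"
      using lin[OF g] v by (intro linear_maps_add)
  next
    fix v assume "v \<in> carrier V"
    then show "act V \<one>\<^bsub>G\<^esub> v = v"
      by (intro spans_eqI[OF assms(3,2,2) lin[OF G.one_closed] linear_maps_id one])
  next
    fix g h v assume gh: "g \<in> carrier G" "h \<in> carrier G" and v: "v \<in> carrier V"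
    show "act V (g \<otimes>\<^bsub>G\<^esub> h) v = act V g (act V h v)"
      by (intro spans_eqI[OF assms(3,2,2) lin[OF G.m_closed[OF gh]]
            linear_maps_comp[OF lin[OF gh(2)] lin[OF gh(1)]] mult[OF gh] v])
  qed
qed

lemma act_linear_map: "representation G V \<Longrightarrow> g \<in> carrier G \<Longrightarrow> act V g \<in> linear_maps V V"
  by (intro linear_mapsI)
    (simp_all add: representation.act_closed representation.act_add representation.act_smult)

lemma representation_vecspace: "representation G V \<Longrightarrow> vecspace V"
  by (rule representation.axioms(2))

lemma representation_group: "representation G V \<Longrightarrow> group G"
  by (rule representation.axioms(1))

lemma representation_subspace:
  assumes rep: "representation G V" and H: "submodule H scalars V"
    and inv: "\<And>g v. g \<in> carrier G \<Longrightarrow> v \<in> H \<Longrightarrow> act V g v \<in> H"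
  shows "representation G (V\<lparr>carrier := H\<rparr>)"
proof (rule representation.intro[OF representation_group[OF rep]
      vecspace_submodule[OF representation_vecspace[OF rep] H]], unfold_locales)
  note [simp] = subsetD[OF submodule_subset[OF H]]
  fix g v w c assume g: "g \<in> carrier G" and v: "v \<in> carrier (V\<lparr>carrier := H\<rparr>)"
  then show "act (V\<lparr>carrier := H\<rparr>) g v \<in> carrier (V\<lparr>carrier := H\<rparr>)"
    using inv by simp
  show "act (V\<lparr>carrier := H\<rparr>) g (c \<odot>\<^bsub>V\<lparr>carrier := H\<rparr>\<^esub> v) = c \<odot>\<^bsub>V\<lparr>carrier := H\<rparr>\<^esub> act (V\<lparr>carrier := H\<rparr>) g v"
    using representation.act_smult[OF rep g] v by simp
  assume "w \<in> carrier (V\<lparr>carrier := H\<rparr>)"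
  then show "act (V\<lparr>carrier := H\<rparr>) g (v \<oplus>\<^bsub>V\<lparr>carrier := H\<rparr>\<^esub> w) =
      act (V\<lparr>carrier := H\<rparr>) g v \<oplus>\<^bsub>V\<lparr>carrier := H\<rparr>\<^esub> act (V\<lparr>carrier := H\<rparr>) g w"
    using representation.act_add[OF rep g] v by simp
next
  note [simp] = subsetD[OF submodule_subset[OF H]]
  fix v assume v: "v \<in> carrier (V\<lparr>carrier := H\<rparr>)"
  then show "act (V\<lparr>carrier := H\<rparr>) \<one>\<^bsub>G\<^esub> v = v"
    using representation.act_one[OF rep] by simp
  fix g h assume "g \<in> carrier G" "h \<in> carrier G"
  then show "act (V\<lparr>carrier := H\<rparr>) (g \<otimes>\<^bsub>G\<^esub> h) v =
      act (V\<lparr>carrier := H\<rparr>) g (act (V\<lparr>carrier := H\<rparr>) h v)"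
    using representation.act_mult[OF rep] v by simp
qed

section \<open>Quotients and free vector spaces\<close>

context
  fixes V :: "('k::field, 'v, 'g) rep" and W :: "'v set"
  assumes V: "vecspace V" and W: "submodule W scalars V"
begin

interpretation V: Module.module scalars V by (rule V)

interpretation abelian_subgroup W V
  using W V.abelian_group_axioms
  by (intro abelian_subgroupI3 additive_subgroupI) (auto intro: submodule.axioms(1))

lemma coset_eq_iff:
  assumes "v \<in> carrier V" "w \<in> carrier V"
  shows "W +>\<^bsub>V\<^esub> v = W +>\<^bsub>V\<^esub> w \<longleftrightarrow> v \<ominus>\<^bsub>V\<^esub> w \<in> W"
  using assms a_rcos_module[of w v] a_repr_independence'[of v w] a_rcos_self[of v]
  by (auto simp: a_minus_def)

lemma coset_self: "v \<in> carrier V \<Longrightarrow> v \<in> W +>\<^bsub>V\<^esub> v"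
  by (rule a_rcos_self)

lemma coset_eqI: "v \<in> carrier V \<Longrightarrow> a \<in> W +>\<^bsub>V\<^esub> v \<Longrightarrow> W +>\<^bsub>V\<^esub> a = W +>\<^bsub>V\<^esub> v"
  using a_repr_independence'[of a v] by simp

lemma coset_subset: "v \<in> carrier V \<Longrightarrow> W +>\<^bsub>V\<^esub> v \<subseteq> carrier V"
  using a_elemrcos_carrier[of v] by blast

lemma coset_zero: "W +>\<^bsub>V\<^esub> \<zero>\<^bsub>V\<^esub> = W"
  by (rule a_rcos_const[OF submodule_zero_closed[OF V W]])

lemma carrier_quot_rep: "carrier (quot_rep V W) = (\<lambda>v. W +>\<^bsub>V\<^esub> v) ` carrier V"
  by (auto simp: quot_rep_def A_RCOSETS_def')

lemma zero_quot_rep: "\<zero>\<^bsub>quot_rep V W\<^esub> = W"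
  by (simp add: quot_rep_def)

text \<open>For \<open>a\<close> in the coset of \<open>v\<close> the difference of
  \<open>h a\<close> and \<open>h v\<close> lies in \<open>W'\<close>, so all cosets in the union
  coincide. This makes the union formulas for scalar multiplication and action computable on any
  representative.\<close>

lemma coset_map:
  fixes U :: "('k, 'u, 'g) rep"
  assumes U: "vecspace U" and W': "submodule W' scalars U" and h: "h \<in> linear_maps V U"
    and "h ` W \<subseteq> W'" and v: "v \<in> carrier V"
  shows "(\<Union>a\<in>W +>\<^bsub>V\<^esub> v. W' +>\<^bsub>U\<^esub> h a) = W' +>\<^bsub>U\<^esub> h v"
proof -
  interpret U: Module.module scalars U by (rule U)
  interpret W': abelian_subgroup W' U
    using W' U.abelian_group_axioms
    by (intro abelian_subgroupI3 additive_subgroupI) (auto intro: submodule.axioms(1))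
  have "W' +>\<^bsub>U\<^esub> h a = W' +>\<^bsub>U\<^esub> h v" if a: "a \<in> W +>\<^bsub>V\<^esub> v" for a
  proof -
    have a': "a \<in> carrier V" using coset_subset[OF v] a by blast
    have "a \<ominus>\<^bsub>V\<^esub> v \<in> W" using coset_eqI[OF v a] coset_eq_iff[OF a' v] by simp
    then have "h a \<ominus>\<^bsub>U\<^esub> h v \<in> W'"
      using linear_maps_minus[OF V U h a' v] assms(4) by (metis image_subset_iff)
    then have "h a \<in> W' +>\<^bsub>U\<^esub> h v"
      using W'.a_rcos_module[of "h v" "h a"] linear_maps_closed[OF h] a' v
      by (simp add: a_minus_def)
    then show ?thesis
      using W'.a_repr_independence' linear_maps_closed[OF h v] by metis
  qed
  then show ?thesis using coset_self[OF v] by blast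
qed

lemma add_quot_rep:
  "v \<in> carrier V \<Longrightarrow> w \<in> carrier V \<Longrightarrow>
    (W +>\<^bsub>V\<^esub> v) \<oplus>\<^bsub>quot_rep V W\<^esub> (W +>\<^bsub>V\<^esub> w) = W +>\<^bsub>V\<^esub> (v \<oplus>\<^bsub>V\<^esub> w)"
  using a_rcos_sum[of v w] by (simp add: quot_rep_def)

lemma smult_quot_rep:
  assumes "v \<in> carrier V"
  shows "c \<odot>\<^bsub>quot_rep V W\<^esub> (W +>\<^bsub>V\<^esub> v) = W +>\<^bsub>V\<^esub> (c \<odot>\<^bsub>V\<^esub> v)"
  using coset_map[OF V W linear_maps_smult_const[OF V] _ assms, of c]
    submodule.smult_closed[OF W, of c] by (auto simp: quot_rep_def)

lemma act_quot_rep: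
  assumes "act V g \<in> linear_maps V V" "act V g ` W \<subseteq> W" "v \<in> carrier V"
  shows "act (quot_rep V W) g (W +>\<^bsub>V\<^esub> v) = W +>\<^bsub>V\<^esub> act V g v"
  using coset_map[OF V W assms] by (simp add: quot_rep_def)

lemma coset_linear: "(\<lambda>v. W +>\<^bsub>V\<^esub> v) \<in> linear_maps V (quot_rep V W)"
  by (rule linear_mapsI) (simp_all add: carrier_quot_rep add_quot_rep smult_quot_rep)

lemma vecspace_quot_rep: "vecspace (quot_rep V W)"
proof (rule vecspaceI)
  fix x y z :: "'v set" and c d
  assume "x \<in> carrier (quot_rep V W)"
  then obtain u where x: "x = W +>\<^bsub>V\<^esub> u" "u \<in> carrier V" by (auto simp: carrier_quot_rep)
  show "c \<odot>\<^bsub>quot_rep V W\<^esub> x \<in> carrier (quot_rep V W)"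
    "\<zero>\<^bsub>quot_rep V W\<^esub> \<oplus>\<^bsub>quot_rep V W\<^esub> x = x"
    "(c + d) \<odot>\<^bsub>quot_rep V W\<^esub> x =
       c \<odot>\<^bsub>quot_rep V W\<^esub> x \<oplus>\<^bsub>quot_rep V W\<^esub> d \<odot>\<^bsub>quot_rep V W\<^esub> x"
    "(c * d) \<odot>\<^bsub>quot_rep V W\<^esub> x = c \<odot>\<^bsub>quot_rep V W\<^esub> (d \<odot>\<^bsub>quot_rep V W\<^esub> x)"
    "1 \<odot>\<^bsub>quot_rep V W\<^esub> x = x" "0 \<odot>\<^bsub>quot_rep V W\<^esub> x = \<zero>\<^bsub>quot_rep V W\<^esub>"
    using x add_quot_rep[of "\<zero>\<^bsub>V\<^esub>" u]
    by (simp_all add: carrier_quot_rep add_quot_rep smult_quot_rep vecspace_simps[OF V]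
        zero_quot_rep coset_zero)
  assume "y \<in> carrier (quot_rep V W)"
  then obtain v where y: "y = W +>\<^bsub>V\<^esub> v" "v \<in> carrier V" by (auto simp: carrier_quot_rep)
  show "x \<oplus>\<^bsub>quot_rep V W\<^esub> y \<in> carrier (quot_rep V W)"
    "x \<oplus>\<^bsub>quot_rep V W\<^esub> y = y \<oplus>\<^bsub>quot_rep V W\<^esub> x"
    "c \<odot>\<^bsub>quot_rep V W\<^esub> (x \<oplus>\<^bsub>quot_rep V W\<^esub> y) =
       c \<odot>\<^bsub>quot_rep V W\<^esub> x \<oplus>\<^bsub>quot_rep V W\<^esub> c \<odot>\<^bsub>quot_rep V W\<^esub> y"
    using x y V.a_comm[of u v] V.a_comm[of "c \<odot>\<^bsub>V\<^esub> u" "c \<odot>\<^bsub>V\<^esub> v"]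
    by (simp_all add: carrier_quot_rep add_quot_rep smult_quot_rep vecspace_simps[OF V]
        V.smult_r_distr)
  assume "z \<in> carrier (quot_rep V W)"
  then obtain w where z: "z = W +>\<^bsub>V\<^esub> w" "w \<in> carrier V" by (auto simp: carrier_quot_rep)
  show "x \<oplus>\<^bsub>quot_rep V W\<^esub> y \<oplus>\<^bsub>quot_rep V W\<^esub> z = x \<oplus>\<^bsub>quot_rep V W\<^esub> (y \<oplus>\<^bsub>quot_rep V W\<^esub> z)"
    using x y z by (simp add: add_quot_rep V.a_assoc)
next
  show "\<zero>\<^bsub>quot_rep V W\<^esub> \<in> carrier (quot_rep V W)"
    using coset_zero by (force simp: zero_quot_rep carrier_quot_rep)
qed

lemma spans_quot_rep: "spans V S \<Longrightarrow> spans (quot_rep V W) ((\<lambda>v. W +>\<^bsub>V\<^esub> v) ` S)"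
  by (rule spans_image[OF _ V vecspace_quot_rep coset_linear]) (auto simp: carrier_quot_rep)

lemma quot_rep_induced:
  assumes U: "vecspace (U :: ('k, 'u, 'g) rep)" and h: "h \<in> linear_maps V U"
    and ker: "\<And>w. w \<in> W \<Longrightarrow> h w = \<zero>\<^bsub>U\<^esub>"
  obtains h' where "h' \<in> linear_maps (quot_rep V W) U"
    and "\<And>v. v \<in> carrier V \<Longrightarrow> h' (W +>\<^bsub>V\<^esub> v) = h v"
proof
  \<comment> \<open>A coset is sent to the value of \<open>h\<close> at a chosen element; since
    \<open>h\<close> kills \<open>W\<close>, every choice gives the same value.\<close>
  let ?h = "\<lambda>A. h (SOME a. a \<in> A)"
  show *: "?h (W +>\<^bsub>V\<^esub> v) = h v" if v: "v \<in> carrier V" for v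
  proof -
    define a where "a = (SOME a. a \<in> W +>\<^bsub>V\<^esub> v)"
    have a: "a \<in> W +>\<^bsub>V\<^esub> v" unfolding a_def using coset_self[OF v] by (rule someI)
    then have a': "a \<in> carrier V" using coset_subset[OF v] by blast
    have "a \<ominus>\<^bsub>V\<^esub> v \<in> W" using coset_eqI[OF v a] coset_eq_iff[OF a' v] by simp
    then have "h a \<ominus>\<^bsub>U\<^esub> h v = \<zero>\<^bsub>U\<^esub>" using ker linear_maps_minus[OF V U h a' v] by metis
    then show ?thesis
      using minus_eq_zero_iff[OF U linear_maps_closed[OF h a'] linear_maps_closed[OF h v]]
      by (simp add: a_def)
  qed
  show "?h \<in> linear_maps (quot_rep V W) U"
  proof (rule linear_mapsI)
    fix x y c assume "x \<in> carrier (quot_rep V W)"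
    then obtain u where x: "x = W +>\<^bsub>V\<^esub> u" "u \<in> carrier V" by (auto simp: carrier_quot_rep)
    show "?h x \<in> carrier U" using x * linear_maps_closed[OF h] by simp
    show "?h (c \<odot>\<^bsub>quot_rep V W\<^esub> x) = c \<odot>\<^bsub>U\<^esub> ?h x"
      unfolding x(1) smult_quot_rep[OF x(2)] using x(2)
      by (simp add: * linear_maps_smult[OF h])
    assume "y \<in> carrier (quot_rep V W)"
    then obtain v where y: "y = W +>\<^bsub>V\<^esub> v" "v \<in> carrier V" by (auto simp: carrier_quot_rep)
    show "?h (x \<oplus>\<^bsub>quot_rep V W\<^esub> y) = ?h x \<oplus>\<^bsub>U\<^esub> ?h y"
      unfolding x(1) y(1) add_quot_rep[OF x(2) y(2)] using x(2) y(2)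
      by (simp add: * linear_maps_add[OF h])
  qed
qed

end

text \<open>The group action on a quotient and the place permutations are instances of this union
  formula, with \<open>h\<close> the map before passing to the quotient.\<close>

lemma coset_map_linear:
  fixes V :: "('k::field, 'v, 'g) rep" and U :: "('k, 'u, 'g) rep"
  assumes V: "vecspace V" "submodule W scalars V" and U: "vecspace U" "submodule W' scalars U"
    and h: "h \<in> linear_maps V U" "h ` W \<subseteq> W'"
  shows "(\<lambda>A. \<Union>a\<in>A. W' +>\<^bsub>U\<^esub> h a) \<in> linear_maps (quot_rep V W) (quot_rep U W')"
proof (rule linear_mapsI)
  interpret V: Module.module scalars V by (rule V(1))
  note * = coset_map[OF V U h]
  fix x y c assume "x \<in> carrier (quot_rep V W)"
  then obtain u where x: "x = W +>\<^bsub>V\<^esub> u" "u \<in> carrier V" by (auto simp: carrier_quot_rep[OF V])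
  show "(\<Union>a\<in>x. W' +>\<^bsub>U\<^esub> h a) \<in> carrier (quot_rep U W')"
    using linear_maps_closed[OF h(1) x(2)]
    unfolding x(1) *[OF x(2)] by (simp add: carrier_quot_rep[OF U])
  show "(\<Union>a\<in>c \<odot>\<^bsub>quot_rep V W\<^esub> x. W' +>\<^bsub>U\<^esub> h a) = c \<odot>\<^bsub>quot_rep U W'\<^esub> (\<Union>a\<in>x. W' +>\<^bsub>U\<^esub> h a)"
    unfolding x(1) *[OF x(2)] smult_quot_rep[OF V x(2)] *[OF vecspace_simps(3)[OF V(1) x(2)]]
    using x(2) by (simp add: smult_quot_rep[OF U] linear_maps_closed[OF h(1)] linear_maps_smult[OF h(1)])
  assume "y \<in> carrier (quot_rep V W)"
  then obtain v where y: "y = W +>\<^bsub>V\<^esub> v" "v \<in> carrier V" by (auto simp: carrier_quot_rep[OF V])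
  show "(\<Union>a\<in>x \<oplus>\<^bsub>quot_rep V W\<^esub> y. W' +>\<^bsub>U\<^esub> h a) =
      (\<Union>a\<in>x. W' +>\<^bsub>U\<^esub> h a) \<oplus>\<^bsub>quot_rep U W'\<^esub> (\<Union>a\<in>y. W' +>\<^bsub>U\<^esub> h a)"
    unfolding x(1) y(1) *[OF x(2)] *[OF y(2)] add_quot_rep[OF V x(2) y(2)]
      *[OF V.a_closed[OF x(2) y(2)]]
    using x(2) y(2) by (simp add: add_quot_rep[OF U] linear_maps_closed[OF h(1)] linear_maps_add[OF h(1)])
qed

lemma representation_quot_rep:
  assumes rep: "representation G V" and W: "submodule W scalars V"
    and inv: "\<And>g. g \<in> carrier G \<Longrightarrow> act V g ` W \<subseteq> W"
  shows "representation G (quot_rep V W)"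
proof (rule representationI)
  note V = representation_vecspace[OF rep]
  interpret G: group G by (rule representation_group[OF rep])
  note act = act_quot_rep[OF V W act_linear_map[OF rep] inv]
  show "group G" by (rule G.group_axioms)
  show "vecspace (quot_rep V W)" by (rule vecspace_quot_rep[OF V W])
  show "spans (quot_rep V W) (carrier (quot_rep V W))" by (auto simp: spans_def)
  show "act (quot_rep V W) g \<in> linear_maps (quot_rep V W) (quot_rep V W)" if "g \<in> carrier G" for g
    using coset_map_linear[OF V W V W act_linear_map[OF rep that] inv[OF that]]
    by (simp add: quot_rep_def)
  fix x assume "x \<in> carrier (quot_rep V W)"
  then obtain u where x: "x = W +>\<^bsub>V\<^esub> u" "u \<in> carrier V" by (auto simp: carrier_quot_rep[OF V W])
  show "act (quot_rep V W) \<one>\<^bsub>G\<^esub> x = x"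
    using x by (simp add: act representation.act_one[OF rep])
  fix g h assume g: "g \<in> carrier G" "h \<in> carrier G"
  then show "act (quot_rep V W) (g \<otimes>\<^bsub>G\<^esub> h) x = act (quot_rep V W) g (act (quot_rep V W) h x)"
    using x by (simp add: act representation.act_mult[OF rep] representation.act_closed[OF rep])
qed

section \<open>Free vector spaces and linear extension\<close>

lemma free_rep_simps [simp]:
  "carrier (free_rep B \<alpha>) = {F. Poly_Mapping.keys F \<subseteq> B}" "\<zero>\<^bsub>free_rep B \<alpha>\<^esub> = 0"
  "x \<oplus>\<^bsub>free_rep B \<alpha>\<^esub> y = x + y" "c \<odot>\<^bsub>free_rep B \<alpha>\<^esub> x = Poly_Mapping.map ((*) c) x"
  "act (free_rep B \<alpha>) g = push (\<alpha> g)"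
  by (simp_all add: free_rep_def)

lemma lookup_map_times:
  "Poly_Mapping.lookup (Poly_Mapping.map ((*) (c::'k::field)) F) x = c * Poly_Mapping.lookup F x"
  by (simp add: Poly_Mapping.map.rep_eq when_def)

lemma keys_map_times:
  "Poly_Mapping.keys (Poly_Mapping.map ((*) (c::'k::field)) F) \<subseteq> Poly_Mapping.keys F"
  by (auto simp: in_keys_iff lookup_map_times)

lemma map_times_single:
  "Poly_Mapping.map ((*) (c::'k::field)) (Poly_Mapping.single x d) = Poly_Mapping.single x (c * d)"
  by (rule poly_mapping_eqI) (simp add: lookup_map_times lookup_single when_def)

lemma vecspace_free_rep: "vecspace (free_rep B \<alpha> :: ('k::field, 'b \<Rightarrow>\<^sub>0 'k, 'g) rep)"
proof (rule vecspaceI)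
  fix x y :: "'b \<Rightarrow>\<^sub>0 'k" and c
  assume x: "x \<in> carrier (free_rep B \<alpha>)"
  then show "c \<odot>\<^bsub>free_rep B \<alpha>\<^esub> x \<in> carrier (free_rep B \<alpha>)"
    using keys_map_times[of c x] by auto
  assume "y \<in> carrier (free_rep B \<alpha>)"
  then show "x \<oplus>\<^bsub>free_rep B \<alpha>\<^esub> y \<in> carrier (free_rep B \<alpha>)"
    using x Poly_Mapping.keys_add[of x y] by auto
qed (auto intro!: poly_mapping_eqI simp: lookup_map_times lookup_add algebra_simps)

text \<open>The defining relations are written with subtraction of finitely supported functions,
  equality of cosets with subtraction in the module; this reconciles the two.\<close>

lemma minus_free_rep:
  "x \<in> carrier (free_rep B \<alpha>) \<Longrightarrow> y \<in> carrier (free_rep B \<alpha>) \<Longrightarrow>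
    x \<ominus>\<^bsub>free_rep B \<alpha>\<^esub> y = x - (y :: 'b \<Rightarrow>\<^sub>0 'k::field)"
  by (subst vecspace_minus[OF vecspace_free_rep])
    (auto intro!: poly_mapping_eqI simp: lookup_map_times lookup_add lookup_minus)

lemma spans_free_rep:
  "spans (free_rep B \<alpha> :: ('k::field, 'b \<Rightarrow>\<^sub>0 'k, 'g) rep) ((\<lambda>b. Poly_Mapping.single b 1) ` B)"
  unfolding spans_def
proof (intro conjI allI impI subsetI)
  let ?V = "free_rep B \<alpha> :: ('k, 'b \<Rightarrow>\<^sub>0 'k, 'g) rep"
  interpret V: Module.module scalars ?V by (rule vecspace_free_rep)
  fix H F assume H: "submodule H scalars ?V \<and> (\<lambda>b. Poly_Mapping.single b 1) ` B \<subseteq> H"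
    and F: "F \<in> carrier ?V"
  have "(\<Sum>x\<in>A. Poly_Mapping.single x (Poly_Mapping.lookup F x)) \<in> H" if "finite A" "A \<subseteq> B" for A
    using that
  proof (induction A)
    case empty
    then show ?case using submodule_zero_closed[OF vecspace_free_rep] H by fastforce
  next
    case (insert a A)
    then have "Poly_Mapping.lookup F a \<odot>\<^bsub>?V\<^esub> Poly_Mapping.single a 1 \<in> H"
      using V.submoduleE(4)[of H "Poly_Mapping.lookup F a" "Poly_Mapping.single a 1"] H by auto
    then have "Poly_Mapping.single a (Poly_Mapping.lookup F a) \<in> H"
      by (simp add: map_times_single)
    then show ?case using insert V.submoduleE(5)[of H] H by auto
  qed
  moreover have "(\<Sum>x\<in>Poly_Mapping.keys F. Poly_Mapping.single x (Poly_Mapping.lookup F x)) = F"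
    by (rule poly_mapping_eqI) (simp add: lookup_sum lookup_single when_def in_keys_iff)
  ultimately show "F \<in> H" using F by (metis finite_keys free_rep_simps(1) mem_Collect_eq)
qed auto

definition lin_ext :: "('k::field, 'u, 'g) rep \<Rightarrow> ('b \<Rightarrow> 'u) \<Rightarrow> ('b \<Rightarrow>\<^sub>0 'k) \<Rightarrow> 'u" where
  "lin_ext U \<phi> F = (\<Oplus>\<^bsub>U\<^esub>x\<in>Poly_Mapping.keys F. Poly_Mapping.lookup F x \<odot>\<^bsub>U\<^esub> \<phi> x)"

context
  fixes U :: "('k::field, 'u, 'g) rep" and B :: "'b set" and \<phi>
  assumes U: "vecspace U" and \<phi>: "\<phi> \<in> B \<rightarrow> carrier U"
begin

interpretation U: Module.module scalars U by (rule U)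

text \<open>Elements outside the support contribute zero terms. Enlarging the index set lets formal
  sums with different supports be added over one common set.\<close>

lemma lin_ext_superset:
  assumes "finite A" "Poly_Mapping.keys F \<subseteq> A" "A \<subseteq> B"
  shows "lin_ext U \<phi> F = (\<Oplus>\<^bsub>U\<^esub>x\<in>A. Poly_Mapping.lookup F x \<odot>\<^bsub>U\<^esub> \<phi> x)"
  unfolding lin_ext_def
proof (rule U.add.finprod_mono_neutral_cong_left)
  show "\<And>i. i \<in> A - Poly_Mapping.keys F \<Longrightarrow> Poly_Mapping.lookup F i \<odot>\<^bsub>U\<^esub> \<phi> i = \<zero>\<^bsub>U\<^esub>"
    using assms(3) \<phi> by (auto simp: in_keys_iff vecspace_simps[OF U] Pi_def)
qed (use assms \<phi> in \<open>auto simp: vecspace_simps[OF U] Pi_def\<close>)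

lemma lin_ext_linear: "lin_ext U \<phi> \<in> linear_maps (free_rep B \<alpha>) U"
proof (rule linear_mapsI)
  fix F G :: "'b \<Rightarrow>\<^sub>0 'k" and c
  assume F: "F \<in> carrier (free_rep B \<alpha>)"
  have cl: "c \<odot>\<^bsub>U\<^esub> \<phi> x \<in> carrier U" if "x \<in> B" for x c
    using \<phi> that by (auto simp: vecspace_simps[OF U])
  show "lin_ext U \<phi> F \<in> carrier U"
    unfolding lin_ext_def using F cl by (intro U.finsum_closed) auto
  have "lin_ext U \<phi> (c \<odot>\<^bsub>free_rep B \<alpha>\<^esub> F) =
      (\<Oplus>\<^bsub>U\<^esub>x\<in>Poly_Mapping.keys F. c \<odot>\<^bsub>U\<^esub> (Poly_Mapping.lookup F x \<odot>\<^bsub>U\<^esub> \<phi> x))"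
    using F keys_map_times[of c F] \<phi> cl
    by (subst lin_ext_superset[of "Poly_Mapping.keys F"])
      (auto intro!: U.finsum_cong' simp: lookup_map_times vecspace_simps[OF U] Pi_def)
  also have "\<dots> = c \<odot>\<^bsub>U\<^esub> lin_ext U \<phi> F"
    unfolding lin_ext_def using F cl
    by (intro U.finsum_smult_ldistr[symmetric]) auto
  finally show "lin_ext U \<phi> (c \<odot>\<^bsub>free_rep B \<alpha>\<^esub> F) = c \<odot>\<^bsub>U\<^esub> lin_ext U \<phi> F" .
  assume G: "G \<in> carrier (free_rep B \<alpha>)"
  let ?A = "Poly_Mapping.keys F \<union> Poly_Mapping.keys G"
  have A: "finite ?A" "?A \<subseteq> B" using F G by auto
  have "lin_ext U \<phi> (F \<oplus>\<^bsub>free_rep B \<alpha>\<^esub> G) =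
      (\<Oplus>\<^bsub>U\<^esub>x\<in>?A. Poly_Mapping.lookup F x \<odot>\<^bsub>U\<^esub> \<phi> x \<oplus>\<^bsub>U\<^esub> Poly_Mapping.lookup G x \<odot>\<^bsub>U\<^esub> \<phi> x)"
    using A \<phi> cl Poly_Mapping.keys_add[of F G]
    by (subst lin_ext_superset[OF A(1) _ A(2)])
      (auto intro!: U.finsum_cong' simp: lookup_add vecspace_simps[OF U] Pi_def)
  also have "\<dots> = lin_ext U \<phi> F \<oplus>\<^bsub>U\<^esub> lin_ext U \<phi> G"
    using A cl by (subst U.finsum_addf) (auto simp: lin_ext_superset[OF A(1) _ A(2)])
  finally show "lin_ext U \<phi> (F \<oplus>\<^bsub>free_rep B \<alpha>\<^esub> G) = lin_ext U \<phi> F \<oplus>\<^bsub>U\<^esub> lin_ext U \<phi> G" .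
qed

lemma lin_ext_single: "b \<in> B \<Longrightarrow> lin_ext U \<phi> (Poly_Mapping.single b 1) = \<phi> b"
  using \<phi> by (subst lin_ext_superset[of "{b}"]) (auto simp: vecspace_simps[OF U] Pi_def)

end

lemma push_superset:
  assumes "finite A" "Poly_Mapping.keys F \<subseteq> A"
  shows "push h F = (\<Sum>x\<in>A. Poly_Mapping.single (h x) (Poly_Mapping.lookup F x))"
  unfolding push_def
  by (rule sum.mono_neutral_left) (use assms in \<open>auto simp: in_keys_iff\<close>)

lemma push_single [simp]: "push h (Poly_Mapping.single x c) = Poly_Mapping.single (h x) c"
  by (subst push_superset[of "{x}"]) auto

lemma push_linear:
  fixes \<alpha> :: "'g \<Rightarrow> 'a \<Rightarrow> 'a" and \<alpha>' :: "'g \<Rightarrow> 'b \<Rightarrow> 'b"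
  assumes "\<tau> ` B \<subseteq> B'"
  shows "push \<tau> \<in> linear_maps (free_rep B \<alpha>) (free_rep B' \<alpha>' :: ('k::field, _, 'g) rep)"
proof (rule linear_mapsI)
  fix F G :: "'a \<Rightarrow>\<^sub>0 'k" and c
  assume F: "F \<in> carrier (free_rep B \<alpha>)"
  have keys: "Poly_Mapping.keys (\<Sum>x\<in>A. Poly_Mapping.single (\<tau> x) (f x)) \<subseteq> B'"
    if "A \<subseteq> B" "finite A" for A and f :: "'a \<Rightarrow> 'k"
    using that(2,1)
  proof (induction A)
    case (insert a A)
    then show ?case
      using Poly_Mapping.keys_add[of "Poly_Mapping.single (\<tau> a) (f a)"
          "\<Sum>x\<in>A. Poly_Mapping.single (\<tau> x) (f x)"] assms by (auto split: if_splits)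
  qed auto
  show "push \<tau> F \<in> carrier (free_rep B' \<alpha>')"
    using F keys[of "Poly_Mapping.keys F"] by (simp add: push_def)
  have "Poly_Mapping.map ((*) c) (\<Sum>x\<in>A. Poly_Mapping.single (\<tau> x) (f x)) =
      (\<Sum>x\<in>A. Poly_Mapping.single (\<tau> x) (c * f x))" for A and f :: "'a \<Rightarrow> 'k"
    by (rule poly_mapping_eqI)
      (simp add: lookup_map_times lookup_sum sum_distrib_left lookup_single when_def if_distrib
        cong: if_cong)
  then show "push \<tau> (c \<odot>\<^bsub>free_rep B \<alpha>\<^esub> F) = c \<odot>\<^bsub>free_rep B' \<alpha>'\<^esub> push \<tau> F"
    using keys_map_times[of c F]
    by (subst (1 2) push_superset[of "Poly_Mapping.keys F"]) (auto simp: lookup_map_times)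
  show "push \<tau> (F \<oplus>\<^bsub>free_rep B \<alpha>\<^esub> G) = push \<tau> F \<oplus>\<^bsub>free_rep B' \<alpha>'\<^esub> push \<tau> G"
    using Poly_Mapping.keys_add[of F G]
    by (subst (1 2 3) push_superset[of "Poly_Mapping.keys F \<union> Poly_Mapping.keys G"])
      (auto simp: lookup_add single_add sum.distrib)
qed

section \<open>Tensor powers\<close>

lemma tuples_iff_nth: "xs \<in> tuples r V \<longleftrightarrow> length xs = r \<and> (\<forall>i<r. xs ! i \<in> carrier V)"
  by (auto simp: tuples_def in_set_conv_nth subset_iff)

lemma tuplesD: "xs \<in> tuples r V \<Longrightarrow> length xs = r" "xs \<in> tuples r V \<Longrightarrow> i < r \<Longrightarrow> xs ! i \<in> carrier V"
  by (simp_all add: tuples_iff_nth)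

lemma tuples_update: "xs \<in> tuples r V \<Longrightarrow> x \<in> carrier V \<Longrightarrow> xs[i := x] \<in> tuples r V"
  using set_update_subset_insert[of xs i x] by (auto simp: tuples_def)

text \<open>Linearity in one slot is phrased through list update, the same shape as the generators
  of \<open>multilinear_rels\<close>, so that the two can be matched directly.\<close>

definition multilinear ::
  "nat \<Rightarrow> ('k::field, 'v, 'g) rep \<Rightarrow> ('k, 'u, 'g) rep \<Rightarrow> ('v list \<Rightarrow> 'u) \<Rightarrow> bool" where
  "multilinear r V U \<phi> \<longleftrightarrow> \<phi> \<in> tuples r V \<rightarrow> carrier U \<and>
     (\<forall>xs\<in>tuples r V. \<forall>i<r. (\<lambda>x. \<phi> (xs[i := x])) \<in> linear_maps V U)"

lemma multilinearD:
  assumes "multilinear r V U \<phi>" "xs \<in> tuples r V"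
  shows "\<phi> xs \<in> carrier U"
    and "i < r \<Longrightarrow> (\<lambda>x. \<phi> (xs[i := x])) \<in> linear_maps V U"
  using assms by (auto simp: multilinear_def)

lemma multilinearI:
  assumes "\<And>xs. xs \<in> tuples r V \<Longrightarrow> \<phi> xs \<in> carrier U"
    and "\<And>xs i x y. xs \<in> tuples r V \<Longrightarrow> i < r \<Longrightarrow> x \<in> carrier V \<Longrightarrow> y \<in> carrier V \<Longrightarrow>
      \<phi> (xs[i := x \<oplus>\<^bsub>V\<^esub> y]) = \<phi> (xs[i := x]) \<oplus>\<^bsub>U\<^esub> \<phi> (xs[i := y])"
    and "\<And>xs i c x. xs \<in> tuples r V \<Longrightarrow> i < r \<Longrightarrow> x \<in> carrier V \<Longrightarrow>
      \<phi> (xs[i := c \<odot>\<^bsub>V\<^esub> x]) = c \<odot>\<^bsub>U\<^esub> \<phi> (xs[i := x])"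
  shows "multilinear r V U \<phi>"
  unfolding multilinear_def using assms
  by (intro conjI ballI allI impI Pi_I linear_mapsI) (simp_all add: tuples_update)

lemma multilinear_cong:
  assumes "vecspace V" "multilinear r V U \<phi>" "\<And>xs. xs \<in> tuples r V \<Longrightarrow> \<psi> xs = \<phi> xs"
  shows "multilinear r V U \<psi>"
proof (rule multilinearI)
  interpret V: Module.module scalars V by fact
  fix xs assume xs: "xs \<in> tuples r V"
  show "\<psi> xs \<in> carrier U" using assms(3)[OF xs] multilinearD(1)[OF assms(2) xs] by simp
  fix i x c assume i: "i < r" and x: "x \<in> carrier V"
  show "\<psi> (xs[i := c \<odot>\<^bsub>V\<^esub> x]) = c \<odot>\<^bsub>U\<^esub> \<psi> (xs[i := x])"
    using linear_maps_smult[OF multilinearD(2)[OF assms(2) xs i] x] assms(3) tuples_update[OF xs] x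
      vecspace_simps(3)[OF assms(1) x] by simp
  fix y assume y: "y \<in> carrier V"
  show "\<psi> (xs[i := x \<oplus>\<^bsub>V\<^esub> y]) = \<psi> (xs[i := x]) \<oplus>\<^bsub>U\<^esub> \<psi> (xs[i := y])"
    using linear_maps_add[OF multilinearD(2)[OF assms(2) xs i] x y] assms(3) tuples_update[OF xs] x y
    by simp
qed

lemma multilinear_linear_comp:
  assumes "multilinear r V U \<phi>" "h \<in> linear_maps U U'"
  shows "multilinear r V U' (\<lambda>xs. h (\<phi> xs))"
  unfolding multilinear_def
proof (intro conjI ballI allI impI Pi_I)
  show "h (\<phi> xs) \<in> carrier U'" if "xs \<in> tuples r V" for xs
    using linear_maps_closed[OF assms(2) multilinearD(1)[OF assms(1) that]] .
  show "(\<lambda>x. h (\<phi> (xs[i := x]))) \<in> linear_maps V U'" if "xs \<in> tuples r V" "i < r" for xs i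
    using linear_maps_comp[OF multilinearD(2)[OF assms(1) that] assms(2)] .
qed

text \<open>Each slot carries its own linear map \<open>\<mu> i\<close>. A constant family gives the
  group action on tensors, and multiplication by varying monomials gives the Wronskian map.\<close>

lemma multilinear_map:
  assumes \<phi>: "multilinear r W U \<phi>" and \<mu>: "\<And>i. i < r \<Longrightarrow> \<mu> i \<in> linear_maps V W"
  shows "multilinear r V U (\<lambda>xs. \<phi> (map (\<lambda>i. \<mu> i (xs ! i)) [0..<r]))"
  unfolding multilinear_def
proof (intro conjI ballI allI impI Pi_I)
  fix xs assume xs: "xs \<in> tuples r V"
  then have t: "map (\<lambda>i. \<mu> i (xs ! i)) [0..<r] \<in> tuples r W"
    using linear_maps_closed[OF \<mu>] by (auto simp: tuples_iff_nth)
  then show "\<phi> (map (\<lambda>i. \<mu> i (xs ! i)) [0..<r]) \<in> carrier U" using \<phi> by (rule multilinearD(1)[rotated])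
  fix i assume i: "i < r"
  have "map (\<lambda>k. \<mu> k (xs[i := x] ! k)) [0..<r] = (map (\<lambda>i. \<mu> i (xs ! i)) [0..<r])[i := \<mu> i x]" for x
    using tuplesD(1)[OF xs] i by (intro nth_equalityI) (auto simp: nth_list_update)
  then show "(\<lambda>x. \<phi> (map (\<lambda>k. \<mu> k (xs[i := x] ! k)) [0..<r])) \<in> linear_maps V U"
    using linear_maps_comp[OF \<mu>[OF i] multilinearD(2)[OF \<phi> t i]] by simp
qed

text \<open>Position \<open>k\<close> of the permuted list holds entry \<open>\<sigma> k\<close> of
  the original, so the entry at \<open>i\<close> moves to the position that \<open>\<sigma>\<close>
  sends to \<open>i\<close>.\<close>

lemma permute_list_update:
  assumes "\<sigma> permutes {..<length xs}" "i < length xs"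
  shows "permute_list \<sigma> (xs[i := x]) = (permute_list \<sigma> xs)[inv_into UNIV \<sigma> i := x]"
proof (rule nth_equalityI)
  fix k assume "k < length (permute_list \<sigma> (xs[i := x]))"
  then have k: "k < length xs" by simp
  have "\<sigma> k < length xs" using permutes_in_image[OF assms(1), of k] k by simp
  moreover have "\<sigma> k = i \<longleftrightarrow> k = inv_into UNIV \<sigma> i"
    using permutes_inverses[OF assms(1)] by metis
  ultimately show "permute_list \<sigma> (xs[i := x]) ! k = (permute_list \<sigma> xs)[inv_into UNIV \<sigma> i := x] ! k"
    using k assms by (cases "\<sigma> k = i") (auto simp: permute_list_nth nth_list_update)
qed simp

lemma tuples_permute_list: "xs \<in> tuples r V \<Longrightarrow> \<sigma> permutes {..<r} \<Longrightarrow> permute_list \<sigma> xs \<in> tuples r V"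
  using mset_permute_list[of \<sigma> xs] by (auto simp: tuples_def)

lemma multilinear_permute_list:
  assumes \<phi>: "multilinear r V U \<phi>" and \<sigma>: "\<sigma> permutes {..<r}"
  shows "multilinear r V U (\<lambda>xs. \<phi> (permute_list \<sigma> xs))"
  unfolding multilinear_def
proof (intro conjI ballI allI impI Pi_I)
  fix xs assume xs: "xs \<in> tuples r V"
  note t = tuples_permute_list[OF xs \<sigma>]
  show "\<phi> (permute_list \<sigma> xs) \<in> carrier U" using multilinearD(1)[OF \<phi> t] .
  fix i assume i: "i < r"
  have "inv_into UNIV \<sigma> i < r" using permutes_in_image[OF permutes_inv[OF \<sigma>], of i] i by simp
  from multilinearD(2)[OF \<phi> t this]
  show "(\<lambda>x. \<phi> (permute_list \<sigma> (xs[i := x]))) \<in> linear_maps V U"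
    using \<sigma> i tuplesD(1)[OF xs] by (simp add: permute_list_update)
qed

lemma vecspace_free_tuples: "vecspace (free_tuples r V)"
  by (simp add: free_tuples_def vecspace_free_rep)

lemma single_in_free_tuples:
  "xs \<in> tuples r V \<Longrightarrow> Poly_Mapping.single xs c \<in> carrier (free_tuples r V)"
  by (auto simp: free_tuples_def)

lemma minus_free_tuples:
  "x \<in> carrier (free_tuples r V) \<Longrightarrow> y \<in> carrier (free_tuples r V) \<Longrightarrow>
    x \<ominus>\<^bsub>free_tuples r V\<^esub> y = x - y"
  unfolding free_tuples_def by (rule minus_free_rep)

context
  fixes V :: "('k::field, 'v, 'g) rep"
  assumes V: "vecspace V"
begin

interpretation V: Module.module scalars V by (rule V)

definition multilinear_gens :: "nat \<Rightarrow> ('v list \<Rightarrow>\<^sub>0 'k) set" where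
  "multilinear_gens r =
     {Poly_Mapping.single (xs[i := x \<oplus>\<^bsub>V\<^esub> y]) 1
        - Poly_Mapping.single (xs[i := x]) 1 - Poly_Mapping.single (xs[i := y]) 1 | xs i x y.
        xs \<in> tuples r V \<and> i < r \<and> x \<in> carrier V \<and> y \<in> carrier V} \<union>
      {Poly_Mapping.single (xs[i := c \<odot>\<^bsub>V\<^esub> x]) 1 - Poly_Mapping.single (xs[i := x]) c | xs i c x.
        xs \<in> tuples r V \<and> i < r \<and> x \<in> carrier V}"

lemma multilinear_rels_eq: "multilinear_rels r V = lin_span (free_tuples r V) (multilinear_gens r)"
  unfolding multilinear_rels_def multilinear_gens_def ..

lemma multilinear_gens_subset: "multilinear_gens r \<subseteq> carrier (free_tuples r V)"
proof -
  have minus: "a - b \<in> carrier (free_tuples r V)"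
    if "a \<in> carrier (free_tuples r V)" "b \<in> carrier (free_tuples r V)" for a b
    using keys_diff[of a b] that by (auto simp: free_tuples_def)
  show ?thesis
    unfolding multilinear_gens_def
    by (auto intro!: minus single_in_free_tuples tuples_update simp: vecspace_simps[OF V])
qed

lemma submodule_multilinear_rels: "submodule (multilinear_rels r V) scalars (free_tuples r V)"
  unfolding multilinear_rels_eq
  by (rule submodule_lin_span[OF vecspace_free_tuples multilinear_gens_subset])

text \<open>Multilinearity on the basis tuples says precisely that \<open>h\<close> vanishes on each
  generator. Its kernel is a subspace, hence contains their span.\<close>

lemma multilinear_rels_kernel:
  assumes U: "vecspace (U :: ('k, 'u, 'g) rep)" and h: "h \<in> linear_maps (free_tuples r V) U"
    and \<phi>: "multilinear r V U (\<lambda>xs. h (Poly_Mapping.single xs 1))"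
    and w: "w \<in> multilinear_rels r V"
  shows "h w = \<zero>\<^bsub>U\<^esub>"
proof -
  interpret U: Module.module scalars U by (rule U)
  have minus: "h (a - b) = h a \<ominus>\<^bsub>U\<^esub> h b"
    if "a \<in> carrier (free_tuples r V)" "b \<in> carrier (free_tuples r V)" for a b
    using linear_maps_minus[OF vecspace_free_tuples U h that] that
    by (simp add: free_tuples_def minus_free_rep)
  have minus': "a - b \<in> carrier (free_tuples r V)"
    if "a \<in> carrier (free_tuples r V)" "b \<in> carrier (free_tuples r V)" for a b
    using keys_diff[of a b] that by (auto simp: free_tuples_def)
  note sng = single_in_free_tuples
  have single: "h (Poly_Mapping.single xs c) = c \<odot>\<^bsub>U\<^esub> h (Poly_Mapping.single xs 1)"
    if "xs \<in> tuples r V" for xs c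
    using linear_maps_smult[OF h sng[OF that, of 1], of c]
    by (simp add: free_tuples_def map_times_single)
  have "h w \<in> {\<zero>\<^bsub>U\<^esub>}"
    using w unfolding multilinear_rels_eq
  proof (rule lin_span_image[OF vecspace_free_tuples U h submodule_zero[OF U] multilinear_gens_subset, rotated],
      intro image_subsetI)
    fix a assume "a \<in> multilinear_gens r"
    then show "h a \<in> {\<zero>\<^bsub>U\<^esub>}"
      unfolding multilinear_gens_def
    proof (elim UnE CollectE exE conjE)
      fix xs i x y assume a: "a = Poly_Mapping.single (xs[i := x \<oplus>\<^bsub>V\<^esub> y]) 1
        - Poly_Mapping.single (xs[i := x]) 1 - Poly_Mapping.single (xs[i := y]) 1"
        and xs: "xs \<in> tuples r V" "i < r" "x \<in> carrier V" "y \<in> carrier V"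
      note up = tuples_update[OF xs(1)]
      have cl: "h (Poly_Mapping.single (xs[i := z]) 1) \<in> carrier U" if "z \<in> carrier V" for z
        using linear_maps_closed[OF h sng[OF up[OF that]]] .
      have ha: "h a = (h (Poly_Mapping.single (xs[i := x]) 1) \<oplus>\<^bsub>U\<^esub> h (Poly_Mapping.single (xs[i := y]) 1))
          \<ominus>\<^bsub>U\<^esub> h (Poly_Mapping.single (xs[i := x]) 1) \<ominus>\<^bsub>U\<^esub> h (Poly_Mapping.single (xs[i := y]) 1)"
        using linear_maps_add[OF multilinearD(2)[OF \<phi> xs(1,2)] xs(3,4)] xs(3,4)
        unfolding a by (simp add: minus minus' sng up)
      have sum: "(p \<oplus>\<^bsub>U\<^esub> q) \<ominus>\<^bsub>U\<^esub> p \<ominus>\<^bsub>U\<^esub> q = \<zero>\<^bsub>U\<^esub>" if "p \<in> carrier U" "q \<in> carrier U" for p q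
        using U.a_assoc[of "p \<oplus>\<^bsub>U\<^esub> q" "\<ominus>\<^bsub>U\<^esub> p" "\<ominus>\<^bsub>U\<^esub> q"] U.minus_add[OF that]
          U.r_neg[of "p \<oplus>\<^bsub>U\<^esub> q"] that by (simp add: a_minus_def del: U.a_assoc)
      show ?thesis unfolding ha using sum[OF cl[OF xs(3)] cl[OF xs(4)]] by simp
    next
      fix xs i c x assume a: "a = Poly_Mapping.single (xs[i := c \<odot>\<^bsub>V\<^esub> x]) 1 -
          Poly_Mapping.single (xs[i := x]) c"
        and xs: "xs \<in> tuples r V" "i < r" "x \<in> carrier V"
      note up = tuples_update[OF xs(1)]
      have "h a = c \<odot>\<^bsub>U\<^esub> h (Poly_Mapping.single (xs[i := x]) 1) \<ominus>\<^bsub>U\<^esub> c \<odot>\<^bsub>U\<^esub> h (Poly_Mapping.single (xs[i := x]) 1)"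
        using linear_maps_smult[OF multilinearD(2)[OF \<phi> xs(1,2)] xs(3), of c] xs(3)
        unfolding a by (simp add: minus sng up single[OF up[OF xs(3)], where c = c] vecspace_simps[OF V])
      then show ?thesis
        using linear_maps_closed[OF h sng[OF up[OF xs(3)]]]
        by (simp add: a_minus_def U.r_neg vecspace_simps(3)[OF U])
    qed
  qed
  then show ?thesis by simp
qed

lemma tensor_coset:
  "xs \<in> tuples r V \<Longrightarrow>
    tensor V xs = multilinear_rels r V +>\<^bsub>free_tuples r V\<^esub> Poly_Mapping.single xs 1"
  using tuplesD(1)[of xs r V] by (auto simp: tensor_def)

lemma vecspace_tensor_power: "vecspace (tensor_power r V)"
  unfolding tensor_power_def by (rule vecspace_quot_rep[OF vecspace_free_tuples submodule_multilinear_rels])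

lemma tensor_closed: "xs \<in> tuples r V \<Longrightarrow> tensor V xs \<in> carrier (tensor_power r V)"
  unfolding tensor_power_def carrier_quot_rep[OF vecspace_free_tuples submodule_multilinear_rels]
  by (auto simp: tensor_coset single_in_free_tuples)

lemma multilinear_tensor: "multilinear r V (tensor_power r V) (tensor V)"
proof (rule multilinearI)
  note Q = vecspace_free_tuples submodule_multilinear_rels
  interpret F: Module.module scalars "free_tuples r V" by (rule Q(1))
  note sng = single_in_free_tuples
  fix xs assume xs: "xs \<in> tuples r V"
  then show "tensor V xs \<in> carrier (tensor_power r V)" by (rule tensor_closed)
  note up = tuples_update[OF xs]
  fix i x c assume i: "i < r" and x: "x \<in> carrier V"
  have "Poly_Mapping.single (xs[i := c \<odot>\<^bsub>V\<^esub> x]) 1 - Poly_Mapping.single (xs[i := x]) c \<in> multilinear_rels r V"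
    unfolding multilinear_rels_eq multilinear_gens_def using xs i x
    by (intro subsetD[OF lin_span_superset]) blast
  then have "Poly_Mapping.single (xs[i := c \<odot>\<^bsub>V\<^esub> x]) 1
      \<ominus>\<^bsub>free_tuples r V\<^esub> Poly_Mapping.single (xs[i := x]) c \<in> multilinear_rels r V"
    using sng[OF up] x vecspace_simps(3)[OF V x] by (simp add: minus_free_tuples)
  then have "tensor V (xs[i := c \<odot>\<^bsub>V\<^esub> x]) =
      multilinear_rels r V +>\<^bsub>free_tuples r V\<^esub> Poly_Mapping.single (xs[i := x]) c"
    using coset_eq_iff[OF Q sng[OF up] sng[OF up]] x vecspace_simps(3)[OF V x]
    by (simp add: tensor_coset[OF up])
  also have "Poly_Mapping.single (xs[i := x]) c = c \<odot>\<^bsub>free_tuples r V\<^esub> Poly_Mapping.single (xs[i := x]) 1"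
    by (simp add: free_tuples_def map_times_single)
  finally show "tensor V (xs[i := c \<odot>\<^bsub>V\<^esub> x]) = c \<odot>\<^bsub>tensor_power r V\<^esub> tensor V (xs[i := x])"
    using x unfolding tensor_power_def
    by (simp only: tensor_coset[OF up] smult_quot_rep[OF Q sng[OF up]])
  fix y assume y: "y \<in> carrier V"
  have "Poly_Mapping.single (xs[i := x \<oplus>\<^bsub>V\<^esub> y]) 1
        - Poly_Mapping.single (xs[i := x]) 1 - Poly_Mapping.single (xs[i := y]) 1 \<in> multilinear_rels r V"
    unfolding multilinear_rels_eq multilinear_gens_def using xs i x y
    by (intro subsetD[OF lin_span_superset]) blast
  then have "Poly_Mapping.single (xs[i := x \<oplus>\<^bsub>V\<^esub> y]) 1 \<ominus>\<^bsub>free_tuples r V\<^esub>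
      (Poly_Mapping.single (xs[i := x]) 1 \<oplus>\<^bsub>free_tuples r V\<^esub> Poly_Mapping.single (xs[i := y]) 1)
      \<in> multilinear_rels r V"
    using sng[OF up] x y F.a_closed[OF sng[OF up] sng[OF up], OF x y]
    by (simp add: minus_free_tuples) (simp add: free_tuples_def diff_diff_eq)
  then have "tensor V (xs[i := x \<oplus>\<^bsub>V\<^esub> y]) = multilinear_rels r V +>\<^bsub>free_tuples r V\<^esub>
      (Poly_Mapping.single (xs[i := x]) 1 \<oplus>\<^bsub>free_tuples r V\<^esub> Poly_Mapping.single (xs[i := y]) 1)"
    using coset_eq_iff[OF Q sng[OF up[OF V.a_closed[OF x y]]] F.a_closed
      [OF sng[OF up] sng[OF up], OF x y]] x y
    by (simp add: tensor_coset[OF up])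
  then show "tensor V (xs[i := x \<oplus>\<^bsub>V\<^esub> y]) =
      tensor V (xs[i := x]) \<oplus>\<^bsub>tensor_power r V\<^esub> tensor V (xs[i := y])"
    unfolding tensor_power_def tensor_coset[OF up[OF x]] tensor_coset[OF up[OF y]]
      add_quot_rep[OF Q sng[OF up[OF x]] sng[OF up[OF y]]] .
qed

lemma spans_tensor_power: "spans (tensor_power r V) (tensor V ` tuples r V)"
proof -
  have "spans (tensor_power r V) ((\<lambda>F. multilinear_rels r V +>\<^bsub>free_tuples r V\<^esub> F) `
      (\<lambda>xs. Poly_Mapping.single xs 1) ` tuples r V)"
    unfolding tensor_power_def using spans_free_rep
    by (intro spans_quot_rep[OF vecspace_free_tuples submodule_multilinear_rels])
      (simp add: free_tuples_def)
  also have "(\<lambda>F. multilinear_rels r V +>\<^bsub>free_tuples r V\<^esub> F) `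
      (\<lambda>xs. Poly_Mapping.single xs 1) ` tuples r V = tensor V ` tuples r V"
    by (auto simp: image_iff tensor_coset)
  finally show ?thesis .
qed

text \<open>The linear extension of \<open>\<phi>\<close> to formal sums of tuples kills the
  multilinearity relations and so descends. From this universal property arise the evaluation
  functionals and the Wronskian map.\<close>

lemma tensor_power_induced:
  assumes U: "vecspace (U :: ('k, 'u, 'g) rep)" and \<phi>: "multilinear r V U \<phi>"
  obtains h where "h \<in> linear_maps (tensor_power r V) U"
    and "\<And>xs. xs \<in> tuples r V \<Longrightarrow> h (tensor V xs) = \<phi> xs"
proof -
  have Pi: "\<phi> \<in> tuples r V \<rightarrow> carrier U" using \<phi> by (simp add: multilinear_def)
  note single = lin_ext_single[OF U Pi]
  have lin: "lin_ext U \<phi> \<in> linear_maps (free_tuples r V) U"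
    unfolding free_tuples_def by (rule lin_ext_linear[OF U Pi])
  have "multilinear r V U (\<lambda>xs. lin_ext U \<phi> (Poly_Mapping.single xs 1))"
    by (rule multilinear_cong[OF V \<phi> single])
  then obtain h where h: "h \<in> linear_maps (tensor_power r V) U"
    and "\<And>F. F \<in> carrier (free_tuples r V) \<Longrightarrow>
      h (multilinear_rels r V +>\<^bsub>free_tuples r V\<^esub> F) = lin_ext U \<phi> F"
    using quot_rep_induced[OF vecspace_free_tuples submodule_multilinear_rels U lin]
      multilinear_rels_kernel[OF U lin] unfolding tensor_power_def by metis
  then show thesis
    using that[OF h] by (simp add: tensor_coset single single_in_free_tuples)
qed

lemma spans_tensor_power_gens:
  assumes S: "spans V S"
  shows "spans (tensor_power r V) (tensor V ` {xs. length xs = r \<and> set xs \<subseteq> S})"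
proof (rule spans_trans[OF spans_tensor_power])
  have S': "S \<subseteq> carrier V" using spans_subset[OF S] .
  show "tensor V ` {xs. length xs = r \<and> set xs \<subseteq> S} \<subseteq> carrier (tensor_power r V)"
    using S' by (auto intro!: tensor_closed simp: tuples_def)
  fix H assume H: "submodule H scalars (tensor_power r V)"
    and gens: "tensor V ` {xs. length xs = r \<and> set xs \<subseteq> S} \<subseteq> H"
  \<comment> \<open>Induction on the number \<open>k\<close> of leading slots that may hold
    arbitrary vectors. A further slot is freed by linearity there: the vectors whose insertion lands
    in \<open>H\<close> form a subspace containing \<open>S\<close>.\<close>
  have "tensor V xs \<in> H" if "k \<le> r" "xs \<in> tuples r V" "\<forall>i\<in>{k..<r}. xs ! i \<in> S" for k xs
    using that
  proof (induction k arbitrary: xs)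
    case 0
    then have "length xs = r" "set xs \<subseteq> S" by (auto simp: tuples_def in_set_conv_nth)
    then show ?case using gens by blast
  next
    case (Suc k)
    have lin: "(\<lambda>x. tensor V (xs[k := x])) \<in> linear_maps V (tensor_power r V)"
      using multilinearD(2)[OF multilinear_tensor Suc.prems(2), of k] Suc.prems(1) by simp
    have "carrier V \<subseteq> {x \<in> carrier V. tensor V (xs[k := x]) \<in> H}"
    proof (rule spans_submodule[OF S submodule_vimage[OF V vecspace_tensor_power lin H]], intro subsetI)
      fix s assume s: "s \<in> S"
      have "tensor V (xs[k := s]) \<in> H"
        using Suc.prems s S' tuplesD(1)[OF Suc.prems(2)]
        by (intro Suc.IH tuples_update) (auto simp: nth_list_update)
      then show "s \<in> {x \<in> carrier V. tensor V (xs[k := x]) \<in> H}" using s S' by auto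
    qed
    moreover have "xs ! k \<in> carrier V" using tuplesD(2)[OF Suc.prems(2)] Suc.prems(1) by simp
    ultimately have "tensor V (xs[k := xs ! k]) \<in> H" by blast
    then show ?case by simp
  qed
  from this[of r] show "tensor V ` tuples r V \<subseteq> H" by auto
qed

end

text \<open>A map of tuples descends to tensor powers as soon as its composite with
  \<open>tensor\<close> is multilinear. Entrywise action of a group element and permutation of the
  entries are the two instances.\<close>

lemma tensor_push:
  fixes V V' :: "('k::field, 'v, 'g) rep"
  assumes V: "vecspace V" and V': "vecspace V'"
    and \<tau>: "\<tau> \<in> tuples r V \<rightarrow> tuples r V'"
    and ml: "multilinear r V (tensor_power r V') (\<lambda>xs. tensor V' (\<tau> xs))"
  shows "push \<tau> ` multilinear_rels r V \<subseteq> multilinear_rels r V'"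
    and "(\<lambda>A. \<Union>F\<in>A. multilinear_rels r V' +>\<^bsub>free_tuples r V'\<^esub> push \<tau> F)
      \<in> linear_maps (tensor_power r V) (tensor_power r V')"
    and "xs \<in> tuples r V \<Longrightarrow>
      (\<Union>F\<in>tensor V xs. multilinear_rels r V' +>\<^bsub>free_tuples r V'\<^esub> push \<tau> F) = tensor V' (\<tau> xs)"
proof -
  note Q = vecspace_free_tuples submodule_multilinear_rels[OF V]
  note Q' = vecspace_free_tuples submodule_multilinear_rels[OF V']
  have lin: "push \<tau> \<in> linear_maps (free_tuples r V) (free_tuples r V')"
    unfolding free_tuples_def using \<tau> by (intro push_linear) auto
  have comp: "(\<lambda>F. multilinear_rels r V' +>\<^bsub>free_tuples r V'\<^esub> push \<tau> F)
      \<in> linear_maps (free_tuples r V) (tensor_power r V')"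
    unfolding tensor_power_def by (rule linear_maps_comp[OF lin coset_linear[OF Q']])
  have coset: "multilinear_rels r V' +>\<^bsub>free_tuples r V'\<^esub> push \<tau> (Poly_Mapping.single xs 1) = tensor V' (\<tau> xs)"
    if "xs \<in> tuples r V" for xs
    using funcset_mem[OF \<tau> that] by (simp add: tensor_coset[OF V'])
  have "multilinear r V (tensor_power r V')
      (\<lambda>xs. multilinear_rels r V' +>\<^bsub>free_tuples r V'\<^esub> push \<tau> (Poly_Mapping.single xs 1))"
    by (rule multilinear_cong[OF V ml coset])
  note ker = multilinear_rels_kernel[OF V vecspace_tensor_power[OF V'] comp this]
  show *: "push \<tau> ` multilinear_rels r V \<subseteq> multilinear_rels r V'"
  proof (rule image_subsetI)
    fix w assume w: "w \<in> multilinear_rels r V"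
    then have "w \<in> carrier (free_tuples r V)" using submodule_subset[OF Q(2)] by blast
    then have cl: "push \<tau> w \<in> carrier (free_tuples r V')" by (rule linear_maps_closed[OF lin])
    \<comment> \<open>The coset of \<open>push \<tau> w\<close> is the zero of the quotient, which
      as a set is \<open>multilinear_rels r V'\<close>; and an element lies in its own
      coset.\<close>
    show "push \<tau> w \<in> multilinear_rels r V'"
      using ker[OF w] coset_self[OF Q' cl] by (simp add: tensor_power_def zero_quot_rep[OF Q'])
  qed
  show "(\<lambda>A. \<Union>F\<in>A. multilinear_rels r V' +>\<^bsub>free_tuples r V'\<^esub> push \<tau> F)
      \<in> linear_maps (tensor_power r V) (tensor_power r V')"
    unfolding tensor_power_def by (rule coset_map_linear[OF Q Q' lin *])
  show "(\<Union>F\<in>tensor V xs. multilinear_rels r V' +>\<^bsub>free_tuples r V'\<^esub> push \<tau> F) = tensor V' (\<tau> xs)"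
    if xs: "xs \<in> tuples r V"
    using coset_map[OF Q Q' lin * single_in_free_tuples[OF xs]] coset[OF xs]
    by (simp add: tensor_coset[OF V xs])
qed

lemma map_eq_map_nth: "length xs = r \<Longrightarrow> map h xs = map (\<lambda>i. h (xs ! i)) [0..<r]"
  by (auto intro: nth_equalityI)

lemma act_tensor_power:
  assumes V: "vecspace V" and lin: "act V g \<in> linear_maps V V"
  shows "act (tensor_power r V) g \<in> linear_maps (tensor_power r V) (tensor_power r V)"
    and "xs \<in> tuples r V \<Longrightarrow> act (tensor_power r V) g (tensor V xs) = tensor V (map (act V g) xs)"
proof -
  have \<tau>: "map (act V g) \<in> tuples r V \<rightarrow> tuples r V"
    using linear_maps_closed[OF lin] by (auto simp: tuples_def subset_iff)
  have "multilinear r V (tensor_power r V) (\<lambda>xs. tensor V (map (\<lambda>i. act V g (xs ! i)) [0..<r]))"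
    by (rule multilinear_map[OF multilinear_tensor[OF V] lin])
  then have ml: "multilinear r V (tensor_power r V) (\<lambda>xs. tensor V (map (act V g) xs))"
    by (rule multilinear_cong[OF V]) (simp only: map_eq_map_nth[OF tuplesD(1)])
  have eq: "act (tensor_power r V) g =
      (\<lambda>A. \<Union>F\<in>A. multilinear_rels r V +>\<^bsub>free_tuples r V\<^esub> push (map (act V g)) F)"
    by (simp add: tensor_power_def quot_rep_def free_tuples_def)
  show "act (tensor_power r V) g \<in> linear_maps (tensor_power r V) (tensor_power r V)"
    unfolding eq by (rule tensor_push(2)[OF V V \<tau> ml])
  show "xs \<in> tuples r V \<Longrightarrow> act (tensor_power r V) g (tensor V xs) = tensor V (map (act V g) xs)"
    unfolding eq by (rule tensor_push(3)[OF V V \<tau> ml])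
qed

lemma place_perm_tensor:
  assumes V: "vecspace V" and \<sigma>: "\<sigma> permutes {..<r}"
  shows "place_perm r V \<sigma> \<in> linear_maps (tensor_power r V) (tensor_power r V)"
    and "xs \<in> tuples r V \<Longrightarrow> place_perm r V \<sigma> (tensor V xs) = tensor V (permute_list \<sigma> xs)"
proof -
  have \<tau>: "permute_list \<sigma> \<in> tuples r V \<rightarrow> tuples r V"
    using tuples_permute_list[OF _ \<sigma>] by auto
  note ml = multilinear_permute_list[OF multilinear_tensor[OF V] \<sigma>]
  have eq: "place_perm r V \<sigma> =
      (\<lambda>A. \<Union>F\<in>A. multilinear_rels r V +>\<^bsub>free_tuples r V\<^esub> push (permute_list \<sigma>) F)"
    by (simp add: place_perm_def fun_eq_iff)
  show "place_perm r V \<sigma> \<in> linear_maps (tensor_power r V) (tensor_power r V)"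
    unfolding eq by (rule tensor_push(2)[OF V V \<tau> ml])
  show "xs \<in> tuples r V \<Longrightarrow> place_perm r V \<sigma> (tensor V xs) = tensor V (permute_list \<sigma> xs)"
    unfolding eq by (rule tensor_push(3)[OF V V \<tau> ml])
qed

lemma tuples_map_act:
  "representation G V \<Longrightarrow> g \<in> carrier G \<Longrightarrow> xs \<in> tuples r V \<Longrightarrow> map (act V g) xs \<in> tuples r V"
  by (auto simp: tuples_def representation.act_closed subset_iff)

lemma representation_tensor_power:
  assumes rep: "representation G V"
  shows "representation G (tensor_power r V)"
proof (rule representationI)
  note V = representation_vecspace[OF rep]
  interpret G: group G by (rule representation_group[OF rep])
  note act = act_tensor_power[OF V act_linear_map[OF rep]]
  show "group G" by (rule G.group_axioms)
  show "vecspace (tensor_power r V)" by (rule vecspace_tensor_power[OF V])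
  show "spans (tensor_power r V) (tensor V ` tuples r V)" by (rule spans_tensor_power[OF V])
  show "act (tensor_power r V) g \<in> linear_maps (tensor_power r V) (tensor_power r V)"
    if "g \<in> carrier G" for g using act(1)[OF that] .
  fix t assume "t \<in> tensor V ` tuples r V"
  then obtain xs where t: "t = tensor V xs" "xs \<in> tuples r V" by blast
  have c: "set xs \<subseteq> carrier V" using t(2) by (auto simp: tuples_def)
  show "act (tensor_power r V) \<one>\<^bsub>G\<^esub> t = t"
    using t c by (simp add: act) (metis representation.act_one[OF rep] map_idI subsetD)
  fix g h assume gh: "g \<in> carrier G" "h \<in> carrier G"
  have "map (act V (g \<otimes>\<^bsub>G\<^esub> h)) xs = map (act V g \<circ> act V h) xs"
    using c gh by (auto simp: representation.act_mult[OF rep])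
  then have "tensor V (map (act V (g \<otimes>\<^bsub>G\<^esub> h)) xs) = tensor V (map (act V g) (map (act V h) xs))"
    by (simp only: map_map)
  then show "act (tensor_power r V) (g \<otimes>\<^bsub>G\<^esub> h) t =
      act (tensor_power r V) g (act (tensor_power r V) h t)"
    using t(2) gh unfolding t(1)
    by (simp only: act G.m_closed tuples_map_act[OF rep])
qed

section \<open>Symmetric and exterior powers\<close>

text \<open>The group acts in the same way at every position, so acting commutes with permuting the
  entries of a pure tensor. Stability of the invariants and of the relations for the coinvariants
  both rest on this.\<close>

lemma place_perm_act:
  assumes rep: "representation G V" and g: "g \<in> carrier G" and \<sigma>: "\<sigma> permutes {..<r}"
    and w: "w \<in> carrier (tensor_power r V)"
  shows "act (tensor_power r V) g (place_perm r V \<sigma> w) = place_perm r V \<sigma> (act (tensor_power r V) g w)"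
proof -
  note V = representation_vecspace[OF rep]
  note T = vecspace_tensor_power[OF V] and act = act_tensor_power[OF V act_linear_map[OF rep g]]
    and pp = place_perm_tensor[OF V \<sigma>]
  show ?thesis
  proof (rule spans_eqI[OF spans_tensor_power[OF V] T T linear_maps_comp[OF pp(1) act(1)]
        linear_maps_comp[OF act(1) pp(1)] _ w])
    fix t assume "t \<in> tensor V ` tuples r V"
    then obtain xs where t: "t = tensor V xs" and xs: "xs \<in> tuples r V" by blast
    have "permute_list \<sigma> (map (act V g) xs) = map (act V g) (permute_list \<sigma> xs)"
      using \<sigma> tuplesD(1)[OF xs] by (intro permute_list_map) simp
    then show "act (tensor_power r V) g (place_perm r V \<sigma> t) =
        place_perm r V \<sigma> (act (tensor_power r V) g t)"
      unfolding t
      by (simp only: act(2) pp(2) xs tuples_permute_list[OF xs \<sigma>] tuples_map_act[OF rep g xs])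
  qed
qed

context
  fixes V :: "('k::field, 'v, 'g) rep" and r :: nat
  assumes V: "vecspace V"
begin

interpretation V: Module.module scalars V by (rule V)
interpretation T: Module.module scalars "tensor_power r V" by (rule vecspace_tensor_power[OF V])

section \<open>Symmetric powers as coinvariants\<close>

lemma submodule_sym_rels: "submodule (sym_rels r V) scalars (tensor_power r V)"
  unfolding sym_rels_def
  by (rule submodule_lin_span[OF vecspace_tensor_power[OF V]])
    (auto intro!: T.minus_closed linear_maps_closed[OF place_perm_tensor(1)[OF V]])

lemma sym_prod_coset:
  "xs \<in> tuples r V \<Longrightarrow> sym_prod V xs = sym_rels r V +>\<^bsub>tensor_power r V\<^esub> tensor V xs"
  using tuplesD(1)[of xs r V] by (auto simp: sym_prod_def)

lemma vecspace_sym_upper: "vecspace (sym_upper r V)"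
  unfolding sym_upper_def by (rule vecspace_quot_rep[OF T.module_axioms submodule_sym_rels])

lemma multilinear_sym_prod: "multilinear r V (sym_upper r V) (sym_prod V)"
  unfolding sym_upper_def
  by (rule multilinear_cong[OF V multilinear_linear_comp[OF multilinear_tensor[OF V]
          coset_linear[OF T.module_axioms submodule_sym_rels]] sym_prod_coset])

lemma spans_sym_upper_gens:
  assumes "spans V S"
  shows "spans (sym_upper r V) (sym_prod V ` {xs. length xs = r \<and> set xs \<subseteq> S})"
proof -
  have "{xs. length xs = r \<and> set xs \<subseteq> S} \<subseteq> tuples r V"
    using spans_subset[OF assms] by (auto simp: tuples_def)
  then have "sym_prod V ` {xs. length xs = r \<and> set xs \<subseteq> S} =
      (\<lambda>t. sym_rels r V +>\<^bsub>tensor_power r V\<^esub> t) ` tensor V ` {xs. length xs = r \<and> set xs \<subseteq> S}"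
    unfolding image_image by (intro image_cong refl sym_prod_coset) blast
  then show ?thesis
    using spans_quot_rep[OF T.module_axioms submodule_sym_rels spans_tensor_power_gens[OF V assms]]
    by (simp add: sym_upper_def)
qed

lemma spans_sym_upper: "spans (sym_upper r V) (sym_prod V ` tuples r V)"
  using spans_sym_upper_gens[of "carrier V"] by (simp add: spans_def[of V] tuples_def)

lemma sym_prod_permute_list:
  assumes xs: "xs \<in> tuples r V" and \<sigma>: "\<sigma> permutes {..<r}"
  shows "sym_prod V (permute_list \<sigma> xs) = sym_prod V xs"
proof -
  note t = tensor_closed[OF V xs] tensor_closed[OF V tuples_permute_list[OF xs \<sigma>]]
  have "place_perm r V \<sigma> (tensor V xs) \<ominus>\<^bsub>tensor_power r V\<^esub> tensor V xs \<in> sym_rels r V"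
    unfolding sym_rels_def using t(1) \<sigma> by (intro subsetD[OF lin_span_superset]) blast
  then show ?thesis
    using coset_eq_iff[OF T.module_axioms submodule_sym_rels t(2,1)]
    by (simp add: place_perm_tensor(2)[OF V \<sigma> xs] sym_prod_coset xs tuples_permute_list[OF xs \<sigma>])
qed

text \<open>Lists with the same multiset of entries differ by a permutation, which the coinvariants
  ignore. Commutativity of products in symmetric powers is used below in this form.\<close>

lemma sym_prod_mset_eq:
  assumes "xs \<in> tuples r V" "mset xs = mset ys"
  shows "sym_prod V xs = sym_prod V ys"
proof -
  obtain p where "p permutes {..<length xs}" "permute_list p xs = ys"
    using mset_eq_permutation[OF assms(2)[symmetric]] by metis
  then show ?thesis using sym_prod_permute_list[OF assms(1)] tuplesD(1)[OF assms(1)] by metis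
qed

lemma sym_upper_induced:
  assumes U: "vecspace (U :: ('k, 'u, 'g) rep)" and \<phi>: "multilinear r V U \<phi>"
    and sym: "\<And>xs \<sigma>. xs \<in> tuples r V \<Longrightarrow> \<sigma> permutes {..<r} \<Longrightarrow> \<phi> (permute_list \<sigma> xs) = \<phi> xs"
  obtains h where "h \<in> linear_maps (sym_upper r V) U"
    and "\<And>xs. xs \<in> tuples r V \<Longrightarrow> h (sym_prod V xs) = \<phi> xs"
proof -
  obtain k where k: "k \<in> linear_maps (tensor_power r V) U"
    and k_tensor: "\<And>xs. xs \<in> tuples r V \<Longrightarrow> k (tensor V xs) = \<phi> xs"
    using tensor_power_induced[OF V U \<phi>] by blast
  \<comment> \<open>Symmetry of \<open>\<phi>\<close> on tuples extends to invariance of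
    \<open>k\<close> on all tensors, so \<open>k\<close> kills every difference that generates
    \<open>sym_rels\<close>.\<close>
  have inv: "k (place_perm r V \<sigma> w) = k w"
    if \<sigma>: "\<sigma> permutes {..<r}" and w: "w \<in> carrier (tensor_power r V)" for \<sigma> w
    by (rule spans_eqI[OF spans_tensor_power[OF V] T.module_axioms U
          linear_maps_comp[OF place_perm_tensor(1)[OF V \<sigma>] k] k _ w])
      (auto simp: place_perm_tensor(2)[OF V \<sigma>] k_tensor tuples_permute_list \<sigma> sym)
  have "k w \<in> {\<zero>\<^bsub>U\<^esub>}" if w: "w \<in> sym_rels r V" for w
  proof (rule lin_span_image[OF T.module_axioms U k submodule_zero[OF U] _ _ w[unfolded sym_rels_def]])
    show "{place_perm r V \<sigma> w \<ominus>\<^bsub>tensor_power r V\<^esub> w | \<sigma> w.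
        \<sigma> permutes {..<r} \<and> w \<in> carrier (tensor_power r V)} \<subseteq> carrier (tensor_power r V)"
      by (auto intro!: T.minus_closed linear_maps_closed[OF place_perm_tensor(1)[OF V]])
    show "k ` {place_perm r V \<sigma> w \<ominus>\<^bsub>tensor_power r V\<^esub> w | \<sigma> w.
        \<sigma> permutes {..<r} \<and> w \<in> carrier (tensor_power r V)} \<subseteq> {\<zero>\<^bsub>U\<^esub>}"
    proof (rule image_subsetI, elim CollectE exE conjE)
      fix t \<sigma> w assume t: "t = place_perm r V \<sigma> w \<ominus>\<^bsub>tensor_power r V\<^esub> w"
        and \<sigma>: "\<sigma> permutes {..<r}" and w: "w \<in> carrier (tensor_power r V)"
      note pw = linear_maps_closed[OF place_perm_tensor(1)[OF V \<sigma>] w]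
      have "k (place_perm r V \<sigma> w \<ominus>\<^bsub>tensor_power r V\<^esub> w) = \<zero>\<^bsub>U\<^esub>"
        unfolding linear_maps_minus[OF T.module_axioms U k pw w] inv[OF \<sigma> w]
        using minus_eq_zero_iff[OF U] linear_maps_closed[OF k w] by blast
      then show "k t \<in> {\<zero>\<^bsub>U\<^esub>}" by (simp add: t)
    qed
  qed
  then obtain h where h: "h \<in> linear_maps (sym_upper r V) U"
    and "\<And>t. t \<in> carrier (tensor_power r V) \<Longrightarrow> h (sym_rels r V +>\<^bsub>tensor_power r V\<^esub> t) = k t"
    using quot_rep_induced[OF T.module_axioms submodule_sym_rels U k] unfolding sym_upper_def
    by (metis singletonD)
  then show thesis
    using that[OF h] by (simp add: sym_prod_coset k_tensor tensor_closed[OF V])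
qed

section \<open>Exterior powers\<close>

lemma submodule_alt_rels: "submodule (alt_rels r V) scalars (tensor_power r V)"
  unfolding alt_rels_def
  by (rule submodule_lin_span[OF T.module_axioms]) (auto intro!: tensor_closed[OF V])

lemma wedge_coset:
  "xs \<in> tuples r V \<Longrightarrow> wedge V xs = alt_rels r V +>\<^bsub>tensor_power r V\<^esub> tensor V xs"
  using tuplesD(1)[of xs r V] by (auto simp: wedge_def)

lemma vecspace_ext_power: "vecspace (ext_power r V)"
  unfolding ext_power_def by (rule vecspace_quot_rep[OF T.module_axioms submodule_alt_rels])

interpretation X: Module.module scalars "ext_power r V" by (rule vecspace_ext_power)

lemma multilinear_wedge: "multilinear r V (ext_power r V) (wedge V)"
  unfolding ext_power_def
  by (rule multilinear_cong[OF V multilinear_linear_comp[OF multilinear_tensor[OF V]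
          coset_linear[OF T.module_axioms submodule_alt_rels]] wedge_coset])

lemma wedge_closed: "xs \<in> tuples r V \<Longrightarrow> wedge V xs \<in> carrier (ext_power r V)"
  by (rule multilinearD(1)[OF multilinear_wedge])

lemma spans_ext_power_gens:
  assumes "spans V S"
  shows "spans (ext_power r V) (wedge V ` {xs. length xs = r \<and> set xs \<subseteq> S})"
proof -
  have "{xs. length xs = r \<and> set xs \<subseteq> S} \<subseteq> tuples r V"
    using spans_subset[OF assms] by (auto simp: tuples_def)
  then have "wedge V ` {xs. length xs = r \<and> set xs \<subseteq> S} =
      (\<lambda>t. alt_rels r V +>\<^bsub>tensor_power r V\<^esub> t) ` tensor V ` {xs. length xs = r \<and> set xs \<subseteq> S}"
    unfolding image_image by (intro image_cong refl wedge_coset) blast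
  then show ?thesis
    using spans_quot_rep[OF T.module_axioms submodule_alt_rels spans_tensor_power_gens[OF V assms]]
    by (simp add: ext_power_def)
qed

lemma spans_ext_power: "spans (ext_power r V) (wedge V ` tuples r V)"
  using spans_ext_power_gens[of "carrier V"] by (simp add: spans_def[of V] tuples_def)

lemma wedge_not_distinct:
  assumes xs: "xs \<in> tuples r V" and "\<not> distinct xs"
  shows "wedge V xs = \<zero>\<^bsub>ext_power r V\<^esub>"
proof -
  have "tensor V xs \<in> alt_rels r V"
    unfolding alt_rels_def using assms by (intro subsetD[OF lin_span_superset]) blast
  then have "tensor V xs \<ominus>\<^bsub>tensor_power r V\<^esub> \<zero>\<^bsub>tensor_power r V\<^esub> \<in> alt_rels r V"
    by (rule submodule_minus[OF T.module_axioms submodule_alt_rels _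
          submodule_zero_closed[OF T.module_axioms submodule_alt_rels]])
  then show ?thesis
    using coset_eq_iff[OF T.module_axioms submodule_alt_rels tensor_closed[OF V xs] T.zero_closed]
      coset_zero[OF T.module_axioms submodule_alt_rels]
    by (simp add: wedge_coset[OF xs] ext_power_def zero_quot_rep[OF T.module_axioms submodule_alt_rels])
qed

lemma ext_power_induced:
  assumes U: "vecspace (U :: ('k, 'u, 'g) rep)" and \<phi>: "multilinear r V U \<phi>"
    and alt: "\<And>xs. xs \<in> tuples r V \<Longrightarrow> \<not> distinct xs \<Longrightarrow> \<phi> xs = \<zero>\<^bsub>U\<^esub>"
  obtains h where "h \<in> linear_maps (ext_power r V) U"
    and "\<And>xs. xs \<in> tuples r V \<Longrightarrow> h (wedge V xs) = \<phi> xs"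
proof -
  obtain k where k: "k \<in> linear_maps (tensor_power r V) U"
    and k_tensor: "\<And>xs. xs \<in> tuples r V \<Longrightarrow> k (tensor V xs) = \<phi> xs"
    using tensor_power_induced[OF V U \<phi>] by blast
  have "k w \<in> {\<zero>\<^bsub>U\<^esub>}" if w: "w \<in> alt_rels r V" for w
    by (rule lin_span_image[OF T.module_axioms U k submodule_zero[OF U] _ _ w[unfolded alt_rels_def]])
      (auto intro!: tensor_closed[OF V] simp: k_tensor alt)
  then obtain h where h: "h \<in> linear_maps (ext_power r V) U"
    and "\<And>t. t \<in> carrier (tensor_power r V) \<Longrightarrow> h (alt_rels r V +>\<^bsub>tensor_power r V\<^esub> t) = k t"
    using quot_rep_induced[OF T.module_axioms submodule_alt_rels U k] unfolding ext_power_def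
    by (metis singletonD)
  then show thesis
    using that[OF h] by (simp add: wedge_coset k_tensor tensor_closed[OF V])
qed

text \<open>Polarization: the wedge with \<open>x + y\<close> in both places vanishes, and expanding
  it leaves the two mixed terms. The exterior relations only mention repeated entries, so the sign
  rule has to be derived.\<close>

lemma wedge_swap:
  assumes xs: "xs \<in> tuples r V" and ij: "i < r" "j < r" "i \<noteq> j"
  shows "wedge V (xs[i := xs ! j, j := xs ! i]) = \<ominus>\<^bsub>ext_power r V\<^esub> wedge V xs"
proof -
  let ?w = "\<lambda>x y. wedge V (xs[i := x, j := y])"
  note up = tuples_update[OF tuples_update[OF xs]]
  have cl: "?w x y \<in> carrier (ext_power r V)" if "x \<in> carrier V" "y \<in> carrier V" for x y
    using wedge_closed[OF up] that by blast
  have alt: "?w x x = \<zero>\<^bsub>ext_power r V\<^esub>" if "x \<in> carrier V" for x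
    using ij tuplesD(1)[OF xs] that
    by (intro wedge_not_distinct up) (auto simp: distinct_conv_nth nth_list_update)
  have add_right: "?w x (y \<oplus>\<^bsub>V\<^esub> z) = ?w x y \<oplus>\<^bsub>ext_power r V\<^esub> ?w x z"
    if "x \<in> carrier V" "y \<in> carrier V" "z \<in> carrier V" for x y z
    using linear_maps_add[OF multilinearD(2)[OF multilinear_wedge tuples_update[OF xs that(1)] ij(2)]
        that(2,3)] .
  have add_left: "?w (x \<oplus>\<^bsub>V\<^esub> y) z = ?w x z \<oplus>\<^bsub>ext_power r V\<^esub> ?w y z"
    if "x \<in> carrier V" "y \<in> carrier V" "z \<in> carrier V" for x y z
    using linear_maps_add[OF multilinearD(2)[OF multilinear_wedge tuples_update[OF xs that(3)] ij(1)]
        that(1,2)] ij(3) by (simp add: list_update_swap)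
  define x y where "x = xs ! i" and "y = xs ! j"
  have c: "x \<in> carrier V" "y \<in> carrier V" using tuplesD(2)[OF xs] ij by (auto simp: x_def y_def)
  have "\<zero>\<^bsub>ext_power r V\<^esub> = ?w (x \<oplus>\<^bsub>V\<^esub> y) (x \<oplus>\<^bsub>V\<^esub> y)" using alt c by simp
  also have "\<dots> = ?w y x \<oplus>\<^bsub>ext_power r V\<^esub> ?w x y"
    using c cl alt[OF c(1)] alt[OF c(2)] V.a_closed[OF c] X.a_comm[OF cl[OF c(2,1)] cl[OF c]]
    by (simp only: add_left add_right X.l_zero X.r_zero)
  finally have "?w y x = \<ominus>\<^bsub>ext_power r V\<^esub> ?w x y"
    using X.minus_equality[of "?w y x" "?w x y"] cl c by metis
  moreover have "xs[i := x, j := y] = xs" by (simp add: x_def y_def)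
  ultimately show ?thesis by (simp add: x_def y_def)
qed

text \<open>Each transposition of two positions only changes the sign, and a subspace is closed
  under negation. Phrasing the result as membership avoids tracking the sign of
  \<open>\<sigma>\<close>.\<close>

lemma wedge_permute_list_mem:
  assumes xs: "xs \<in> tuples r V" and \<sigma>: "\<sigma> permutes {..<r}"
    and H: "submodule H scalars (ext_power r V)" and mem: "wedge V xs \<in> H"
  shows "wedge V (permute_list \<sigma> xs) \<in> H"
  using \<sigma> finite_lessThan xs mem
proof (induction arbitrary: xs rule: permutes_induct)
  case id
  then show ?case by simp
next
  case (swap a b p)
  let ?ys = "permute_list (Transposition.transpose a b) xs"
  have t: "Transposition.transpose a b permutes {..<r}" using swap.hyps by (intro permutes_swap_id)
  have ys: "?ys \<in> tuples r V" using tuples_permute_list[OF swap.prems(1) t] .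
  have "wedge V ?ys \<in> H"
  proof (cases "a = b")
    case False
    have "?ys = xs[a := xs ! b, b := xs ! a]"
      using t swap.hyps False tuplesD(1)[OF swap.prems(1)]
      by (intro nth_equalityI) (auto simp: permute_list_nth nth_list_update Transposition.transpose_def)
    then show ?thesis
      using wedge_swap[OF swap.prems(1)] False swap.hyps X.submoduleE(3)[OF H swap.prems(2)] by simp
  qed (use swap.prems in simp)
  then have "wedge V (permute_list p ?ys) \<in> H" using swap.IH[OF ys] by simp
  moreover have "permute_list p ?ys = permute_list (Transposition.transpose a b \<circ> p) xs"
    using swap.hyps tuplesD(1)[OF swap.prems(1)] by (simp add: permute_list_compose)
  ultimately show ?case by (simp add: o_def)
qed

end

section \<open>The group action on symmetric and exterior powers\<close>

lemma act_sym_rels: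
  assumes rep: "representation G V" and g: "g \<in> carrier G"
  shows "act (tensor_power r V) g ` sym_rels r V \<subseteq> sym_rels r V"
proof (rule image_subsetI)
  note V = representation_vecspace[OF rep]
  note T = vecspace_tensor_power[OF V] and act = act_tensor_power[OF V act_linear_map[OF rep g]]
  interpret T: Module.module scalars "tensor_power r V" by (rule T)
  note pp = linear_maps_closed[OF place_perm_tensor(1)[OF V]]
  fix w assume w: "w \<in> sym_rels r V"
  show "act (tensor_power r V) g w \<in> sym_rels r V"
  proof (rule lin_span_image[OF T T act(1) submodule_sym_rels[OF V] _ _ w[unfolded sym_rels_def]])
    show "{place_perm r V \<sigma> w \<ominus>\<^bsub>tensor_power r V\<^esub> w | \<sigma> w.
        \<sigma> permutes {..<r} \<and> w \<in> carrier (tensor_power r V)} \<subseteq> carrier (tensor_power r V)"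
      by (auto intro!: T.minus_closed pp)
    show "act (tensor_power r V) g ` {place_perm r V \<sigma> w \<ominus>\<^bsub>tensor_power r V\<^esub> w | \<sigma> w.
        \<sigma> permutes {..<r} \<and> w \<in> carrier (tensor_power r V)} \<subseteq> sym_rels r V"
    proof (rule image_subsetI, elim CollectE exE conjE)
      fix t \<sigma> w assume t: "t = place_perm r V \<sigma> w \<ominus>\<^bsub>tensor_power r V\<^esub> w"
        and \<sigma>: "\<sigma> permutes {..<r}" and w: "w \<in> carrier (tensor_power r V)"
      have "act (tensor_power r V) g t = place_perm r V \<sigma> (act (tensor_power r V) g w)
          \<ominus>\<^bsub>tensor_power r V\<^esub> act (tensor_power r V) g w"
        unfolding t linear_maps_minus[OF T T act(1) pp[OF \<sigma> w] w] place_perm_act[OF rep g \<sigma> w] ..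
      then show "act (tensor_power r V) g t \<in> sym_rels r V"
        unfolding sym_rels_def using \<sigma> linear_maps_closed[OF act(1) w]
        by (intro subsetD[OF lin_span_superset]) blast
    qed
  qed
qed

lemma representation_sym_upper: "representation G V \<Longrightarrow> representation G (sym_upper r V)"
  unfolding sym_upper_def
  by (intro representation_quot_rep representation_tensor_power act_sym_rels submodule_sym_rels
      vecspace_tensor_power representation_vecspace)

lemma act_sym_prod:
  assumes rep: "representation G V" and g: "g \<in> carrier G" and xs: "xs \<in> tuples r V"
  shows "act (sym_upper r V) g (sym_prod V xs) = sym_prod V (map (act V g) xs)"
proof -
  note V = representation_vecspace[OF rep]
  note act = act_tensor_power[OF V act_linear_map[OF rep g]]
  show ?thesis
    using act_quot_rep[OF vecspace_tensor_power[OF V] submodule_sym_rels[OF V] act(1)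
        act_sym_rels[OF rep g] tensor_closed[OF V xs]]
    by (simp add: sym_upper_def sym_prod_coset[OF V xs]
        sym_prod_coset[OF V tuples_map_act[OF rep g xs]] act(2)[OF xs])
qed

text \<open>Applying a map entrywise keeps equal entries equal, so generators go to
  generators.\<close>

lemma act_alt_rels:
  assumes rep: "representation G V" and g: "g \<in> carrier G"
  shows "act (tensor_power r V) g ` alt_rels r V \<subseteq> alt_rels r V"
proof (rule image_subsetI)
  note V = representation_vecspace[OF rep]
  note T = vecspace_tensor_power[OF V] and act = act_tensor_power[OF V act_linear_map[OF rep g]]
  fix w assume w: "w \<in> alt_rels r V"
  show "act (tensor_power r V) g w \<in> alt_rels r V"
  proof (rule lin_span_image[OF T T act(1) submodule_alt_rels[OF V] _ _ w[unfolded alt_rels_def]])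
    show "act (tensor_power r V) g ` {tensor V xs |xs. xs \<in> tuples r V \<and> \<not> distinct xs} \<subseteq> alt_rels r V"
    proof (rule image_subsetI, elim CollectE exE conjE)
      fix t xs assume t: "t = tensor V xs" and xs: "xs \<in> tuples r V" "\<not> distinct xs"
      have "tensor V (map (act V g) xs) \<in> alt_rels r V"
        unfolding alt_rels_def using tuples_map_act[OF rep g xs(1)] xs(2) distinct_map[of "act V g" xs]
        by (intro subsetD[OF lin_span_superset]) blast
      then show "act (tensor_power r V) g t \<in> alt_rels r V" by (simp add: t act(2)[OF xs(1)])
    qed
  qed (auto intro!: tensor_closed[OF V])
qed

lemma representation_ext_power: "representation G V \<Longrightarrow> representation G (ext_power r V)"
  unfolding ext_power_def
  by (intro representation_quot_rep representation_tensor_power act_alt_rels submodule_alt_rels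
      vecspace_tensor_power representation_vecspace)

lemma act_wedge:
  assumes rep: "representation G V" and g: "g \<in> carrier G" and xs: "xs \<in> tuples r V"
  shows "act (ext_power r V) g (wedge V xs) = wedge V (map (act V g) xs)"
proof -
  note V = representation_vecspace[OF rep]
  note act = act_tensor_power[OF V act_linear_map[OF rep g]]
  show ?thesis
    using act_quot_rep[OF vecspace_tensor_power[OF V] submodule_alt_rels[OF V] act(1)
        act_alt_rels[OF rep g] tensor_closed[OF V xs]]
    by (simp add: ext_power_def wedge_coset[OF V xs]
        wedge_coset[OF V tuples_map_act[OF rep g xs]] act(2)[OF xs])
qed

section \<open>Invariant tensors\<close>

lemma carrier_sym_lower:
  "carrier (sym_lower r V) =
    {w \<in> carrier (tensor_power r V). \<forall>\<sigma>. \<sigma> permutes {..<r} \<longrightarrow> place_perm r V \<sigma> w = w}"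
  by (simp add: sym_lower_def)

lemma submodule_sym_lower:
  assumes V: "vecspace V"
  shows "submodule (carrier (sym_lower r V)) scalars (tensor_power r V)"
proof -
  interpret T: Module.module scalars "tensor_power r V" by (rule vecspace_tensor_power[OF V])
  \<comment> \<open>The tensors fixed by one permutation form the equalizer of its place permutation
    with the identity; the invariants are the intersection of these.\<close>
  have "submodule {w \<in> carrier (tensor_power r V). place_perm r V \<sigma> w = w} scalars (tensor_power r V)"
    if "\<sigma> permutes {..<r}" for \<sigma>
    by (rule submodule_equalizer[OF T.module_axioms T.module_axioms place_perm_tensor(1)[OF V that] linear_maps_id])
  note S = T.submoduleE[OF this] submodule_zero_closed[OF T.module_axioms this]
  show ?thesis
  proof (rule T.submoduleI)
    show "\<zero>\<^bsub>tensor_power r V\<^esub> \<in> carrier (sym_lower r V)"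
      using S(7) by (simp add: carrier_sym_lower)
    fix a b c assume a: "a \<in> carrier (sym_lower r V)"
    show "\<ominus>\<^bsub>tensor_power r V\<^esub> a \<in> carrier (sym_lower r V)"
      using a S(3)[of _ a] by (auto simp: carrier_sym_lower)
    show "c \<odot>\<^bsub>tensor_power r V\<^esub> a \<in> carrier (sym_lower r V)"
      using a S(4)[of _ c a] by (auto simp: carrier_sym_lower)
    assume "b \<in> carrier (sym_lower r V)"
    then show "a \<oplus>\<^bsub>tensor_power r V\<^esub> b \<in> carrier (sym_lower r V)"
      using a S(5)[of _ a b] by (auto simp: carrier_sym_lower)
  qed (auto simp: carrier_sym_lower)
qed

lemma sym_lower_simps [simp]:
  "x \<oplus>\<^bsub>sym_lower r V\<^esub> y = x \<oplus>\<^bsub>tensor_power r V\<^esub> y"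
  "c \<odot>\<^bsub>sym_lower r V\<^esub> x = c \<odot>\<^bsub>tensor_power r V\<^esub> x"
  "\<zero>\<^bsub>sym_lower r V\<^esub> = \<zero>\<^bsub>tensor_power r V\<^esub>"
  "act (sym_lower r V) = act (tensor_power r V)"
  by (simp_all add: sym_lower_def)

lemma sym_lower_subset: "carrier (sym_lower r V) \<subseteq> carrier (tensor_power r V)"
  by (auto simp: carrier_sym_lower)

lemma linear_maps_sym_lower:
  "f \<in> linear_maps (tensor_power r V) U \<Longrightarrow> f \<in> linear_maps (sym_lower r V) U"
  by (rule linear_mapsI)
    (simp_all add: linear_maps_closed linear_maps_add linear_maps_smult
      subsetD[OF sym_lower_subset])

lemma sym_lower_eq: "sym_lower r V = (tensor_power r V)\<lparr>carrier := carrier (sym_lower r V)\<rparr>"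
  by (simp add: sym_lower_def)

lemma vecspace_sym_lower: "vecspace V \<Longrightarrow> vecspace (sym_lower r V)"
  using vecspace_submodule[OF vecspace_tensor_power submodule_sym_lower] by (simp flip: sym_lower_eq)

lemma representation_sym_lower:
  assumes rep: "representation G V"
  shows "representation G (sym_lower r V)"
proof -
  note V = representation_vecspace[OF rep]
  have "representation G ((tensor_power r V)\<lparr>carrier := carrier (sym_lower r V)\<rparr>)"
  proof (rule representation_subspace[OF representation_tensor_power[OF rep] submodule_sym_lower[OF V]])
    fix g v assume g: "g \<in> carrier G" and v: "v \<in> carrier (sym_lower r V)"
    then show "act (tensor_power r V) g v \<in> carrier (sym_lower r V)"
      using linear_maps_closed[OF act_tensor_power(1)[OF V act_linear_map[OF rep g]]]
      by (simp add: carrier_sym_lower place_perm_act[OF rep g, symmetric])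
  qed
  then show ?thesis by (simp flip: sym_lower_eq)
qed

section \<open>The tensor product of two representations\<close>

context
  fixes V :: "('k::field, 'v, 'g) rep" and W :: "('k, 'w, 'g) rep"
  assumes V: "vecspace V" and W: "vecspace W"
begin

interpretation V: Module.module scalars V by (rule V)
interpretation W: Module.module scalars W by (rule W)

definition bilinear :: "('k, 'u, 'g) rep \<Rightarrow> ('v \<Rightarrow> 'w \<Rightarrow> 'u) \<Rightarrow> bool" where
  "bilinear U \<phi> \<longleftrightarrow> (\<forall>v\<in>carrier V. \<phi> v \<in> linear_maps W U) \<and>
     (\<forall>w\<in>carrier W. (\<lambda>v. \<phi> v w) \<in> linear_maps V U)"

abbreviation free_pairs :: "('k, 'v \<times> 'w \<Rightarrow>\<^sub>0 'k, 'g) rep" where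
  "free_pairs \<equiv> free_rep (carrier V \<times> carrier W) (\<lambda>g. map_prod (act V g) (act W g))"

abbreviation single_pair :: "'v \<Rightarrow> 'w \<Rightarrow> 'k \<Rightarrow> ('v \<times> 'w \<Rightarrow>\<^sub>0 'k)" where
  "single_pair v w c \<equiv> Poly_Mapping.single (v, w) c"

definition bilinear_gens :: "('v \<times> 'w \<Rightarrow>\<^sub>0 'k) set" where
  "bilinear_gens =
     {single_pair (v \<oplus>\<^bsub>V\<^esub> v') w 1 - single_pair v w 1 - single_pair v' w 1 | v v' w.
        v \<in> carrier V \<and> v' \<in> carrier V \<and> w \<in> carrier W} \<union>
      {single_pair v (w \<oplus>\<^bsub>W\<^esub> w') 1 - single_pair v w 1 - single_pair v w' 1 | v w w'.
        v \<in> carrier V \<and> w \<in> carrier W \<and> w' \<in> carrier W} \<union>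
      {single_pair (c \<odot>\<^bsub>V\<^esub> v) w 1 - single_pair v w c | c v w.
        v \<in> carrier V \<and> w \<in> carrier W} \<union>
      {single_pair v (c \<odot>\<^bsub>W\<^esub> w) 1 - single_pair v w c | c v w.
        v \<in> carrier V \<and> w \<in> carrier W}"

lemma bilinear_rels_eq: "bilinear_rels V W = lin_span free_pairs bilinear_gens"
  unfolding bilinear_rels_def bilinear_gens_def ..

lemma single_pair_closed:
  "v \<in> carrier V \<Longrightarrow> w \<in> carrier W \<Longrightarrow> single_pair v w c \<in> carrier free_pairs"
  by auto

lemma minus_pair_closed:
  "a \<in> carrier free_pairs \<Longrightarrow> b \<in> carrier free_pairs \<Longrightarrow> a - b \<in> carrier free_pairs"
  using keys_diff[of a b] by auto

lemma bilinear_gens_subset: "bilinear_gens \<subseteq> carrier free_pairs"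
  unfolding bilinear_gens_def
  by (intro Un_least subsetI; elim CollectE exE conjE; hypsubst;
      intro minus_pair_closed single_pair_closed V.a_closed W.a_closed
        vecspace_simps(3)[OF V] vecspace_simps(3)[OF W])

lemma submodule_bilinear_rels: "submodule (bilinear_rels V W) scalars free_pairs"
  unfolding bilinear_rels_eq by (rule submodule_lin_span[OF vecspace_free_rep bilinear_gens_subset])

text \<open>Vanishing on the four families of generators is additivity and homogeneity in each of
  the two arguments; the kernel then contains their span.\<close>

lemma bilinear_rels_kernel:
  assumes U: "vecspace (U :: ('k, 'u, 'g) rep)" and h: "h \<in> linear_maps free_pairs U"
    and \<phi>: "bilinear U (\<lambda>v w. h (single_pair v w 1))"
    and x: "x \<in> bilinear_rels V W"
  shows "h x = \<zero>\<^bsub>U\<^esub>"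
proof -
  interpret U: Module.module scalars U by (rule U)
  have minus: "h (a - b) = h a \<ominus>\<^bsub>U\<^esub> h b" if "a \<in> carrier free_pairs" "b \<in> carrier free_pairs" for a b
    using linear_maps_minus[OF vecspace_free_rep U h that] minus_free_rep[OF that] by simp
  have single: "h (single_pair v w c) = c \<odot>\<^bsub>U\<^esub> h (single_pair v w 1)"
    if "v \<in> carrier V" "w \<in> carrier W" for v w c
    using linear_maps_smult[OF h single_pair_closed[OF that], of c 1] by (simp add: map_times_single)
  have cl: "h (single_pair v w 1) \<in> carrier U" if "v \<in> carrier V" "w \<in> carrier W" for v w
    using linear_maps_closed[OF h single_pair_closed[OF that]] .
  have zero: "p \<ominus>\<^bsub>U\<^esub> q \<ominus>\<^bsub>U\<^esub> s = \<zero>\<^bsub>U\<^esub>"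
    if "p = q \<oplus>\<^bsub>U\<^esub> s" "q \<in> carrier U" "s \<in> carrier U" for p q s
    using U.a_assoc[of "q \<oplus>\<^bsub>U\<^esub> s" "\<ominus>\<^bsub>U\<^esub> q" "\<ominus>\<^bsub>U\<^esub> s"] U.minus_add[OF that(2,3)]
      U.r_neg[of "q \<oplus>\<^bsub>U\<^esub> s"] that by (simp add: a_minus_def del: U.a_assoc)
  have lin: "\<And>v. v \<in> carrier V \<Longrightarrow> (\<lambda>w. h (single_pair v w 1)) \<in> linear_maps W U"
    "\<And>w. w \<in> carrier W \<Longrightarrow> (\<lambda>v. h (single_pair v w 1)) \<in> linear_maps V U"
    using \<phi> by (auto simp: bilinear_def)
  note clos = single_pair_closed minus_pair_closed V.a_closed W.a_closed
    vecspace_simps(3)[OF V] vecspace_simps(3)[OF W]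
  have "h a \<in> {\<zero>\<^bsub>U\<^esub>}" if "a \<in> bilinear_gens" for a
    using that unfolding bilinear_gens_def
  proof (elim UnE CollectE exE conjE)
    fix v v' w assume a: "a = single_pair (v \<oplus>\<^bsub>V\<^esub> v') w 1 - single_pair v w 1 - single_pair v' w 1"
      and c: "v \<in> carrier V" "v' \<in> carrier V" "w \<in> carrier W"
    have "h a = h (single_pair (v \<oplus>\<^bsub>V\<^esub> v') w 1) \<ominus>\<^bsub>U\<^esub> h (single_pair v w 1) \<ominus>\<^bsub>U\<^esub> h (single_pair v' w 1)"
      unfolding a by (simp only: minus clos c)
    also have "\<dots> = \<zero>\<^bsub>U\<^esub>"
      using linear_maps_add[OF lin(2)[OF c(3)] c(1,2)] cl c by (intro zero) auto
    finally show ?thesis by simp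
  next
    fix v w w' assume a: "a = single_pair v (w \<oplus>\<^bsub>W\<^esub> w') 1 - single_pair v w 1 - single_pair v w' 1"
      and c: "v \<in> carrier V" "w \<in> carrier W" "w' \<in> carrier W"
    have "h a = h (single_pair v (w \<oplus>\<^bsub>W\<^esub> w') 1) \<ominus>\<^bsub>U\<^esub> h (single_pair v w 1) \<ominus>\<^bsub>U\<^esub> h (single_pair v w' 1)"
      unfolding a by (simp only: minus clos c)
    also have "\<dots> = \<zero>\<^bsub>U\<^esub>"
      using linear_maps_add[OF lin(1)[OF c(1)] c(2,3)] cl c by (intro zero) auto
    finally show ?thesis by simp
  next
    fix d v w assume a: "a = single_pair (d \<odot>\<^bsub>V\<^esub> v) w 1 - single_pair v w d"
      and c: "v \<in> carrier V" "w \<in> carrier W"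
    have "h a = h (single_pair (d \<odot>\<^bsub>V\<^esub> v) w 1) \<ominus>\<^bsub>U\<^esub> h (single_pair v w d)"
      unfolding a by (simp only: minus clos c)
    also have "h (single_pair v w d) = h (single_pair (d \<odot>\<^bsub>V\<^esub> v) w 1)"
      using linear_maps_smult[OF lin(2)[OF c(2)] c(1), of d] single[OF c, of d] by simp
    finally show ?thesis using cl c vecspace_simps(3)[OF V] by (simp add: a_minus_def U.r_neg)
  next
    fix d v w assume a: "a = single_pair v (d \<odot>\<^bsub>W\<^esub> w) 1 - single_pair v w d"
      and c: "v \<in> carrier V" "w \<in> carrier W"
    have "h a = h (single_pair v (d \<odot>\<^bsub>W\<^esub> w) 1) \<ominus>\<^bsub>U\<^esub> h (single_pair v w d)"
      unfolding a by (simp only: minus clos c)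
    also have "h (single_pair v w d) = h (single_pair v (d \<odot>\<^bsub>W\<^esub> w) 1)"
      using linear_maps_smult[OF lin(1)[OF c(1)] c(2), of d] single[OF c, of d] by simp
    finally show ?thesis using cl c vecspace_simps(3)[OF W] by (simp add: a_minus_def U.r_neg)
  qed
  then have "h x \<in> {\<zero>\<^bsub>U\<^esub>}"
    by (intro lin_span_image[OF vecspace_free_rep U h submodule_zero[OF U] bilinear_gens_subset _
          x[unfolded bilinear_rels_eq]] image_subsetI)
  then show ?thesis by simp
qed

lemma vecspace_tensor_prod: "vecspace (tensor_prod V W)"
  unfolding tensor_prod_def by (rule vecspace_quot_rep[OF vecspace_free_rep submodule_bilinear_rels])

text \<open>A generator becomes an equality of cosets. The additivity generators have three terms
  and are fed in with \<open>b\<close> the sum of the last two.\<close>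

lemma bilinear_rels_gen:
  assumes "a \<in> carrier free_pairs" "b \<in> carrier free_pairs" "a - b \<in> bilinear_gens"
  shows "bilinear_rels V W +>\<^bsub>free_pairs\<^esub> a = bilinear_rels V W +>\<^bsub>free_pairs\<^esub> b"
  using coset_eq_iff[OF vecspace_free_rep submodule_bilinear_rels assms(1,2)]
    minus_free_rep[OF assms(1,2)] subsetD[OF lin_span_superset assms(3)]
  by (simp add: bilinear_rels_eq)

lemma bilinear_tensor2: "bilinear (tensor_prod V W) (tensor2 V W)"
proof -
  note Q = vecspace_free_rep submodule_bilinear_rels
  interpret F: Module.module scalars free_pairs by (rule vecspace_free_rep)
  note clos = single_pair_closed V.a_closed W.a_closed vecspace_simps(3)[OF V] vecspace_simps(3)[OF W]
  have cl: "tensor2 V W v w \<in> carrier (tensor_prod V W)" if "v \<in> carrier V" "w \<in> carrier W" for v w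
    unfolding tensor_prod_def carrier_quot_rep[OF Q] tensor2_def using single_pair_closed[OF that] by blast
  have add: "tensor2 V W v w \<oplus>\<^bsub>tensor_prod V W\<^esub> tensor2 V W v' w' =
      bilinear_rels V W +>\<^bsub>free_pairs\<^esub> (single_pair v w 1 + single_pair v' w' 1)"
    if "v \<in> carrier V" "w \<in> carrier W" "v' \<in> carrier V" "w' \<in> carrier W" for v v' w w'
    unfolding tensor_prod_def tensor2_def
    using add_quot_rep[OF Q single_pair_closed[OF that(1,2)] single_pair_closed[OF that(3,4)]] by simp
  have smult: "c \<odot>\<^bsub>tensor_prod V W\<^esub> tensor2 V W v w = bilinear_rels V W +>\<^bsub>free_pairs\<^esub> single_pair v w c"
    if "v \<in> carrier V" "w \<in> carrier W" for v w c
    unfolding tensor_prod_def tensor2_def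
    using smult_quot_rep[OF Q single_pair_closed[OF that], of c 1] by (simp add: map_times_single)
  have plus: "a + b \<in> carrier free_pairs" if "a \<in> carrier free_pairs" "b \<in> carrier free_pairs" for a b
    using F.a_closed[OF that] by simp
  show ?thesis unfolding bilinear_def
  proof (intro conjI ballI linear_mapsI)
    fix v v' w c assume c: "v \<in> carrier V" "w \<in> carrier W"
    show "tensor2 V W (c \<odot>\<^bsub>V\<^esub> v) w = c \<odot>\<^bsub>tensor_prod V W\<^esub> tensor2 V W v w"
      unfolding smult[OF c] unfolding tensor2_def
      using c by (intro bilinear_rels_gen clos) (auto simp: bilinear_gens_def)
    assume c': "v' \<in> carrier V"
    show "tensor2 V W (v \<oplus>\<^bsub>V\<^esub> v') w = tensor2 V W v w \<oplus>\<^bsub>tensor_prod V W\<^esub> tensor2 V W v' w"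
      unfolding add[OF c c' c(2)] unfolding tensor2_def
    proof (intro bilinear_rels_gen clos plus c c')
      have "single_pair (v \<oplus>\<^bsub>V\<^esub> v') w 1 - single_pair v w 1 - single_pair v' w 1 \<in> bilinear_gens"
        unfolding bilinear_gens_def using c c' by blast
      then show "single_pair (v \<oplus>\<^bsub>V\<^esub> v') w 1 - (single_pair v w 1 + single_pair v' w 1) \<in> bilinear_gens"
        by (simp add: diff_diff_eq)
    qed
  next
    fix v w w' c assume c: "v \<in> carrier V" "w \<in> carrier W"
    show "tensor2 V W v (c \<odot>\<^bsub>W\<^esub> w) = c \<odot>\<^bsub>tensor_prod V W\<^esub> tensor2 V W v w"
      unfolding smult[OF c] unfolding tensor2_def
      using c by (intro bilinear_rels_gen clos) (auto simp: bilinear_gens_def)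
    assume c': "w' \<in> carrier W"
    show "tensor2 V W v (w \<oplus>\<^bsub>W\<^esub> w') = tensor2 V W v w \<oplus>\<^bsub>tensor_prod V W\<^esub> tensor2 V W v w'"
      unfolding add[OF c c(1) c'] unfolding tensor2_def
    proof (intro bilinear_rels_gen clos plus c c')
      have "single_pair v (w \<oplus>\<^bsub>W\<^esub> w') 1 - single_pair v w 1 - single_pair v w' 1 \<in> bilinear_gens"
        unfolding bilinear_gens_def using c c' by blast
      then show "single_pair v (w \<oplus>\<^bsub>W\<^esub> w') 1 - (single_pair v w 1 + single_pair v w' 1) \<in> bilinear_gens"
        by (simp add: diff_diff_eq)
    qed
  qed (auto intro: cl)
qed

lemma tensor2_linear_right: "v \<in> carrier V \<Longrightarrow> tensor2 V W v \<in> linear_maps W (tensor_prod V W)"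
  and tensor2_linear_left: "w \<in> carrier W \<Longrightarrow> (\<lambda>v. tensor2 V W v w) \<in> linear_maps V (tensor_prod V W)"
  using bilinear_tensor2 by (auto simp: bilinear_def)

lemma spans_tensor_prod:
  "spans (tensor_prod V W) {tensor2 V W v w | v w. v \<in> carrier V \<and> w \<in> carrier W}"
proof -
  have "(\<lambda>F. bilinear_rels V W +>\<^bsub>free_pairs\<^esub> F) `
      (\<lambda>b. Poly_Mapping.single b 1) ` (carrier V \<times> carrier W) =
      {tensor2 V W v w | v w. v \<in> carrier V \<and> w \<in> carrier W}"
    unfolding tensor2_def by auto
  then show ?thesis
    using spans_quot_rep[OF vecspace_free_rep submodule_bilinear_rels spans_free_rep]
    by (simp add: tensor_prod_def)
qed

lemma tensor_prod_induced:
  assumes U: "vecspace (U :: ('k, 'u, 'g) rep)" and \<phi>: "bilinear U \<phi>"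
  obtains h where "h \<in> linear_maps (tensor_prod V W) U"
    and "\<And>v w. v \<in> carrier V \<Longrightarrow> w \<in> carrier W \<Longrightarrow> h (tensor2 V W v w) = \<phi> v w"
proof -
  let ?\<phi> = "\<lambda>(v, w). \<phi> v w"
  have lin: "\<And>v. v \<in> carrier V \<Longrightarrow> \<phi> v \<in> linear_maps W U" using \<phi> by (simp add: bilinear_def)
  have Pi: "?\<phi> \<in> carrier V \<times> carrier W \<rightarrow> carrier U"
    using linear_maps_closed[OF lin] by auto
  have single: "lin_ext U ?\<phi> (single_pair v w 1) = \<phi> v w" if "v \<in> carrier V" "w \<in> carrier W" for v w
    using lin_ext_single[OF U Pi, of "(v, w)"] that by simp
  have ext: "lin_ext U ?\<phi> \<in> linear_maps free_pairs U" by (rule lin_ext_linear[OF U Pi])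
  have "bilinear U (\<lambda>v w. lin_ext U ?\<phi> (single_pair v w 1))"
    unfolding bilinear_def
  proof (intro conjI ballI)
    fix v assume v: "v \<in> carrier V"
    show "(\<lambda>w. lin_ext U ?\<phi> (single_pair v w 1)) \<in> linear_maps W U"
      by (rule linear_maps_cong[OF W lin[OF v] single[OF v]])
  next
    fix w assume w: "w \<in> carrier W"
    have "(\<lambda>v. \<phi> v w) \<in> linear_maps V U" using \<phi> w by (simp add: bilinear_def)
    then show "(\<lambda>v. lin_ext U ?\<phi> (single_pair v w 1)) \<in> linear_maps V U"
      by (rule linear_maps_cong[OF V _ single[OF _ w]])
  qed
  note ker = bilinear_rels_kernel[OF U ext this]
  obtain h where h: "h \<in> linear_maps (tensor_prod V W) U"
    and eq: "\<And>F. F \<in> carrier free_pairs \<Longrightarrow> h (bilinear_rels V W +>\<^bsub>free_pairs\<^esub> F) = lin_ext U ?\<phi> F"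
  proof (rule quot_rep_induced[OF vecspace_free_rep submodule_bilinear_rels U ext ker,
        folded tensor_prod_def])
    fix h assume "h \<in> linear_maps (tensor_prod V W) U"
      and "\<And>F. F \<in> carrier free_pairs \<Longrightarrow> h (bilinear_rels V W +>\<^bsub>free_pairs\<^esub> F) = lin_ext U ?\<phi> F"
    then show thesis by (rule that)
  qed
  show thesis
    by (rule that[OF h]) (simp only: tensor2_def eq single_pair_closed single)
qed

end

lemma act_tensor_prod:
  fixes V :: "('k::field, 'v, 'g) rep" and W :: "('k, 'w, 'g) rep"
  assumes rep: "representation G V" "representation G W" and g: "g \<in> carrier G"
  shows "act (tensor_prod V W) g \<in> linear_maps (tensor_prod V W) (tensor_prod V W)"
    and "v \<in> carrier V \<Longrightarrow> w \<in> carrier W \<Longrightarrow>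
      act (tensor_prod V W) g (tensor2 V W v w) = tensor2 V W (act V g v) (act W g w)"
proof -
  note V = representation_vecspace[OF rep(1)] and W = representation_vecspace[OF rep(2)]
  note Q = vecspace_free_rep submodule_bilinear_rels[OF V W]
  let ?\<tau> = "map_prod (act V g) (act W g)"
  let ?F = "free_pairs V W"
  note cl = representation.act_closed[OF rep(1) g] representation.act_closed[OF rep(2) g]
  have lin: "push ?\<tau> \<in> linear_maps ?F ?F"
    using cl by (intro push_linear) auto
  have comp: "(\<lambda>F. bilinear_rels V W +>\<^bsub>?F\<^esub> push ?\<tau> F) \<in> linear_maps ?F (tensor_prod V W)"
    unfolding tensor_prod_def by (rule linear_maps_comp[OF lin coset_linear[OF Q]])
  have coset: "bilinear_rels V W +>\<^bsub>?F\<^esub> push ?\<tau> (Poly_Mapping.single (v, w) 1) =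
      tensor2 V W (act V g v) (act W g w)" for v w
    by (simp add: tensor2_def)
  have "bilinear V W (tensor_prod V W)
      (\<lambda>v w. bilinear_rels V W +>\<^bsub>?F\<^esub> push ?\<tau> (Poly_Mapping.single (v, w) 1))"
    unfolding coset bilinear_def[OF V W]
    using linear_maps_comp[OF act_linear_map[OF rep(2) g] tensor2_linear_right[OF V W cl(1)]]
      linear_maps_comp[OF act_linear_map[OF rep(1) g] tensor2_linear_left[OF V W cl(2)]] by blast
  note ker = bilinear_rels_kernel[OF V W vecspace_tensor_prod[OF V W] comp this]
  have *: "push ?\<tau> ` bilinear_rels V W \<subseteq> bilinear_rels V W"
  proof (rule image_subsetI)
    fix w assume w: "w \<in> bilinear_rels V W"
    then have "w \<in> carrier ?F" using submodule_subset[OF Q(2)] by blast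
    then have cl: "push ?\<tau> w \<in> carrier ?F" by (rule linear_maps_closed[OF lin])
    show "push ?\<tau> w \<in> bilinear_rels V W"
      using ker[OF w] coset_self[OF Q cl] by (simp add: tensor_prod_def zero_quot_rep[OF Q])
  qed
  have eq: "act (tensor_prod V W) g = (\<lambda>A. \<Union>F\<in>A. bilinear_rels V W +>\<^bsub>?F\<^esub> push ?\<tau> F)"
    by (simp add: tensor_prod_def quot_rep_def)
  show "act (tensor_prod V W) g \<in> linear_maps (tensor_prod V W) (tensor_prod V W)"
    unfolding eq unfolding tensor_prod_def by (rule coset_map_linear[OF Q Q lin *])
  show "act (tensor_prod V W) g (tensor2 V W v w) = tensor2 V W (act V g v) (act W g w)"
    if "v \<in> carrier V" "w \<in> carrier W"
    unfolding eq using coset_map[OF Q Q lin * single_pair_closed[OF V W that]] coset[of v w]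
    by (simp add: tensor2_def)
qed

lemma representation_tensor_prod:
  fixes V :: "('k::field, 'v, 'g) rep" and W :: "('k, 'w, 'g) rep"
  assumes rep: "representation G V" "representation G W"
  shows "representation G (tensor_prod V W)"
proof (rule representationI)
  note V = representation_vecspace[OF rep(1)] and W = representation_vecspace[OF rep(2)]
  interpret G: group G by (rule representation_group[OF rep(1)])
  note act = act_tensor_prod[OF rep]
  show "group G" by (rule G.group_axioms)
  show "vecspace (tensor_prod V W)" by (rule vecspace_tensor_prod[OF V W])
  show "spans (tensor_prod V W) {tensor2 V W v w | v w. v \<in> carrier V \<and> w \<in> carrier W}"
    by (rule spans_tensor_prod[OF V W])
  show "act (tensor_prod V W) g \<in> linear_maps (tensor_prod V W) (tensor_prod V W)"
    if "g \<in> carrier G" for g using act(1)[OF that] .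
  fix t assume "t \<in> {tensor2 V W v w | v w. v \<in> carrier V \<and> w \<in> carrier W}"
  then obtain v w where t: "t = tensor2 V W v w" "v \<in> carrier V" "w \<in> carrier W" by blast
  show "act (tensor_prod V W) \<one>\<^bsub>G\<^esub> t = t"
    using t by (simp add: act representation.act_one[OF rep(1)] representation.act_one[OF rep(2)])
  fix g h assume gh: "g \<in> carrier G" "h \<in> carrier G"
  then show "act (tensor_prod V W) (g \<otimes>\<^bsub>G\<^esub> h) t = act (tensor_prod V W) g (act (tensor_prod V W) h t)"
    using t by (simp add: act representation.act_mult[OF rep(1)] representation.act_mult[OF rep(2)]
        representation.act_closed[OF rep(1)] representation.act_closed[OF rep(2)])
qed

section \<open>Evaluation functionals and the Vandermonde determinant\<close>

text \<open>With all \<open>y\<close> equal to 1 this is the usual Vandermonde determinant up to the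
  order of columns. Row \<open>j\<close> lists all monomials of degree \<open>m - 1\<close> in
  \<open>x j\<close> and \<open>y j\<close>, which makes linear substitutions in the pair
  meaningful.\<close>

definition hom_vandermonde :: "nat \<Rightarrow> (nat \<Rightarrow> 'a) \<Rightarrow> (nat \<Rightarrow> 'a) \<Rightarrow> 'a::comm_ring_1" where
  "hom_vandermonde m x y = det (mat m m (\<lambda>(j, i). x j ^ (m - 1 - i) * y j ^ i))"

lemma det_scale_rows:
  "det (mat m m (\<lambda>(j, i). c j * f j i)) = (\<Prod>j<m. c j) * det (mat m m (\<lambda>(j, i). f j i))"
proof -
  have "(\<Prod>j = 0..<m. mat m m (\<lambda>(j, i). c j * f j i) $$ (j, p j)) =
      (\<Prod>j<m. c j) * (\<Prod>j = 0..<m. mat m m (\<lambda>(j, i). f j i) $$ (j, p j))"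
    if p: "p permutes {0..<m}" for p
  proof -
    have "(\<Prod>j = 0..<m. mat m m (\<lambda>(j, i). c j * f j i) $$ (j, p j)) =
        (\<Prod>j = 0..<m. c j * mat m m (\<lambda>(j, i). f j i) $$ (j, p j))"
      using permutes_in_image[OF p] by (intro prod.cong) auto
    then show ?thesis by (simp add: prod.distrib atLeast0LessThan)
  qed
  then show ?thesis
    by (simp add: det_def'[of _ m] sum_distrib_left mult.left_commute)
qed

text \<open>Replacing each column by \<open>y\<^sub>m\<close> times itself minus \<open>x\<^sub>m\<close> times the next one clears the last
  row except for its last entry.\<close>

lemma hom_vandermonde_Suc:
  fixes x y :: "nat \<Rightarrow> 'a::idom"
  assumes "y m \<noteq> 0"
  shows "hom_vandermonde (Suc m) x y = (\<Prod>j<m. x j * y m - x m * y j) * hom_vandermonde m x y"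
proof -
  define M where "M = mat (Suc m) (Suc m) (\<lambda>(j, i). x j ^ (m - i) * y j ^ i)"
  \<comment> \<open>Right multiplication by \<open>T\<close> performs these column operations; the
    last column is kept, whence the diagonal entry 1.\<close>
  define T where "T = mat (Suc m) (Suc m) (\<lambda>(k, i).
    if k = i then (if i = m then 1 else y m) else if k = Suc i then - x m else 0)"
  define R where "R = mat m m (\<lambda>(j, i). x j ^ (m - 1 - i) * y j ^ i)"
  have carr: "M \<in> carrier_mat (Suc m) (Suc m)" "T \<in> carrier_mat (Suc m) (Suc m)"
    by (simp_all add: M_def T_def)
  have detT: "det T = y m ^ m"
  proof -
    have "det T = prod_list (diag_mat T)"
      by (rule det_lower_triangular[OF _ carr(2)]) (auto simp: T_def)
    also have "diag_mat T = map (\<lambda>i. if i = m then 1 else y m) [0..<Suc m]"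
      by (auto simp: diag_mat_def T_def)
    also have "prod_list \<dots> = (\<Prod>i\<in>{0..<Suc m}. if i = m then 1 else y m)"
      by (simp only: prod.distinct_set_conv_list[symmetric] distinct_upt set_upt)
    also have "\<dots> = (\<Prod>i\<in>{0..<m}. y m)" by (simp add: prod.cong)
    finally show ?thesis by simp
  qed
  have MT: "(M * T) $$ (j, i) =
      (if i = m then y j ^ m else x j ^ (m - 1 - i) * y j ^ i * (x j * y m - x m * y j))"
    if ji: "j < Suc m" "i < Suc m" for j i
  proof -
    have "(M * T) $$ (j, i) = (\<Sum>k\<in>{0..<Suc m}. M $$ (j, k) * T $$ (k, i))"
      using ji carr by (simp add: scalar_prod_def M_def T_def)
    also have "\<dots> = (\<Sum>k\<in>{0..<Suc m}. (if k = i then M $$ (j, i) * (if i = m then 1 else y m) else 0) +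
        (if k = Suc i then M $$ (j, Suc i) * - x m else 0))"
      using ji by (intro sum.cong) (auto simp: T_def)
    also have "\<dots> = M $$ (j, i) * (if i = m then 1 else y m) +
        (if i < m then M $$ (j, Suc i) * - x m else 0)"
      using ji by (simp only: sum.distrib sum.delta finite_atLeastLessThan) auto
    also have "\<dots> = (if i = m then y j ^ m else x j ^ (m - 1 - i) * y j ^ i * (x j * y m - x m * y j))"
    proof (cases "i = m")
      case False
      \<comment> \<open>With \<open>m = i + k + 1\<close> the truncated exponents
        \<open>m - i\<close> and \<open>m - 1 - i\<close> become \<open>k + 1\<close> and
        \<open>k\<close>.\<close>
      then obtain k where k: "m = Suc (i + k)" using ji less_iff_Suc_add[of i m] by auto
      show ?thesis using ji False unfolding k M_def by (simp add: algebra_simps)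
    qed (use ji in \<open>simp add: M_def\<close>)
    finally show ?thesis .
  qed
  have "det (M * T) = (\<Sum>i<Suc m. (M * T) $$ (m, i) * cofactor (M * T) m i)"
    using carr by (intro laplace_expansion_row[of _ "Suc m"]) auto
  also have "\<dots> = y m ^ m * cofactor (M * T) m m"
    using MT[of m] by simp
  also have "cofactor (M * T) m m = det (mat_delete (M * T) m m)"
    by (simp add: cofactor_def)
  also have "mat_delete (M * T) m m =
      mat m m (\<lambda>(j, i). (x j * y m - x m * y j) * (x j ^ (m - 1 - i) * y j ^ i))"
  proof (rule eq_matI)
    fix j i
    assume "j < dim_row (mat m m (\<lambda>(j, i). (x j * y m - x m * y j) * (x j ^ (m - 1 - i) * y j ^ i)))"
      "i < dim_col (mat m m (\<lambda>(j, i). (x j * y m - x m * y j) * (x j ^ (m - 1 - i) * y j ^ i)))"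
    then have ji: "j < m" "i < m" by auto
    then have "mat_delete (M * T) m m $$ (j, i) = (M * T) $$ (j, i)"
      using carr by (simp add: mat_delete_def del: index_mult_mat(1))
    then show "mat_delete (M * T) m m $$ (j, i) =
        mat m m (\<lambda>(j, i). (x j * y m - x m * y j) * (x j ^ (m - 1 - i) * y j ^ i)) $$ (j, i)"
      using ji MT[of j i] by (simp del: index_mult_mat(1))
  qed (use carr in auto)
  also have "det \<dots> = (\<Prod>j<m. x j * y m - x m * y j) * det R"
    unfolding R_def by (rule det_scale_rows)
  finally have "y m ^ m * det M = y m ^ m * ((\<Prod>j<m. x j * y m - x m * y j) * det R)"
    by (simp add: det_mult[OF carr] detT mult.commute)
  \<comment> \<open>The corner entry \<open>y m ^ m\<close> that survives in the last row equals
    \<open>det T\<close>, and it can be cancelled because \<open>y m\<close> is nonzero in a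
    domain.\<close>
  then have "det M = (\<Prod>j<m. x j * y m - x m * y j) * det R" using assms by simp
  then show ?thesis
    by (simp add: hom_vandermonde_def M_def R_def atLeast0LessThan)
qed

lemma hom_vandermonde_prod:
  fixes x y :: "nat \<Rightarrow> 'a::idom"
  assumes "\<And>j. j < m \<Longrightarrow> y j \<noteq> 0"
  shows "hom_vandermonde m x y = (\<Prod>k<m. \<Prod>j<k. x j * y k - x k * y j)"
  using assms
proof (induction m)
  case (Suc m)
  then show ?case by (simp add: hom_vandermonde_Suc mult.commute)
qed (simp add: hom_vandermonde_def)

text \<open>Every factor \<open>x j * y k - x k * y j\<close> is the 2 by 2 determinant of two
  points, so the substitution multiplies it by \<open>a * d - b * c\<close>. There is one factor for
  each pair \<open>j < k\<close>, which is where the exponent \<open>m * (m - 1) div 2\<close> comes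
  from.\<close>

lemma hom_vandermonde_linear_substitution:
  fixes x y :: "nat \<Rightarrow> 'a::idom"
  assumes "\<And>j. j < m \<Longrightarrow> y j \<noteq> 0" "\<And>j. j < m \<Longrightarrow> b * x j + d * y j \<noteq> 0"
  shows "hom_vandermonde m (\<lambda>j. a * x j + c * y j) (\<lambda>j. b * x j + d * y j) =
    (a * d - b * c) ^ (m * (m - 1) div 2) * hom_vandermonde m x y"
proof -
  have *: "(a * x j + c * y j) * (b * x k + d * y k) - (a * x k + c * y k) * (b * x j + d * y j) =
      (a * d - b * c) * (x j * y k - x k * y j)" for j k
    by (simp add: algebra_simps)
  have "(\<Prod>k<m. (a * d - b * c) ^ k) = (a * d - b * c) ^ (m * (m - 1) div 2)"
    using Sum_Ico_nat[of 0 m] by (simp add: power_sum atLeast0LessThan flip: power_sum)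
  then show ?thesis
    by (simp add: hom_vandermonde_prod assms * prod.distrib)
qed

text \<open>A commutative ring viewed as a vector space along \<open>\<iota>\<close>, so that
  functionals with values in \<open>K\<close> or in \<open>K[T]\<close> are ordinary members of
  \<open>linear_maps\<close>.\<close>

definition ring_rep :: "('k::field \<Rightarrow> 'a::comm_ring_1) \<Rightarrow> ('k, 'a, 'g) rep" where
  "ring_rep \<iota> = \<lparr>carrier = UNIV, mult = undefined, one = undefined, zero = 0, add = (+),
     module.smult = (\<lambda>c a. \<iota> c * a), act = undefined\<rparr>"

lemma ring_rep_simps [simp]:
  "carrier (ring_rep \<iota>) = UNIV" "\<zero>\<^bsub>ring_rep \<iota>\<^esub> = 0"
  "x \<oplus>\<^bsub>ring_rep \<iota>\<^esub> y = x + y" "c \<odot>\<^bsub>ring_rep \<iota>\<^esub> x = \<iota> c * x"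
  by (simp_all add: ring_rep_def)

context
  fixes \<iota> :: "'k::field \<Rightarrow> 'a::comm_ring_1"
  assumes \<iota>: "Ring_Hom.comm_ring_hom \<iota>"
begin

interpretation comm_ring_hom \<iota> by (rule \<iota>)

lemma vecspace_ring_rep: "vecspace (ring_rep \<iota> :: ('k, 'a, 'g) rep)"
  by (rule vecspaceI) (auto simp: algebra_simps hom_add hom_mult)

context
  fixes V :: "('k, 'v, 'g) rep" and m :: nat and e :: "nat \<Rightarrow> 'v \<Rightarrow> 'a"
  assumes V: "vecspace V" and e: "\<And>i. i < m \<Longrightarrow> e i \<in> linear_maps V (ring_rep \<iota>)"
begin

lemma multilinear_prod: "multilinear m V (ring_rep \<iota>) (\<lambda>xs. \<Prod>i<m. e i (xs ! i))"
proof -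
  have split: "(\<Prod>k<m. e k (xs[i := x] ! k)) = (\<Prod>k\<in>{..<m} - {i}. e k (xs ! k)) * e i x"
    if "xs \<in> tuples m V" "i < m" for xs i x
  proof -
    have "(\<Prod>k<m. e k (xs[i := x] ! k)) = e i (xs[i := x] ! i) * (\<Prod>k\<in>{..<m} - {i}. e k (xs[i := x] ! k))"
      using that by (intro prod.remove) auto
    also have "(\<Prod>k\<in>{..<m} - {i}. e k (xs[i := x] ! k)) = (\<Prod>k\<in>{..<m} - {i}. e k (xs ! k))"
      by (intro prod.cong) auto
    finally show ?thesis using that tuplesD(1)[OF that(1)] by (simp add: mult.commute)
  qed
  show ?thesis
    by (rule multilinearI)
      (simp_all add: split linear_maps_add[OF e] linear_maps_smult[OF e] algebra_simps)
qed

text \<open>The Leibniz formula writes the determinant as a signed sum of products over permuted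
  lists, and each of these products is multilinear.\<close>

lemma multilinear_det:
  "multilinear m V (ring_rep \<iota>) (\<lambda>xs. det (mat m m (\<lambda>(j, i). e j (xs ! i))))"
proof (rule multilinear_cong[OF V])
  let ?\<phi> = "\<lambda>xs. \<Sum>p\<in>{p. p permutes {..<m}}. signof p * (\<Prod>j<m. e j (permute_list p xs ! j))"
  have ml: "multilinear m V (ring_rep \<iota>) (\<lambda>xs. \<Prod>j<m. e j (permute_list p xs ! j))"
    if "p permutes {..<m}" for p
    by (rule multilinear_permute_list[OF multilinear_prod that])
  show "multilinear m V (ring_rep \<iota>) ?\<phi>"
  proof (rule multilinearI)
    fix xs i x c assume xs: "xs \<in> tuples m V" and i: "i < m" and x: "x \<in> carrier V"
    note lin = multilinearD(2)[OF ml xs i]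
    show "?\<phi> (xs[i := c \<odot>\<^bsub>V\<^esub> x]) = c \<odot>\<^bsub>ring_rep \<iota>\<^esub> ?\<phi> (xs[i := x])"
      using linear_maps_smult[OF lin x, where c = c] unfolding ring_rep_simps sum_distrib_left
      by (intro sum.cong refl) (simp only: mem_Collect_eq mult.left_commute)
    fix y assume y: "y \<in> carrier V"
    show "?\<phi> (xs[i := x \<oplus>\<^bsub>V\<^esub> y]) = ?\<phi> (xs[i := x]) \<oplus>\<^bsub>ring_rep \<iota>\<^esub> ?\<phi> (xs[i := y])"
      using linear_maps_add[OF lin x y] unfolding ring_rep_simps sum.distrib[symmetric]
      by (intro sum.cong refl) (simp only: mem_Collect_eq distrib_left)
  qed simp
  fix xs assume xs: "xs \<in> tuples m V"
  have "det (mat m m (\<lambda>(j, i). e j (xs ! i))) =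
      (\<Sum>p\<in>{p. p permutes {0..<m}}. signof p * (\<Prod>j = 0..<m. mat m m (\<lambda>(j, i). e j (xs ! i)) $$ (j, p j)))"
    by (rule det_def') simp
  also have "\<dots> = ?\<phi> xs"
    unfolding atLeast0LessThan
  proof (rule sum.cong[OF refl])
    fix p assume "p \<in> {p. p permutes {..<m}}"
    then have p: "p permutes {..<m}" by simp
    have "mat m m (\<lambda>(j, i). e j (xs ! i)) $$ (j, p j) = e j (permute_list p xs ! j)" if "j < m" for j
      using that p permutes_in_image[OF p, of j] tuplesD(1)[OF xs] by (simp add: permute_list_nth)
    then show "signof p * (\<Prod>j<m. mat m m (\<lambda>(j, i). e j (xs ! i)) $$ (j, p j)) =
        signof p * (\<Prod>j<m. e j (permute_list p xs ! j))"
      by simp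
  qed
  finally show "det (mat m m (\<lambda>(j, i). e j (xs ! i))) = ?\<phi> xs" .
qed

lemma tensor_eval_exists:
  obtains h where "h \<in> linear_maps (tensor_power m V) (ring_rep \<iota>)"
    and "\<And>xs. xs \<in> tuples m V \<Longrightarrow> h (tensor V xs) = (\<Prod>i<m. e i (xs ! i))"
  using tensor_power_induced[OF V vecspace_ring_rep multilinear_prod] by blast

text \<open>Repeated entries give repeated columns, so the determinant is alternating and factors
  through the exterior power.\<close>

lemma ext_eval_exists:
  obtains h where "h \<in> linear_maps (ext_power m V) (ring_rep \<iota>)"
    and "\<And>xs. xs \<in> tuples m V \<Longrightarrow> h (wedge V xs) = det (mat m m (\<lambda>(j, i). e j (xs ! i)))"
proof (rule ext_power_induced[OF V vecspace_ring_rep multilinear_det])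
  fix xs assume xs: "xs \<in> tuples m V" "\<not> distinct xs"
  then obtain i j where ij: "i < m" "j < m" "i \<noteq> j" "xs ! i = xs ! j"
    using tuplesD(1)[OF xs(1)] by (auto simp: distinct_conv_nth)
  have "det (mat m m (\<lambda>(j, i). e j (xs ! i))) = 0"
    by (rule det_identical_columns[OF _ ij(3,1,2)]) (use ij in \<open>auto intro!: eq_vecI\<close>)
  then show "det (mat m m (\<lambda>(j, i). e j (xs ! i))) = \<zero>\<^bsub>ring_rep \<iota>\<^esub>" by simp
qed (rule that)

end

end

text \<open>Universal properties only assert existence; a choice gives the functional a name. On the
  carrier it is determined by its values on pure tensors.\<close>

definition tensor_eval ::
  "('k::field \<Rightarrow> 'a::comm_ring_1) \<Rightarrow> nat \<Rightarrow> ('k, 'v, 'g) rep \<Rightarrow> (nat \<Rightarrow> 'v \<Rightarrow> 'a) \<Rightarrow>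
     ('v list \<Rightarrow>\<^sub>0 'k) set \<Rightarrow> 'a" where
  "tensor_eval \<iota> m V e = (SOME h. h \<in> linear_maps (tensor_power m V) (ring_rep \<iota>) \<and>
     (\<forall>xs\<in>tuples m V. h (tensor V xs) = (\<Prod>i<m. e i (xs ! i))))"

definition ext_eval ::
  "('k::field \<Rightarrow> 'a::comm_ring_1) \<Rightarrow> nat \<Rightarrow> ('k, 'v, 'g) rep \<Rightarrow> (nat \<Rightarrow> 'v \<Rightarrow> 'a) \<Rightarrow>
     ('v list \<Rightarrow>\<^sub>0 'k) set set \<Rightarrow> 'a" where
  "ext_eval \<iota> m V e = (SOME h. h \<in> linear_maps (ext_power m V) (ring_rep \<iota>) \<and>
     (\<forall>xs\<in>tuples m V. h (wedge V xs) = det (mat m m (\<lambda>(j, i). e j (xs ! i)))))"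

lemma
  assumes "Ring_Hom.comm_ring_hom \<iota>" "vecspace V"
    and "\<And>i. i < m \<Longrightarrow> e i \<in> linear_maps V (ring_rep \<iota>)"
  shows tensor_eval_linear: "tensor_eval \<iota> m V e \<in> linear_maps (tensor_power m V) (ring_rep \<iota>)"
    and tensor_eval_tensor: "xs \<in> tuples m V \<Longrightarrow>
      tensor_eval \<iota> m V e (tensor V xs) = (\<Prod>i<m. e i (xs ! i))"
    and ext_eval_linear: "ext_eval \<iota> m V e \<in> linear_maps (ext_power m V) (ring_rep \<iota>)"
    and ext_eval_wedge: "xs \<in> tuples m V \<Longrightarrow>
      ext_eval \<iota> m V e (wedge V xs) = det (mat m m (\<lambda>(j, i). e j (xs ! i)))"
proof -
  have "\<exists>h. h \<in> linear_maps (tensor_power m V) (ring_rep \<iota>) \<and>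
     (\<forall>xs\<in>tuples m V. h (tensor V xs) = (\<Prod>i<m. e i (xs ! i)))"
    by (rule tensor_eval_exists[OF assms]) blast+
  from someI_ex[OF this]
  show "tensor_eval \<iota> m V e \<in> linear_maps (tensor_power m V) (ring_rep \<iota>)"
    "xs \<in> tuples m V \<Longrightarrow> tensor_eval \<iota> m V e (tensor V xs) = (\<Prod>i<m. e i (xs ! i))"
    by (simp_all add: tensor_eval_def)
  have "\<exists>h. h \<in> linear_maps (ext_power m V) (ring_rep \<iota>) \<and>
     (\<forall>xs\<in>tuples m V. h (wedge V xs) = det (mat m m (\<lambda>(j, i). e j (xs ! i))))"
    by (rule ext_eval_exists[OF assms]) blast+
  from someI_ex[OF this]
  show "ext_eval \<iota> m V e \<in> linear_maps (ext_power m V) (ring_rep \<iota>)"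
    "xs \<in> tuples m V \<Longrightarrow> ext_eval \<iota> m V e (wedge V xs) = det (mat m m (\<lambda>(j, i). e j (xs ! i)))"
    by (simp_all add: ext_eval_def)
qed

section \<open>Symmetric powers of the natural representation\<close>

type_synonym 'k power_vec = "(('k^2) list \<Rightarrow>\<^sub>0 'k) set set"

lemma natE_simps [simp]:
  "carrier natE = UNIV" "\<zero>\<^bsub>natE\<^esub> = 0" "x \<oplus>\<^bsub>natE\<^esub> y = x + y" "c \<odot>\<^bsub>natE\<^esub> x = c *s x"
  "act natE g = (*v) g"
  by (simp_all add: natE_def)

lemma vecspace_natE: "vecspace natE"
  by (rule vecspaceI) (simp_all add: Finite_Cartesian_Product.vec_eq_iff algebra_simps)

lemma tuples_natE [simp]: "tuples r natE = {xs. length xs = r}"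
  by (simp add: tuples_def)

lemma GL2_simps [simp]:
  "carrier GL2 = {A. invertible A}" "mult GL2 = (**)" "one GL2 = Finite_Cartesian_Product.mat 1"
  by (simp_all add: GL2_def)

lemma group_GL2: "group (GL2 :: ('k::field^2^2) monoid)"
proof (rule groupI)
  fix x :: "'k^2^2" assume "x \<in> carrier GL2"
  then obtain y where "x ** y = Finite_Cartesian_Product.mat 1" "y ** x = Finite_Cartesian_Product.mat 1" by (auto simp: invertible_def)
  then show "\<exists>y\<in>carrier GL2. y \<otimes>\<^bsub>GL2\<^esub> x = \<one>\<^bsub>GL2\<^esub>" by (auto simp: invertible_def)
qed (auto simp: matrix_mul_assoc invertible_mult, auto simp: invertible_def)

lemma representation_natE: "representation GL2 natE"
  by (rule representationI[OF group_GL2 vecspace_natE, of UNIV])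
    (auto simp: spans_def matrix_vector_right_distrib vector_scalar_commute matrix_vector_mul_assoc
      intro!: linear_mapsI)

lemma E_X_E_Y_nth [simp]:
  "vec_nth E_X 1 = 1" "vec_nth E_X 2 = 0" "vec_nth E_Y 1 = 0" "vec_nth E_Y 2 = 1"
  by (simp_all add: E_X_def E_Y_def axis_def)

lemma spans_natE: "spans (natE :: ('k::field, _, _) rep) {E_X, E_Y}"
  unfolding spans_def
proof (intro conjI allI impI subsetI)
  let ?E = "natE :: ('k, _, _) rep"
  interpret E: Module.module scalars ?E by (rule vecspace_natE)
  fix H and v :: "'k^2"
  assume H: "submodule H scalars ?E \<and> {E_X, E_Y} \<subseteq> H"
  then have "vec_nth v 1 *s E_X + vec_nth v 2 *s E_Y \<in> H"
    using E.submoduleE(4)[of H "vec_nth v 1" E_X] E.submoduleE(4)[of H "vec_nth v 2" E_Y]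
      E.submoduleE(5)[of H "vec_nth v 1 *s E_X" "vec_nth v 2 *s E_Y"] by simp
  moreover have "vec_nth v 1 *s E_X + vec_nth v 2 *s E_Y = v"
    by (simp add: Finite_Cartesian_Product.vec_eq_iff forall_2)
  ultimately show "v \<in> H" by simp
qed simp

abbreviation symE :: "nat \<Rightarrow> ('k::field, 'k power_vec, 'k^2^2) rep" where
  "symE d \<equiv> sym_upper d natE"

lemma vecspace_symE: "vecspace (symE d)"
  by (rule vecspace_sym_upper[OF vecspace_natE])

lemma sym_prod_symE_closed: "length vs = d \<Longrightarrow> sym_prod natE vs \<in> carrier (symE d)"
  using multilinearD(1)[OF multilinear_sym_prod[OF vecspace_natE], of vs d] by simp

lemma monomial_closed: "a + b = d \<Longrightarrow> monomial a b \<in> carrier (symE d)"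
  unfolding monomial_def by (rule sym_prod_symE_closed) simp

text \<open>A product of copies of \<open>E_X\<close> and \<open>E_Y\<close> depends only on how
  many of its factors are \<open>E_X\<close>.\<close>

lemma spans_symE: "spans (symE d :: ('a::field, _, _) rep) ((\<lambda>i. monomial i (d - i)) ` {..d})"
proof (rule spans_trans[OF spans_sym_upper_gens[OF vecspace_natE spans_natE]])
  show "(\<lambda>i. monomial i (d - i)) ` {..d} \<subseteq> carrier (symE d :: ('a, _, _) rep)"
    by (auto intro: monomial_closed)
  fix H :: "'a power_vec set" assume H: "(\<lambda>i. monomial i (d - i)) ` {..d} \<subseteq> H"
  show "sym_prod natE ` {xs. length xs = d \<and> set xs \<subseteq> {E_X, E_Y}} \<subseteq> H"
  proof (rule image_subsetI)
    fix xs :: "('a^2) list" assume xs: "xs \<in> {xs. length xs = d \<and> set xs \<subseteq> {E_X, E_Y}}"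
    define i where "i = count (mset xs) E_X"
    \<comment> \<open>If the two vectors coincided, counting the copies of \<open>E_X\<close> would
      count all entries.\<close>
    have ne: "E_X \<noteq> (E_Y :: 'a^2)"
    proof
      assume "E_X = (E_Y :: 'a^2)"
      then have "vec_nth E_X 1 = vec_nth (E_Y :: 'a^2) 1" by simp
      then show False by simp
    qed
    have "mset xs = replicate_mset i E_X + replicate_mset (d - i) E_Y \<and> i \<le> d"
      using xs unfolding i_def
    proof (induction xs arbitrary: d)
      case (Cons x xs)
      then show ?case using Cons.IH[of "length xs"] ne by (auto simp: Suc_diff_le)
    qed simp
    then have "sym_prod natE xs = monomial i (d - i)" "i \<le> d"
      using xs unfolding monomial_def
      by (auto intro!: sym_prod_mset_eq[OF vecspace_natE, of _ d])
    then show "sym_prod natE xs \<in> H" using H by auto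
  qed
qed

subsection \<open>Evaluation and multiplication by monomials\<close>

lemma prod_nth_append:
  fixes f :: "'b \<Rightarrow> 'a::comm_monoid_mult"
  assumes "length us = d"
  shows "(\<Prod>i<d + length vs. f ((us @ vs) ! i)) = (\<Prod>i<d. f (us ! i)) * (\<Prod>i<length vs. f (vs ! i))"
proof -
  have *: "(\<Prod>i<length ws. f (ws ! i)) = prod_list (map f ws)" for ws
    by (simp add: prod.list_conv_set_nth atLeast0LessThan)
  show ?thesis using *[of "us @ vs"] *[of us] *[of vs] assms by simp
qed

text \<open>Vectors of \<open>E\<close> are read as linear forms in \<open>X\<close> and
  \<open>Y\<close>, and elements of symmetric powers as homogeneous polynomials; this is the value
  of such a form at the point \<open>(x, y)\<close>.\<close>

definition lin_form :: "('k::field \<Rightarrow> 'a::comm_ring_1) \<Rightarrow> 'a \<Rightarrow> 'a \<Rightarrow> 'k^2 \<Rightarrow> 'a" where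
  "lin_form \<iota> x y v = \<iota> (vec_nth v 1) * x + \<iota> (vec_nth v 2) * y"

definition sym_eval ::
  "('k::field \<Rightarrow> 'a::comm_ring_1) \<Rightarrow> nat \<Rightarrow> 'a \<Rightarrow> 'a \<Rightarrow> 'k power_vec \<Rightarrow> 'a" where
  "sym_eval \<iota> d x y = (SOME h. h \<in> linear_maps (symE d) (ring_rep \<iota>) \<and>
     (\<forall>vs. length vs = d \<longrightarrow> h (sym_prod natE vs) = (\<Prod>i<d. lin_form \<iota> x y (vs ! i))))"

context
  fixes \<iota> :: "'k::field \<Rightarrow> 'a::comm_ring_1"
  assumes \<iota>: "Ring_Hom.comm_ring_hom \<iota>"
begin

interpretation comm_ring_hom \<iota> by (rule \<iota>)

lemma sym_eval_linear: "sym_eval \<iota> d x y \<in> linear_maps (symE d) (ring_rep \<iota>)"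
  and sym_eval_sym_prod: "length vs = d \<Longrightarrow>
    sym_eval \<iota> d x y (sym_prod natE vs) = (\<Prod>i<d. lin_form \<iota> x y (vs ! i))"
proof -
  have lin: "lin_form \<iota> x y \<in> linear_maps natE (ring_rep \<iota>)"
    by (rule linear_mapsI) (simp_all add: lin_form_def hom_distribs algebra_simps)
  have "\<exists>h. h \<in> linear_maps (symE d) (ring_rep \<iota>) \<and>
     (\<forall>vs :: ('k^2) list. length vs = d \<longrightarrow> h (sym_prod natE vs) = (\<Prod>i<d. lin_form \<iota> x y (vs ! i)))"
  proof (rule sym_upper_induced[OF vecspace_natE vecspace_ring_rep[OF \<iota>]
        multilinear_prod[OF \<iota> vecspace_natE lin]])
    fix vs :: "('k^2) list" and \<sigma> assume vs: "vs \<in> tuples d natE" and \<sigma>: "\<sigma> permutes {..<d}"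
    have "(\<Prod>i<d. lin_form \<iota> x y (permute_list \<sigma> vs ! i)) = (\<Prod>i<d. lin_form \<iota> x y (vs ! \<sigma> i))"
      using vs \<sigma> by (intro prod.cong) (auto simp: permute_list_nth)
    also have "\<dots> = (\<Prod>i<d. lin_form \<iota> x y (vs ! i))"
      using prod.permute[OF \<sigma>, of "\<lambda>i. lin_form \<iota> x y (vs ! i)"] by (simp add: o_def)
    finally show "(\<Prod>i<d. lin_form \<iota> x y (permute_list \<sigma> vs ! i)) = (\<Prod>i<d. lin_form \<iota> x y (vs ! i))" .
  next
    fix h assume "h \<in> linear_maps (symE d) (ring_rep \<iota>)"
      and "\<And>vs :: ('k^2) list. vs \<in> tuples d natE \<Longrightarrow> h (sym_prod natE vs) = (\<Prod>i<d. lin_form \<iota> x y (vs ! i))"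
    then show ?thesis by auto
  qed
  from someI_ex[OF this]
  show "sym_eval \<iota> d x y \<in> linear_maps (symE d) (ring_rep \<iota>)"
    "length vs = d \<Longrightarrow> sym_eval \<iota> d x y (sym_prod natE vs) = (\<Prod>i<d. lin_form \<iota> x y (vs ! i))"
    by (simp_all add: sym_eval_def)
qed

lemma prod_lin_form_monomial:
  "(\<Prod>i<a + b. lin_form \<iota> x y ((replicate a E_X @ replicate b E_Y) ! i)) = x ^ a * y ^ b"
  using prod_nth_append[of "replicate a E_X" a "lin_form \<iota> x y" "replicate b E_Y"]
  by (simp add: lin_form_def)

lemma sym_eval_monomial: "a + b = d \<Longrightarrow> sym_eval \<iota> d x y (monomial a b) = x ^ a * y ^ b"
  using prod_lin_form_monomial[where x = x and y = y and a = a and b = b] by (auto simp: monomial_def sym_eval_sym_prod)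

text \<open>The form \<open>g *v v\<close> has at \<open>(x, y)\<close> the same value as the form
  \<open>v\<close> at the point moved by the transpose of \<open>g\<close>. Products of forms
  inherit this.\<close>

lemma sym_eval_act:
  assumes g: "g \<in> carrier GL2" and p: "p \<in> carrier (symE d)"
  shows "sym_eval \<iota> d x y (act (symE d) g p) =
    sym_eval \<iota> d (\<iota> (vec_nth (vec_nth g 1) 1) * x + \<iota> (vec_nth (vec_nth g 2) 1) * y)
      (\<iota> (vec_nth (vec_nth g 1) 2) * x + \<iota> (vec_nth (vec_nth g 2) 2) * y) p"
    (is "_ = sym_eval \<iota> d ?x ?y p")
proof -
  have act: "act (symE d) g \<in> linear_maps (symE d) (symE d)"
    by (rule act_linear_map[OF representation_sym_upper[OF representation_natE] g])
  have lf: "lin_form \<iota> x y (g *v v) = lin_form \<iota> ?x ?y v" for v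
    by (simp add: lin_form_def matrix_vector_mult_def sum_2 hom_distribs algebra_simps)
  show ?thesis
  proof (rule spans_eqI[OF spans_sym_upper[OF vecspace_natE] vecspace_symE vecspace_ring_rep[OF \<iota>]
        linear_maps_comp[OF act sym_eval_linear] sym_eval_linear _ p])
    fix s assume "s \<in> sym_prod natE ` tuples d (natE :: ('k, _, _) rep)"
    then obtain vs where s: "s = sym_prod natE vs" and vs: "length vs = d" by auto
    have "act (symE d) g s = sym_prod natE (map ((*v) g) vs)"
      unfolding s using act_sym_prod[OF representation_natE g, of vs d] vs by simp
    then show "sym_eval \<iota> d x y (act (symE d) g s) = sym_eval \<iota> d ?x ?y s"
      using vs by (simp add: s sym_eval_sym_prod lf)
  qed
qed

end

text \<open>Appending factors to a product of vectors realizes multiplication by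
  \<open>X^a Y^b\<close> on the whole symmetric power, not just on its monomials.\<close>

definition mon_mult ::
  "nat \<Rightarrow> nat \<Rightarrow> nat \<Rightarrow> ('k::field) power_vec \<Rightarrow> 'k power_vec" where
  "mon_mult d a b = (SOME h. h \<in> linear_maps (symE d) (symE (d + a + b)) \<and>
     (\<forall>vs. length vs = d \<longrightarrow>
       h (sym_prod natE vs) = sym_prod natE (vs @ replicate a E_X @ replicate b E_Y)))"

lemma
  fixes vs :: "('a::field^2) list"
  shows mon_mult_linear: "(mon_mult d a b :: 'a power_vec \<Rightarrow> _) \<in>
      linear_maps (symE d) (symE (d + a + b))"
    and mon_mult_sym_prod: "length vs = d \<Longrightarrow>
    mon_mult d a b (sym_prod natE vs) = sym_prod natE (vs @ replicate a E_X @ replicate b E_Y)"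
proof -
  let ?ws = "replicate a E_X @ replicate b E_Y :: ('a^2) list"
  have ml: "multilinear d natE (symE (d + a + b)) (\<lambda>vs :: ('a^2) list. sym_prod natE (vs @ ?ws))"
    unfolding multilinear_def
  proof (intro conjI ballI allI impI Pi_I)
    fix vs :: "('a^2) list" assume vs: "vs \<in> tuples d natE"
    then have t: "vs @ ?ws \<in> tuples (d + a + b) natE" by simp
    show "sym_prod natE (vs @ ?ws) \<in> carrier (symE (d + a + b))"
      using vs by (intro sym_prod_symE_closed) simp
    fix i assume i: "i < d"
    then have "(vs @ ?ws)[i := x] = vs[i := x] @ ?ws" for x using vs by (simp add: list_update_append1)
    then show "(\<lambda>x. sym_prod natE (vs[i := x] @ ?ws)) \<in> linear_maps natE (symE (d + a + b))"
      using multilinearD(2)[OF multilinear_sym_prod[OF vecspace_natE] t, of i] i by simp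
  qed
  have "\<exists>h. h \<in> linear_maps (symE d) (symE (d + a + b) :: ('a, _, _) rep) \<and>
     (\<forall>vs :: ('a^2) list. length vs = d \<longrightarrow> h (sym_prod natE vs) = sym_prod natE (vs @ ?ws))"
  proof (rule sym_upper_induced[OF vecspace_natE vecspace_symE ml])
    fix vs :: "('a^2) list" and \<sigma> assume vs: "vs \<in> tuples d natE" and \<sigma>: "\<sigma> permutes {..<d}"
    then show "sym_prod natE (permute_list \<sigma> vs @ ?ws) = sym_prod natE (vs @ ?ws)"
      by (intro sym_prod_mset_eq[OF vecspace_natE, of _ "d + a + b"]) auto
  next
    fix h assume "h \<in> linear_maps (symE d) (symE (d + a + b))"
      and "\<And>vs :: ('a^2) list. vs \<in> tuples d natE \<Longrightarrow> h (sym_prod natE vs) = sym_prod natE (vs @ ?ws)"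
    then show ?thesis by auto
  qed
  from someI_ex[OF this]
  show "(mon_mult d a b :: 'a power_vec \<Rightarrow> _) \<in>
      linear_maps (symE d) (symE (d + a + b))"
    "length vs = d \<Longrightarrow> mon_mult d a b (sym_prod natE vs) = sym_prod natE (vs @ ?ws)"
    by (simp_all add: mon_mult_def)
qed

lemma mon_mult_monomial: "i + j = d \<Longrightarrow> mon_mult d a b (monomial i j) = monomial (i + a) (j + b)"
  unfolding monomial_def
  by (subst mon_mult_sym_prod)
    (auto intro!: sym_prod_mset_eq[OF vecspace_natE, of _ "d + a + b"] multiset_eqI)

text \<open>Evaluation is multiplicative on products of linear forms, and both sides are linear in
  \<open>p\<close>.\<close>

lemma sym_eval_mon_mult:
  assumes \<iota>: "Ring_Hom.comm_ring_hom \<iota>" and p: "p \<in> carrier (symE d)"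
  shows "sym_eval \<iota> (d + a + b) x y (mon_mult d a b p) = sym_eval \<iota> d x y p * (x ^ a * y ^ b)"
proof -
  have lin: "(\<lambda>p. sym_eval \<iota> d x y p * (x ^ a * y ^ b)) \<in> linear_maps (symE d) (ring_rep \<iota>)"
    by (rule linear_mapsI)
      (simp_all add: linear_maps_add[OF sym_eval_linear[OF \<iota>]] linear_maps_smult[OF sym_eval_linear[OF \<iota>]]
        algebra_simps)
  show ?thesis
  proof (rule spans_eqI[OF spans_sym_upper[OF vecspace_natE] vecspace_symE vecspace_ring_rep[OF \<iota>]
        linear_maps_comp[OF mon_mult_linear sym_eval_linear[OF \<iota>]] lin _ p])
    fix s assume "s \<in> sym_prod natE ` tuples d (natE :: ('a, _, _) rep)"
    then obtain vs where s: "s = sym_prod natE vs" and vs: "length vs = d" by auto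
    show "sym_eval \<iota> (d + a + b) x y (mon_mult d a b s) = sym_eval \<iota> d x y s * (x ^ a * y ^ b)"
      using prod_nth_append[OF vs, of "lin_form \<iota> x y" "replicate a E_X @ replicate b E_Y"]
        prod_lin_form_monomial[OF \<iota>, where x = x and y = y and a = a and b = b] vs
      by (simp add: s mon_mult_sym_prod sym_eval_sym_prod[OF \<iota>] add.assoc)
  qed
qed

section \<open>Powers of the determinant representation\<close>

definition det2 :: "'k::field^2^2 \<Rightarrow> 'k" where
  "det2 g = vec_nth (vec_nth g 1) 1 * vec_nth (vec_nth g 2) 2 -
     vec_nth (vec_nth g 1) 2 * vec_nth (vec_nth g 2) 1"

text \<open>The functional taking \<open>v \<and> w\<close> to the 2 by 2 determinant of
  coordinates, built from the two coordinate forms of \<open>E\<close>. It will be the coordinate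
  with respect to \<open>detE_gen\<close>.\<close>

definition det_coord :: "('k::field) power_vec \<Rightarrow> 'k" where
  "det_coord = ext_eval (\<lambda>c. c) 2 natE (\<lambda>i v. vec_nth v (if i = 0 then 1 else 2))"

lemma det_mat_2: "det (mat 2 2 f) = f (0, 0) * f (1, 1) - f (0, 1) * f (1, 0)"
proof -
  have "det (mat 2 2 f) = (\<Sum>j<2. mat 2 2 f $$ (0, j) * cofactor (mat 2 2 f) 0 j)"
    by (rule laplace_expansion_row[of _ 2]) auto
  also have "\<dots> = f (0, 0) * f (1, 1) - f (0, 1) * f (1, 0)"
    by (simp add: numeral_2_eq_2 cofactor_def mat_delete_def det_single)
  finally show ?thesis .
qed

lemma comm_ring_hom_ident: "Ring_Hom.comm_ring_hom (\<lambda>c :: 'a::comm_ring_1. c)"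
  by unfold_locales auto

lemma
  fixes v w :: "'a::field^2"
  shows det_coord_linear: "(det_coord :: 'a power_vec \<Rightarrow> 'a) \<in>
      linear_maps detE (ring_rep (\<lambda>c. c))"
    and det_coord_wedge: "det_coord (wedge natE [v, w]) =
    vec_nth v 1 * vec_nth w 2 - vec_nth w 1 * vec_nth v 2"
proof -
  have lin: "(\<lambda>v :: 'a^2. vec_nth v (if i = 0 then 1 else 2)) \<in> linear_maps natE (ring_rep (\<lambda>c. c))"
    for i :: nat
    by (rule linear_mapsI) auto
  show "(det_coord :: 'a power_vec \<Rightarrow> 'a) \<in> linear_maps detE (ring_rep (\<lambda>c. c))"
    unfolding det_coord_def by (rule ext_eval_linear[OF comm_ring_hom_ident vecspace_natE lin])
  show "det_coord (wedge natE [v, w]) = vec_nth v 1 * vec_nth w 2 - vec_nth w 1 * vec_nth v 2"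
    unfolding det_coord_def
    by (rule trans[OF ext_eval_wedge[OF comm_ring_hom_ident vecspace_natE lin]]) (simp_all add: det_mat_2)
qed

abbreviation detE_gen :: "('k::field) power_vec" where
  "detE_gen \<equiv> wedge natE [E_X, E_Y]"

lemma vecspace_detE: "vecspace detE"
  by (rule vecspace_ext_power[OF vecspace_natE])

lemma representation_detE: "representation GL2 detE"
  by (rule representation_ext_power[OF representation_natE])

lemma detE_gen_closed: "detE_gen \<in> carrier detE"
  by (rule wedge_closed[OF vecspace_natE]) simp

lemma linear_maps_ring_rep_smult:
  fixes V :: "('k::field, 'v, 'g) rep" and W :: "('k, 'w, 'g) rep"
  assumes W: "vecspace W" and f: "f \<in> linear_maps V (ring_rep (\<lambda>c. c))" and w: "w \<in> carrier W"
  shows "(\<lambda>v. f v \<odot>\<^bsub>W\<^esub> w) \<in> linear_maps V W"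
  by (rule linear_mapsI)
    (simp_all add: linear_maps_add[OF f] linear_maps_smult[OF f] vecspace_simps[OF W w])

text \<open>The wedges of \<open>E_X\<close> and \<open>E_Y\<close> that span the space are zero or
  plus or minus \<open>detE_gen\<close>, and \<open>det_coord\<close> reads off the factor.
  One-dimensionality of the determinant representation is used in this form.\<close>

lemma detE_eq_smult_gen:
  assumes "w \<in> carrier detE"
  shows "w = det_coord w \<odot>\<^bsub>detE\<^esub> detE_gen"
proof (rule spans_eqI[OF spans_ext_power_gens[OF vecspace_natE spans_natE] vecspace_detE vecspace_detE
      linear_maps_id linear_maps_ring_rep_smult[OF vecspace_detE det_coord_linear detE_gen_closed] _ assms])
  fix s :: "'a power_vec"
  assume "s \<in> wedge natE ` {xs. length xs = 2 \<and> set xs \<subseteq> {E_X, E_Y}}"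
  then obtain v w where s: "s = wedge natE [v, w]" and vw: "v \<in> {E_X, E_Y}" "w \<in> {E_X, E_Y}"
    by (auto simp: length_Suc_conv numeral_2_eq_2)
  show "s = det_coord s \<odot>\<^bsub>detE\<^esub> detE_gen"
  proof (cases "v = w")
    case True
    then have "s = \<zero>\<^bsub>detE\<^esub>" unfolding s by (intro wedge_not_distinct[OF vecspace_natE]) auto
    moreover have "det_coord s = 0" unfolding s det_coord_wedge using True by simp
    ultimately show ?thesis by (simp add: vecspace_simps[OF vecspace_detE detE_gen_closed])
  next
    case False
    then consider "v = E_X" "w = E_Y" | "v = E_Y" "w = E_X" using vw by auto
    then show ?thesis
    proof cases
      case 1
      then have "det_coord s = 1" unfolding s det_coord_wedge by simp
      then show ?thesis using 1 by (simp add: s vecspace_simps[OF vecspace_detE detE_gen_closed])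
    next
      case 2
      then have "det_coord s = -1" unfolding s det_coord_wedge by simp
      moreover have "s = \<ominus>\<^bsub>detE\<^esub> detE_gen"
        using wedge_swap[OF vecspace_natE, of "[E_X, E_Y]" 2 0 1] 2 by (simp add: s)
      ultimately show ?thesis by (simp add: vecspace_simps(6)[OF vecspace_detE detE_gen_closed])
    qed
  qed
qed

lemma spans_detE: "spans detE {detE_gen}"
  unfolding spans_def
proof (intro conjI allI impI subsetI)
  fix H and w :: "'a power_vec"
  assume H: "submodule H scalars (detE :: ('a, _, _) rep) \<and> {detE_gen} \<subseteq> H" and w: "w \<in> carrier detE"
  interpret D: Module.module scalars "detE :: ('a, _, _) rep" by (rule vecspace_detE)
  have "det_coord w \<odot>\<^bsub>detE\<^esub> detE_gen \<in> H"
    using D.submoduleE(4)[of H "det_coord w" detE_gen] H by simp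
  then show "w \<in> H" using detE_eq_smult_gen[OF w] by simp
qed (use detE_gen_closed in auto)

lemma det_coord_act:
  assumes g: "g \<in> carrier GL2"
  shows "det_coord (act detE g detE_gen) = det2 g"
proof -
  have "act detE g detE_gen = wedge natE (map ((*v) g) [E_X, E_Y])"
    using act_wedge[OF representation_natE g, of "[E_X, E_Y]" 2] by simp
  then show ?thesis
    by (simp add: det_coord_wedge det2_def matrix_vector_mult_def sum_2 mult.commute)
qed

definition det_power_coord ::
  "nat \<Rightarrow> (('k::field) power_vec list \<Rightarrow>\<^sub>0 'k) set \<Rightarrow> 'k" where
  "det_power_coord N = tensor_eval (\<lambda>c. c) N detE (\<lambda>_. det_coord)"

lemma replicate_tuples: "replicate N detE_gen \<in> tuples N detE"
  by (simp add: tuples_iff_nth detE_gen_closed)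

lemma det_power_coord_linear:
  "det_power_coord N \<in> linear_maps (tensor_power N detE) (ring_rep (\<lambda>c. c))"
  unfolding det_power_coord_def
  by (rule tensor_eval_linear[OF comm_ring_hom_ident vecspace_detE det_coord_linear])

lemma det_power_coord_tensor:
  "ws \<in> tuples N detE \<Longrightarrow> det_power_coord N (tensor detE ws) = (\<Prod>i<N. det_coord (ws ! i))"
  unfolding det_power_coord_def
  by (rule tensor_eval_tensor[OF comm_ring_hom_ident vecspace_detE det_coord_linear])

lemma det_generator_closed: "det_generator N \<in> carrier (tensor_power N detE)"
  unfolding det_generator_def by (rule tensor_closed[OF vecspace_detE replicate_tuples])

lemma det_power_coord_generator: "det_power_coord N (det_generator N) = 1"
  unfolding det_generator_def
  by (simp add: det_power_coord_tensor[OF replicate_tuples] det_coord_wedge)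

lemma det_power_eq_smult_generator:
  assumes "s \<in> carrier (tensor_power N detE)"
  shows "s = det_power_coord N s \<odot>\<^bsub>tensor_power N detE\<^esub> det_generator N"
proof (rule spans_eqI[OF spans_tensor_power_gens[OF vecspace_detE spans_detE]
      vecspace_tensor_power[OF vecspace_detE] vecspace_tensor_power[OF vecspace_detE] linear_maps_id
      linear_maps_ring_rep_smult[OF vecspace_tensor_power[OF vecspace_detE] det_power_coord_linear
        det_generator_closed] _ assms])
  fix t :: "('a power_vec list \<Rightarrow>\<^sub>0 'a) set"
  assume "t \<in> tensor detE ` {xs. length xs = N \<and> set xs \<subseteq> {detE_gen}}"
  then obtain xs where "t = tensor detE xs" "length xs = N" "set xs \<subseteq> {detE_gen}" by auto
  moreover have "xs = replicate N detE_gen" if "length xs = N" "set xs \<subseteq> {detE_gen}"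
    using that by (auto intro!: replicate_eqI)
  ultimately have "t = det_generator N" by (simp add: det_generator_def)
  then show "t = det_power_coord N t \<odot>\<^bsub>tensor_power N detE\<^esub> det_generator N"
    by (simp add: det_power_coord_generator
        vecspace_simps(2)[OF vecspace_tensor_power[OF vecspace_detE] det_generator_closed])
qed

text \<open>On the generator the group acts factor by factor, each factor contributing
  \<open>det2 g\<close>; every other tensor is a multiple of the generator.\<close>

lemma det_power_coord_act:
  assumes g: "g \<in> carrier GL2" and s: "s \<in> carrier (tensor_power N detE)"
  shows "det_power_coord N (act (tensor_power N detE) g s) = det2 g ^ N * det_power_coord N s"
proof -
  note act = act_tensor_power[OF vecspace_detE act_linear_map[OF representation_detE g], where r = N]
  have "det_power_coord N (act (tensor_power N detE) g (det_generator N)) = det2 g ^ N"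
    unfolding det_generator_def act(2)[OF replicate_tuples]
    by (subst det_power_coord_tensor[OF tuples_map_act[OF representation_detE g replicate_tuples]])
      (simp add: det_coord_act[OF g])
  then have "det_power_coord N (act (tensor_power N detE) g
      (det_power_coord N s \<odot>\<^bsub>tensor_power N detE\<^esub> det_generator N)) = det2 g ^ N * det_power_coord N s"
    by (simp add: linear_maps_smult[OF act(1) det_generator_closed] mult.commute
        linear_maps_smult[OF det_power_coord_linear linear_maps_closed[OF act(1) det_generator_closed]])
  then show ?thesis using det_power_eq_smult_generator[OF s] by simp
qed

text \<open>Otherwise the lower right entry of \<open>h ** g\<close> would be 0 instead of 1. This
  keeps the second coordinates of the generic point nonzero after the substitution by
  \<open>g\<close>.\<close>

lemma GL2_second_column:
  assumes "g \<in> carrier GL2"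
  shows "vec_nth (vec_nth g 1) 2 \<noteq> 0 \<or> vec_nth (vec_nth g 2) 2 \<noteq> 0"
proof -
  obtain h where h: "h ** g = Finite_Cartesian_Product.mat 1" using assms by (auto simp: invertible_def)
  have "vec_nth (vec_nth (h ** g) i) j = vec_nth (vec_nth h i) 1 * vec_nth (vec_nth g 1) j +
      vec_nth (vec_nth h i) 2 * vec_nth (vec_nth g 2) j" for i j
    by (simp add: matrix_matrix_mult_def sum_2)
  note * = this[unfolded h Finite_Cartesian_Product.mat_def]
  show "vec_nth (vec_nth g 1) 2 \<noteq> 0 \<or> vec_nth (vec_nth g 2) 2 \<noteq> 0"
    using *[of 2 2] by auto
qed

section \<open>Exponent sequences\<close>

text \<open>Adds the staircase \<open>m - 1, ..., 1, 0\<close>, with \<open>m\<close> the length: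
  the exponent shift of the Wronskian map, positions being counted from 0.\<close>

definition stair :: "nat list \<Rightarrow> nat list" where
  "stair js = map (\<lambda>j. js ! j + (length js - 1 - j)) [0..<length js]"

lemma length_stair [simp]: "length (stair js) = length js"
  by (simp add: stair_def)

lemma stair_nth: "j < length js \<Longrightarrow> stair js ! j = js ! j + (length js - 1 - j)"
  by (simp add: stair_def)

text \<open>The measure for the triangularity argument. It ignores the order of the exponents, as
  wedge products do up to sign, but after adding the staircase it singles out the decreasing
  arrangement of a multiset.\<close>

definition square_sum :: "nat list \<Rightarrow> nat" where
  "square_sum js = (\<Sum>j\<leftarrow>js. j\<^sup>2)"

lemma square_sum_mset_eq: "mset js = mset ks \<Longrightarrow> square_sum js = square_sum ks"
  unfolding square_sum_def by (metis mset_map sum_mset_sum_list)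

lemma square_sum_nth: "square_sum js = (\<Sum>j<length js. (js ! j)\<^sup>2)"
  unfolding square_sum_def by (simp add: sum_list_sum_nth atLeast0LessThan)

text \<open>Moving the larger entry \<open>q\<close> to the larger step, in exchange for the smaller
  entry \<open>p\<close>, raises the sum of squares by \<open>2 * (q - p)\<close>; all other
  positions are untouched.\<close>

lemma stair_swap_less:
  assumes "Suc j < length js" "js ! j < js ! Suc j"
  shows "square_sum (stair js) < square_sum (stair (js[j := js ! Suc j, Suc j := js ! j]))"
proof -
  let ?ks = "js[j := js ! Suc j, Suc j := js ! j]"
  let ?S = "{..<length js} - {j, Suc j}"
  have split: "(\<Sum>i<length js. f i) = f j + f (Suc j) + (\<Sum>i\<in>?S. f i)" for f :: "nat \<Rightarrow> nat"
  proof -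
    have "{..<length js} = insert j (insert (Suc j) ?S)" using assms(1) by auto
    then show ?thesis
      by (metis (no_types, lifting) Diff_iff add.assoc finite_Diff finite_insert finite_lessThan
          insertCI insertE n_not_Suc_n sum.insert)
  qed
  have rest: "(\<Sum>i\<in>?S. (stair ?ks ! i)\<^sup>2) = (\<Sum>i\<in>?S. (stair js ! i)\<^sup>2)"
    by (intro sum.cong) (auto simp: stair_nth nth_list_update)
  define p q r where pqr: "p = js ! j" "q = js ! Suc j" "r = length js - 1 - Suc j"
  have r: "length js - 1 - j = Suc r" using assms(1) by (simp add: pqr)
  have "stair js ! j = p + Suc r" "stair js ! Suc j = q + r"
    "stair ?ks ! j = q + Suc r" "stair ?ks ! Suc j = p + r"
    using assms(1) r by (simp_all add: stair_nth pqr)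
  moreover obtain d where "q = p + Suc d" using assms(2) less_iff_Suc_add[of p q] by (auto simp: pqr)
  ultimately have "(stair js ! j)\<^sup>2 + (stair js ! Suc j)\<^sup>2 < (stair ?ks ! j)\<^sup>2 + (stair ?ks ! Suc j)\<^sup>2"
    by (simp add: power2_eq_square algebra_simps)
  then show ?thesis
    unfolding square_sum_nth length_stair length_list_update split rest by simp
qed

text \<open>An ordering with an ascent is not maximal for \<open>square_sum \<circ> stair\<close>, as the ascent can be swapped.\<close>

lemma square_sum_stair_less:
  assumes "sorted (rev is)" "mset js = mset is" "js \<noteq> is"
  shows "square_sum (stair js) < square_sum (stair is)"
proof -
  define P where "P = permutations_of_multiset (mset is)"
  have fin: "finite P" by (simp add: P_def)
  have mem: "ks \<in> P \<longleftrightarrow> mset ks = mset is" for ks by (simp add: P_def permutations_of_multiset_def)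
  have max_eq: "ks = is" if ks: "ks \<in> P" and max: "\<And>ks'. ks' \<in> P \<Longrightarrow>
    square_sum (stair ks') \<le> square_sum (stair ks)" for ks
  proof -
    have "ks ! Suc j \<le> ks ! j" if j: "Suc j < length ks" for j
    proof (rule ccontr)
      assume "\<not> ks ! Suc j \<le> ks ! j"
      then have "square_sum (stair ks) < square_sum (stair (ks[j := ks ! Suc j, Suc j := ks ! j]))"
        using stair_swap_less[OF j] by simp
      moreover have "ks[j := ks ! Suc j, Suc j := ks ! j] \<in> P"
        using ks j by (simp add: mem mset_swap)
      ultimately show False using max by (meson leD)
    qed
    then have "sorted_wrt (\<ge>) ks"
      by (subst sorted_wrt_iff_nth_Suc_transp) (auto intro: transpI)
    then have "sorted (rev ks)" by (simp add: sorted_wrt_rev)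
    moreover have "mset (rev ks) = mset (rev is)" using ks by (simp add: mem)
    ultimately have "rev ks = rev is" using assms(1) by (metis properties_for_sort)
    then show ?thesis by simp
  qed
  have ne: "is \<in> P" by (simp add: mem)
  \<comment> \<open>A maximum exists because there are finitely many arrangements; as every
    maximizer equals \<open>is\<close>, any other arrangement falls strictly below.\<close>
  define f where "f ks = square_sum (stair ks)" for ks
  have "Max (f ` P) \<in> f ` P" using ne fin by (intro Max_in) auto
  then obtain ks where ks: "ks \<in> P" "f ks = Max (f ` P)" by auto
  have max: "square_sum (stair ks') \<le> square_sum (stair ks)" if "ks' \<in> P" for ks'
    using Max_ge[of "f ` P" "f ks'"] fin that ks(2) by (simp add: f_def)
  have "ks = is" using max_eq[OF ks(1) max] .
  then have is_max: "\<And>ks'. ks' \<in> P \<Longrightarrow> square_sum (stair ks') \<le> square_sum (stair is)" using max by simp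
  have "js \<in> P" using assms(2) by (simp add: mem)
  then show ?thesis
    using is_max max_eq[of js] assms(3) by (metis le_neq_implies_less)
qed

text \<open>A strictly decreasing sequence of naturals drops by at least 1 at each step, so
  subtracting the staircase never truncates and leaves a weakly decreasing sequence. The first entry
  loses \<open>m - 1\<close>, which turns the bound \<open>l + m - 1\<close> into
  \<open>l\<close>.\<close>

lemma strictly_decreasing_eq_stair:
  assumes a: "sorted_wrt (>) a" "length a = m" "set a \<subseteq> {..l + m - 1}"
  obtains "is" where "length is = m" "set is \<subseteq> {..l}" "sorted (rev is)" "stair is = a"
proof -
  have gap: "a ! j + (j - i) \<le> a ! i" if "i \<le> j" "j < m" for i j
    using that
  proof (induction j rule: dec_induct)
    case (step k)
    then show ?case using sorted_wrt_nth_less[OF a(1), of k "Suc k"] a(2) by (simp add: Suc_diff_le)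
  qed simp
  define js where "js = map (\<lambda>j. a ! j - (m - 1 - j)) [0..<m]"
  have low: "m - 1 - j \<le> a ! j" if "j < m" for j
  proof -
    have "a ! (m - 1) + (m - 1 - j) \<le> a ! j" using that by (intro gap) auto
    then show ?thesis by simp
  qed
  show thesis
  proof (rule that)
    show "length js = m" by (simp add: js_def)
    have "a ! j - (m - 1 - j) \<le> l" if j: "j < m" for j
    proof -
      have "a ! 0 \<le> l + m - 1" using a(2,3) j nth_mem[of 0 a] by fastforce
      then show ?thesis using gap[of 0 j] j by simp
    qed
    then show "set js \<subseteq> {..l}" by (auto simp: js_def)
    have "js ! j \<le> js ! i" if "i < j" "j < m" for i j
      using gap[of i j] low[of i] low[of j] that by (simp add: js_def)
    then have "sorted_wrt (\<ge>) js" by (auto simp: sorted_wrt_iff_nth_less js_def)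
    then show "sorted (rev js)" by (simp add: sorted_wrt_rev)
    show "stair js = a"
    proof (rule nth_equalityI)
      fix j assume "j < length (stair js)"
      then have j: "j < m" by (simp add: js_def)
      then have "stair js ! j = a ! j - (m - 1 - j) + (m - 1 - j)" by (simp add: stair_nth js_def)
      then show "stair js ! j = a ! j" using low[OF j] by linarith
    qed (simp add: js_def a(2))
  qed
qed

text \<open>Digits in base \<open>B\<close> are recovered by remainder and quotient. This is what
  makes the Kronecker substitution reversible.\<close>

lemma horner_sum_inj:
  fixes B :: nat
  assumes "length xs = length ys" "set xs \<subseteq> {..<B}" "set ys \<subseteq> {..<B}"
    and "horner_sum (\<lambda>n. n) B xs = horner_sum (\<lambda>n. n) B ys"
  shows "xs = ys"
  using assms
proof (induction xs ys rule: list_induct2)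
  case (Cons x xs y ys)
  then have "(x + B * horner_sum (\<lambda>n. n) B xs) mod B = (y + B * horner_sum (\<lambda>n. n) B ys) mod B"
    "(x + B * horner_sum (\<lambda>n. n) B xs) div B = (y + B * horner_sum (\<lambda>n. n) B ys) div B" by auto
  then show ?case using Cons by auto
qed simp

section \<open>The Wronskian map\<close>

text \<open>Basis-free form of the map of the theorem: multiply factor \<open>i\<close>, counted
  from 0, by \<open>X^(m-1-i) Y^i\<close>, then take the wedge product. It is explicit on all pure
  tensors, so evaluations can be computed on it directly.\<close>

definition wronskian ::
  "nat \<Rightarrow> nat \<Rightarrow> (('k::field) power_vec list \<Rightarrow>\<^sub>0 'k) set \<Rightarrow>
     ('k power_vec list \<Rightarrow>\<^sub>0 'k) set set" where
  "wronskian m l = (SOME h.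
     h \<in> linear_maps (tensor_power m (symE l)) (ext_power m (symE (l + m - 1))) \<and>
     (\<forall>xs\<in>tuples m (symE l). h (tensor (symE l) xs) =
       wedge (symE (l + m - 1)) (map (\<lambda>i. mon_mult l (m - 1 - i) i (xs ! i)) [0..<m])))"

lemma mon_mult_linear':
  "i < m \<Longrightarrow> mon_mult l (m - 1 - i) i \<in> linear_maps (symE l) (symE (l + m - 1))"
  using mon_mult_linear[of l "m - 1 - i" i] by simp

lemma
  fixes xs :: "('k::field) power_vec list"
  shows wronskian_linear: "(wronskian m l :: ('k power_vec list \<Rightarrow>\<^sub>0 'k) set \<Rightarrow> _) \<in>
      linear_maps (tensor_power m (symE l)) (ext_power m (symE (l + m - 1)))"
    and wronskian_tensor: "xs \<in> tuples m (symE l) \<Longrightarrow> wronskian m l (tensor (symE l) xs) =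
      wedge (symE (l + m - 1)) (map (\<lambda>i. mon_mult l (m - 1 - i) i (xs ! i)) [0..<m])"
proof -
  let ?\<phi> = "\<lambda>xs :: 'k power_vec list.
    wedge (symE (l + m - 1)) (map (\<lambda>i. mon_mult l (m - 1 - i) i (xs ! i)) [0..<m])"
  have ml: "multilinear m (symE l) (ext_power m (symE (l + m - 1))) ?\<phi>"
    by (rule multilinear_map[OF multilinear_wedge[OF vecspace_symE] mon_mult_linear'])
  have "\<exists>h. h \<in> linear_maps (tensor_power m (symE l)) (ext_power m (symE (l + m - 1))) \<and>
     (\<forall>xs\<in>tuples m (symE l). h (tensor (symE l) xs) = ?\<phi> xs)"
    by (rule tensor_power_induced[OF vecspace_symE vecspace_ext_power[OF vecspace_symE] ml]) blast
  from someI_ex[OF this]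
  show "(wronskian m l :: ('k power_vec list \<Rightarrow>\<^sub>0 'k) set \<Rightarrow> _) \<in>
      linear_maps (tensor_power m (symE l)) (ext_power m (symE (l + m - 1)))"
    "xs \<in> tuples m (symE l) \<Longrightarrow> wronskian m l (tensor (symE l) xs) = ?\<phi> xs"
    by (simp_all add: wronskian_def)
qed

lemma nth_le_of_set_subset: "set is \<subseteq> {..l} \<Longrightarrow> i < length is \<Longrightarrow> is ! i \<le> (l :: nat)"
  by (meson atMost_iff nth_mem subsetD)

definition monomials :: "nat \<Rightarrow> nat list \<Rightarrow> ('k::field) power_vec list" where
  "monomials d is = map (\<lambda>i. monomial i (d - i)) is"

lemma monomials_tuples: "length is = m \<Longrightarrow> set is \<subseteq> {..d} \<Longrightarrow> monomials d is \<in> tuples m (symE d)"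
  by (auto simp: monomials_def tuples_def intro!: monomial_closed)

lemma monomial_lists:
  "{xs. length xs = m \<and> set xs \<subseteq> (\<lambda>i. monomial i (d - i)) ` {..d}} =
    monomials d ` {is. length is = m \<and> set is \<subseteq> {..d}}"
proof (intro equalityI subsetI)
  fix xs assume xs: "xs \<in> {xs. length xs = m \<and> set xs \<subseteq> (\<lambda>i. monomial i (d - i)) ` {..d}}"
  then have "\<forall>t\<in>set xs. \<exists>i. i \<le> d \<and> t = monomial i (d - i)" by auto
  then obtain i where i: "\<And>t. t \<in> set xs \<Longrightarrow> i t \<le> d \<and> t = monomial (i t) (d - i t)" by metis
  then have "xs = monomials d (map i xs)"
    by (auto simp: monomials_def intro!: map_idI[symmetric])
  then show "xs \<in> monomials d ` {is. length is = m \<and> set is \<subseteq> {..d}}"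
    using xs i by (intro image_eqI[of _ _ "map i xs"]) auto
next
  fix xs assume "xs \<in> monomials d ` {is. length is = m \<and> set is \<subseteq> {..d}}"
  then show "xs \<in> {xs. length xs = m \<and> set xs \<subseteq> (\<lambda>i. monomial i (d - i)) ` {..d}}"
    by (force simp: monomials_def)
qed

lemma spans_tensor_monomials:
  "spans (tensor_power m (symE d))
    ((\<lambda>is. tensor (symE d) (monomials d is)) ` {is. length is = m \<and> set is \<subseteq> {..d}})"
  using spans_tensor_power_gens[OF vecspace_symE spans_symE, of m d]
  unfolding monomial_lists image_image .

lemma spans_wedge_monomials:
  "spans (ext_power m (symE d))
    ((\<lambda>is. wedge (symE d) (monomials d is)) ` {is. length is = m \<and> set is \<subseteq> {..d}})"
  using spans_ext_power_gens[OF vecspace_symE spans_symE, of m d]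
  unfolding monomial_lists image_image .

lemma wronskian_monomials:
  assumes "length is = m" "set is \<subseteq> {..l}"
  shows "wronskian m l (tensor (symE l) (monomials l is)) =
    wedge (symE (l + m - 1)) (monomials (l + m - 1) (stair is))"
proof -
  have "map (\<lambda>i. mon_mult l (m - 1 - i) i (monomials l is ! i)) [0..<m] =
      (monomials (l + m - 1) (stair is) :: 'a power_vec list)"
  proof (rule nth_equalityI)
    fix i assume "i < length (map (\<lambda>i. mon_mult l (m - 1 - i) i (monomials l is ! i)) [0..<m])"
    then have i: "i < m" by simp
    then have le: "is ! i \<le> l" using assms by (simp add: nth_le_of_set_subset)
    then have "mon_mult l (m - 1 - i) i (monomial (is ! i) (l - is ! i)) =
        monomial (is ! i + (m - 1 - i)) (l - is ! i + i)"
      by (intro mon_mult_monomial) simp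
    moreover have "l - is ! i + i = l + m - 1 - (is ! i + (m - 1 - i))" using le i by simp
    ultimately show "map (\<lambda>i. mon_mult l (m - 1 - i) i (monomials l is ! i)) [0..<m] ! i =
        monomials (l + m - 1) (stair is) ! i"
      using i assms by (simp add: monomials_def stair_nth)
  qed (simp add: monomials_def assms)
  then show ?thesis by (simp add: wronskian_tensor[OF monomials_tuples[OF assms]])
qed

text \<open>Pure translation: index functions on \<open>1, ..., m\<close> become lists indexed from
  0, and the exponents of \<open>Y\<close> are recovered from the total degree.\<close>

lemma wronskian_map_iff:
  "wronskian_map m l f \<longleftrightarrow>
    f \<in> linear_maps (tensor_power m (symE l)) (ext_power m (symE (l + m - 1))) \<and>
    (\<forall>is. length is = m \<and> set is \<subseteq> {..l} \<longrightarrow> f (tensor (symE l) (monomials l is)) =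
      wedge (symE (l + m - 1)) (monomials (l + m - 1) (stair is)))"
proof -
  have upt: "[1..<Suc m] = map Suc [0..<m]" by (simp add: map_Suc_upt)
  have 1: "map (\<lambda>j. monomial (i j) (l - i j)) [1..<Suc m] = monomials l (map (i \<circ> Suc) [0..<m])"
    for i :: "nat \<Rightarrow> nat"
    unfolding upt by (simp add: monomials_def)
  have 2: "map (\<lambda>j. monomial (i j + m - j) (l - i j + j - 1)) [1..<Suc m] =
      monomials (l + m - 1) (stair (map (i \<circ> Suc) [0..<m]))"
    if le: "\<forall>j\<in>{1..m}. i j \<le> l" for i :: "nat \<Rightarrow> nat"
    unfolding upt
  proof (rule nth_equalityI)
    fix k assume "k < length (map (\<lambda>j. monomial (i j + m - j) (l - i j + j - 1)) (map Suc [0..<m]))"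
    then have k: "k < m" by simp
    then have "i (Suc k) \<le> l" using le by auto
    \<comment> \<open>The bound by \<open>l\<close> keeps the subtraction in
      \<open>l - i (Suc k)\<close> exact, so that the two expressions for the exponent of
      \<open>Y\<close> agree.\<close>
    then have "i (Suc k) + m - Suc k = i (Suc k) + (m - 1 - k)"
      "l - i (Suc k) + Suc k - 1 = l + m - 1 - (i (Suc k) + (m - 1 - k))" using k by auto
    then show "map (\<lambda>j. monomial (i j + m - j) (l - i j + j - 1)) (map Suc [0..<m]) ! k =
        monomials (l + m - 1) (stair (map (i \<circ> Suc) [0..<m])) ! k"
      using k by (simp add: monomials_def stair_nth)
  qed (simp add: monomials_def)
  \<comment> \<open>Only the values at \<open>1, ..., m\<close> enter, so quantifying over index
    functions and over lists of length \<open>m\<close> amounts to the same.\<close>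
  have "(\<forall>i. (\<forall>j\<in>{1..m}. i j \<le> l) \<longrightarrow> P (map (i \<circ> Suc) [0..<m])) \<longleftrightarrow>
      (\<forall>is. length is = m \<and> set is \<subseteq> {..l} \<longrightarrow> P is)" for P
  proof (intro iffI allI impI)
    fix "is" assume P: "\<forall>i. (\<forall>j\<in>{1..m}. i j \<le> l) \<longrightarrow> P (map (i \<circ> Suc) [0..<m])"
      and "is": "length is = m \<and> set is \<subseteq> {..l}"
    have "\<forall>j\<in>{1..m}. is ! (j - 1) \<le> l"
      using "is" by (auto intro!: nth_le_of_set_subset)
    then have "P (map ((\<lambda>j. is ! (j - 1)) \<circ> Suc) [0..<m])" using P[THEN spec, of "\<lambda>j. is ! (j - 1)"] by (rule mp[rotated])
    moreover have "map ((\<lambda>j. is ! (j - 1)) \<circ> Suc) [0..<m] = is"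
      using "is" by (intro nth_equalityI) auto
    ultimately show "P is" by simp
  next
    fix i :: "nat \<Rightarrow> nat"
    assume P: "\<forall>is. length is = m \<and> set is \<subseteq> {..l} \<longrightarrow> P is" and le: "\<forall>j\<in>{1..m}. i j \<le> l"
    have "length (map (i \<circ> Suc) [0..<m]) = m \<and> set (map (i \<circ> Suc) [0..<m]) \<subseteq> {..l}"
      using le by auto
    then show "P (map (i \<circ> Suc) [0..<m])" using P[THEN spec, of "map (i \<circ> Suc) [0..<m]"] by (rule mp[rotated])
  qed
  from this[of "\<lambda>is. f (tensor (symE l) (monomials l is)) =
      wedge (symE (l + m - 1)) (monomials (l + m - 1) (stair is))"]
  show ?thesis by (simp only: wronskian_map_def 1 2 cong: imp_cong)
qed

lemma wronskian_map_wronskian: "wronskian_map m l (wronskian m l)"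
  unfolding wronskian_map_iff
  by (intro conjI allI impI wronskian_linear wronskian_monomials) auto

lemma wronskian_map_unique:
  assumes "wronskian_map m l f" "t \<in> carrier (tensor_power m (symE l))"
  shows "f t = wronskian m l t"
proof (rule spans_eqI[OF spans_tensor_monomials vecspace_tensor_power[OF vecspace_symE]
      vecspace_ext_power[OF vecspace_symE] _ wronskian_linear _ assms(2)])
  show "f \<in> linear_maps (tensor_power m (symE l)) (ext_power m (symE (l + m - 1)))"
    using assms(1) by (simp add: wronskian_map_def)
qed (use assms(1) in \<open>auto simp: wronskian_map_iff wronskian_monomials\<close>)

subsection \<open>Comparison with the Vandermonde determinant\<close>

text \<open>The functional \<open>\<theta>\<close> of the overview; \<open>ext_point\<close> is
  \<open>\<Psi>\<close>.\<close>

definition tensor_point ::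
  "('k::field \<Rightarrow> 'a::comm_ring_1) \<Rightarrow> nat \<Rightarrow> nat \<Rightarrow> (nat \<Rightarrow> 'a) \<Rightarrow> (nat \<Rightarrow> 'a) \<Rightarrow>
     ('k power_vec list \<Rightarrow>\<^sub>0 'k) set \<Rightarrow> 'a" where
  "tensor_point \<iota> m d x y = tensor_eval \<iota> m (symE d) (\<lambda>j. sym_eval \<iota> d (x j) (y j))"

definition ext_point ::
  "('k::field \<Rightarrow> 'a::comm_ring_1) \<Rightarrow> nat \<Rightarrow> nat \<Rightarrow> (nat \<Rightarrow> 'a) \<Rightarrow> (nat \<Rightarrow> 'a) \<Rightarrow>
     ('k power_vec list \<Rightarrow>\<^sub>0 'k) set set \<Rightarrow> 'a" where
  "ext_point \<iota> m d x y = ext_eval \<iota> m (symE d) (\<lambda>j. sym_eval \<iota> d (x j) (y j))"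

context
  fixes \<iota> :: "'k::field \<Rightarrow> 'a::comm_ring_1"
  assumes \<iota>: "Ring_Hom.comm_ring_hom \<iota>"
begin

lemma tensor_point_linear: "tensor_point \<iota> m d x y \<in> linear_maps (tensor_power m (symE d)) (ring_rep \<iota>)"
  unfolding tensor_point_def by (rule tensor_eval_linear[OF \<iota> vecspace_symE sym_eval_linear[OF \<iota>]])

lemma tensor_point_tensor:
  "xs \<in> tuples m (symE d) \<Longrightarrow>
    tensor_point \<iota> m d x y (tensor (symE d) xs) = (\<Prod>i<m. sym_eval \<iota> d (x i) (y i) (xs ! i))"
  unfolding tensor_point_def by (rule tensor_eval_tensor[OF \<iota> vecspace_symE sym_eval_linear[OF \<iota>]])

lemma ext_point_linear: "ext_point \<iota> m d x y \<in> linear_maps (ext_power m (symE d)) (ring_rep \<iota>)"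
  unfolding ext_point_def by (rule ext_eval_linear[OF \<iota> vecspace_symE sym_eval_linear[OF \<iota>]])

lemma ext_point_wedge:
  "xs \<in> tuples m (symE d) \<Longrightarrow> ext_point \<iota> m d x y (wedge (symE d) xs) =
    det (mat m m (\<lambda>(j, i). sym_eval \<iota> d (x j) (y j) (xs ! i)))"
  unfolding ext_point_def by (rule ext_eval_wedge[OF \<iota> vecspace_symE sym_eval_linear[OF \<iota>]])

lemma tensor_point_act:
  assumes g: "g \<in> carrier GL2" and t: "t \<in> carrier (tensor_power m (symE d))"
  shows "tensor_point \<iota> m d x y (act (tensor_power m (symE d)) g t) =
    tensor_point \<iota> m d (\<lambda>j. \<iota> (vec_nth (vec_nth g 1) 1) * x j + \<iota> (vec_nth (vec_nth g 2) 1) * y j)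
      (\<lambda>j. \<iota> (vec_nth (vec_nth g 1) 2) * x j + \<iota> (vec_nth (vec_nth g 2) 2) * y j) t"
    (is "_ = tensor_point \<iota> m d ?x ?y t")
proof -
  note rep = representation_sym_upper[OF representation_natE]
  note act = act_tensor_power[OF vecspace_symE act_linear_map[OF rep g]]
  show ?thesis
  proof (rule spans_eqI[OF spans_tensor_power[OF vecspace_symE] vecspace_tensor_power[OF vecspace_symE]
        vecspace_ring_rep[OF \<iota>] linear_maps_comp[OF act(1) tensor_point_linear] tensor_point_linear _ t])
    fix s assume "s \<in> tensor (symE d) ` tuples m (symE d :: ('k, _, _) rep)"
    then obtain xs where s: "s = tensor (symE d) xs" and xs: "xs \<in> tuples m (symE d)" by auto
    have "sym_eval \<iota> d (x i) (y i) (act (symE d) g (xs ! i)) = sym_eval \<iota> d (?x i) (?y i) (xs ! i)"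
      if "i < m" for i
      by (rule sym_eval_act[OF \<iota> g tuplesD(2)[OF xs that]])
    then show "tensor_point \<iota> m d x y (act (tensor_power m (symE d)) g s) = tensor_point \<iota> m d ?x ?y s"
      using tuplesD(1)[OF xs] unfolding s act(2)[OF xs] tensor_point_tensor[OF xs]
        tensor_point_tensor[OF tuples_map_act[OF rep g xs]] by simp
  qed
qed

lemma ext_point_act:
  assumes g: "g \<in> carrier GL2" and t: "t \<in> carrier (ext_power m (symE d))"
  shows "ext_point \<iota> m d x y (act (ext_power m (symE d)) g t) =
    ext_point \<iota> m d (\<lambda>j. \<iota> (vec_nth (vec_nth g 1) 1) * x j + \<iota> (vec_nth (vec_nth g 2) 1) * y j)
      (\<lambda>j. \<iota> (vec_nth (vec_nth g 1) 2) * x j + \<iota> (vec_nth (vec_nth g 2) 2) * y j) t"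
    (is "_ = ext_point \<iota> m d ?x ?y t")
proof -
  note rep = representation_sym_upper[OF representation_natE]
  note act = act_linear_map[OF representation_ext_power[OF rep] g]
  show ?thesis
  proof (rule spans_eqI[OF spans_ext_power[OF vecspace_symE] vecspace_ext_power[OF vecspace_symE]
        vecspace_ring_rep[OF \<iota>] linear_maps_comp[OF act ext_point_linear] ext_point_linear _ t])
    fix s assume "s \<in> wedge (symE d) ` tuples m (symE d :: ('k, _, _) rep)"
    then obtain xs where s: "s = wedge (symE d) xs" and xs: "xs \<in> tuples m (symE d)" by auto
    have eq: "sym_eval \<iota> d (x j) (y j) (act (symE d) g (xs ! i)) = sym_eval \<iota> d (?x j) (?y j) (xs ! i)"
      if "i < m" for i j
      by (rule sym_eval_act[OF \<iota> g tuplesD(2)[OF xs that]])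
    have "mat m m (\<lambda>(j, i). sym_eval \<iota> d (x j) (y j) (map (act (symE d) g) xs ! i)) =
        mat m m (\<lambda>(j, i). sym_eval \<iota> d (?x j) (?y j) (xs ! i))"
      by (rule eq_matI) (simp_all add: tuplesD(1)[OF xs] eq)
    then show "ext_point \<iota> m d x y (act (ext_power m (symE d)) g s) = ext_point \<iota> m d ?x ?y s"
      unfolding s act_wedge[OF rep g xs] ext_point_wedge[OF xs]
        ext_point_wedge[OF tuples_map_act[OF rep g xs]] by simp
  qed
qed

text \<open>Leibniz expansion, valid for an arbitrary tensor. In the term of \<open>p\<close>, row
  \<open>j\<close> meets factor \<open>p j\<close>: its monomial multiplier splits off, and the
  remaining evaluations are those of the tensor permuted by \<open>p\<close>.\<close>

lemma ext_point_wronskian_sum: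
  assumes t: "t \<in> carrier (tensor_power m (symE l))"
  shows "ext_point \<iota> m (l + m - 1) x y (wronskian m l t) =
    (\<Sum>p\<in>{p. p permutes {..<m}}. signof p * (\<Prod>j<m. x j ^ (m - 1 - p j) * y j ^ p j) *
      tensor_point \<iota> m l x y (place_perm m (symE l) p t))"
    (is "_ = ?R t")
proof (rule spans_eqI[OF spans_tensor_power[OF vecspace_symE] vecspace_tensor_power[OF vecspace_symE]
      vecspace_ring_rep[OF \<iota>] linear_maps_comp[OF wronskian_linear ext_point_linear] _ _ t])
  let ?T = "tensor_power m (symE l) :: ('k, _, _) rep"
  have lin: "(\<lambda>t. tensor_point \<iota> m l x y (place_perm m (symE l) p t)) \<in> linear_maps ?T (ring_rep \<iota>)"
    if "p permutes {..<m}" for p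
    by (rule linear_maps_comp[OF place_perm_tensor(1)[OF vecspace_symE that] tensor_point_linear])
  show "?R \<in> linear_maps ?T (ring_rep \<iota>)"
  proof (rule linear_mapsI)
    fix v w c assume v: "v \<in> carrier ?T"
    show "?R (c \<odot>\<^bsub>?T\<^esub> v) = c \<odot>\<^bsub>ring_rep \<iota>\<^esub> ?R v"
      using linear_maps_smult[OF lin v, where c = c] unfolding ring_rep_simps sum_distrib_left
      by (intro sum.cong refl) (simp only: mem_Collect_eq mult.left_commute)
    assume w: "w \<in> carrier ?T"
    show "?R (v \<oplus>\<^bsub>?T\<^esub> w) = ?R v \<oplus>\<^bsub>ring_rep \<iota>\<^esub> ?R w"
      using linear_maps_add[OF lin v w] unfolding ring_rep_simps sum.distrib[symmetric]
      by (intro sum.cong refl) (simp only: mem_Collect_eq distrib_left)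
  qed simp
  fix s assume "s \<in> tensor (symE l) ` tuples m (symE l :: ('k, _, _) rep)"
  then obtain xs where s: "s = tensor (symE l) xs" and xs: "xs \<in> tuples m (symE l)" by auto
  let ?ys = "map (\<lambda>i. mon_mult l (m - 1 - i) i (xs ! i)) [0..<m]"
  have ys: "?ys \<in> tuples m (symE (l + m - 1))"
    using linear_maps_closed[OF mon_mult_linear' tuplesD(2)[OF xs]] by (simp add: tuples_iff_nth)
  have eval: "sym_eval \<iota> (l + m - 1) (x j) (y j) (?ys ! i) =
      sym_eval \<iota> l (x j) (y j) (xs ! i) * (x j ^ (m - 1 - i) * y j ^ i)" if "i < m" for i j
    using sym_eval_mon_mult[OF \<iota> tuplesD(2)[OF xs that], of "m - 1 - i" i "x j" "y j"] that by simp
  have "ext_point \<iota> m (l + m - 1) x y (wronskian m l s) =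
      (\<Sum>p\<in>{p. p permutes {..<m}}. signof p * (\<Prod>j<m.
        mat m m (\<lambda>(j, i). sym_eval \<iota> (l + m - 1) (x j) (y j) (?ys ! i)) $$ (j, p j)))"
    unfolding s wronskian_tensor[OF xs] ext_point_wedge[OF ys]
    by (subst det_def'[of _ m]) (simp_all add: atLeast0LessThan)
  also have "\<dots> = ?R s"
  proof (rule sum.cong[OF refl])
    fix p assume "p \<in> {p. p permutes {..<m}}"
    then have p: "p permutes {..<m}" by simp
    have pj: "p j < m" if "j < m" for j using permutes_in_image[OF p, of j] that by simp
    have "(\<Prod>j<m. mat m m (\<lambda>(j, i). sym_eval \<iota> (l + m - 1) (x j) (y j) (?ys ! i)) $$ (j, p j)) =
        (\<Prod>j<m. sym_eval \<iota> l (x j) (y j) (xs ! p j) * (x j ^ (m - 1 - p j) * y j ^ p j))"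
    proof (rule prod.cong[OF refl])
      fix j assume "j \<in> {..<m}"
      then show "mat m m (\<lambda>(j, i). sym_eval \<iota> (l + m - 1) (x j) (y j) (?ys ! i)) $$ (j, p j) =
          sym_eval \<iota> l (x j) (y j) (xs ! p j) * (x j ^ (m - 1 - p j) * y j ^ p j)"
        using eval[OF pj, of j j] pj[of j] by simp
    qed
    also have "\<dots> = (\<Prod>j<m. x j ^ (m - 1 - p j) * y j ^ p j) *
        (\<Prod>j<m. sym_eval \<iota> l (x j) (y j) (permute_list p xs ! j))"
      using tuplesD(1)[OF xs] p by (simp add: prod.distrib permute_list_nth mult.commute)
    also have "(\<Prod>j<m. sym_eval \<iota> l (x j) (y j) (permute_list p xs ! j)) =
        tensor_point \<iota> m l x y (place_perm m (symE l) p s)"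
      unfolding s place_perm_tensor(2)[OF vecspace_symE p xs]
      by (rule tensor_point_tensor[OF tuples_permute_list[OF xs p], symmetric])
    finally show "signof p * (\<Prod>j<m.
        mat m m (\<lambda>(j, i). sym_eval \<iota> (l + m - 1) (x j) (y j) (?ys ! i)) $$ (j, p j)) =
        signof p * (\<Prod>j<m. x j ^ (m - 1 - p j) * y j ^ p j) *
        tensor_point \<iota> m l x y (place_perm m (symE l) p s)"
      by (simp add: mult.assoc)
  qed
  finally show "ext_point \<iota> m (l + m - 1) x y (wronskian m l s) = ?R s" .
qed

text \<open>A symmetric tensor is fixed by every place permutation, so its value is a common factor;
  the signed multipliers left over are the Leibniz expansion of
  \<open>hom_vandermonde\<close>.\<close>

lemma ext_point_wronskian:
  assumes t: "t \<in> carrier (sym_lower m (symE l))"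
  shows "ext_point \<iota> m (l + m - 1) x y (wronskian m l t) =
    hom_vandermonde m x y * tensor_point \<iota> m l x y t"
proof -
  have "hom_vandermonde m x y = (\<Sum>p\<in>{p. p permutes {..<m}}. signof p *
      (\<Prod>j<m. mat m m (\<lambda>(j, i). x j ^ (m - 1 - i) * y j ^ i) $$ (j, p j)))"
    unfolding hom_vandermonde_def by (subst det_def'[of _ m]) (simp_all add: atLeast0LessThan)
  also have "\<dots> = (\<Sum>p\<in>{p. p permutes {..<m}}. signof p * (\<Prod>j<m. x j ^ (m - 1 - p j) * y j ^ p j))"
  proof (intro sum.cong[OF refl] arg_cong2[where f = "(*)"] prod.cong refl)
    fix p j assume "p \<in> {p. p permutes {..<m}}" "j \<in> {..<m}"
    then show "mat m m (\<lambda>(j, i). x j ^ (m - 1 - i) * y j ^ i) $$ (j, p j) = x j ^ (m - 1 - p j) * y j ^ p j"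
      using permutes_in_image[of p "{..<m}" j] by simp
  qed
  finally have V: "hom_vandermonde m x y =
      (\<Sum>p\<in>{p. p permutes {..<m}}. signof p * (\<Prod>j<m. x j ^ (m - 1 - p j) * y j ^ p j))" .
  show ?thesis
    unfolding V sum_distrib_right ext_point_wronskian_sum[OF subsetD[OF sym_lower_subset t]]
    using t by (intro sum.cong[OF refl]) (simp add: carrier_sym_lower)
qed

end

subsection \<open>Injectivity\<close>

lemma ring_rep_minus_self: "Ring_Hom.comm_ring_hom \<iota> \<Longrightarrow> a \<ominus>\<^bsub>ring_rep \<iota>\<^esub> a = 0"
  using minus_eq_zero_iff[OF vecspace_ring_rep, of \<iota> a a] by simp

abbreviation const_poly :: "'k::field \<Rightarrow> 'k poly" where
  "const_poly c \<equiv> [:c:]"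

lemma comm_ring_hom_const_poly: "Ring_Hom.comm_ring_hom (const_poly :: 'k::field \<Rightarrow> 'k poly)"
  by unfold_locales (auto simp: one_pCons)

text \<open>Kronecker substitution: at the points \<open>(T\<^bsup>B\<^sup>j\<^esup>, 1)\<close> with \<open>B\<close> larger than all exponents, distinct
  monomials in \<open>m\<close> pairs of variables take distinct powers of \<open>T\<close> as values.\<close>

definition generic :: "nat \<Rightarrow> nat \<Rightarrow> 'k::field poly" where
  "generic l j = monom 1 ((l + 2) ^ j)"

text \<open>The value \<open>(T^(B^j))^i\<close> has exponent \<open>i * B^j\<close>, so the
  exponents of the factors become the base \<open>l + 2\<close> digits of a single exponent.\<close>

lemma tensor_point_generic_monomials:
  assumes "length is = m" "set is \<subseteq> {..l}"
  shows "tensor_point const_poly m l (generic l) (\<lambda>_. 1) (tensor (symE l) (monomials l is)) =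
    monom (1 :: 'k::field) (horner_sum (\<lambda>n. n) (l + 2) is)"
proof -
  have "tensor_point const_poly m l (generic l) (\<lambda>_. 1) (tensor (symE l) (monomials l is)) =
      (\<Prod>i<m. sym_eval const_poly l (generic l i) 1 (monomials l is ! i :: 'k power_vec))"
    by (rule tensor_point_tensor[OF comm_ring_hom_const_poly monomials_tuples[OF assms]])
  also have "\<dots> = (\<Prod>i<m. monom 1 ((l + 2) ^ i * is ! i))"
  proof (rule prod.cong[OF refl])
    fix i assume "i \<in> {..<m}"
    then have "is ! i \<le> l" "i < length is" using assms by (auto intro: nth_le_of_set_subset)
    then show "sym_eval const_poly l (generic l i) 1 (monomials l is ! i) =
        monom (1 :: 'k) ((l + 2) ^ i * is ! i)"
      by (simp add: monomials_def sym_eval_monomial[OF comm_ring_hom_const_poly] generic_def monom_power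
          mult.commute)
  qed
  also have "\<dots> = monom 1 (\<Sum>i<m. (l + 2) ^ i * is ! i)"
    by (induction m) (simp_all add: mult_monom one_pCons monom_0)
  also have "(\<Sum>i<m. (l + 2) ^ i * is ! i) = horner_sum (\<lambda>n. n) (l + 2) is"
    using assms(1) by (simp add: horner_sum_eq_sum mult.commute atLeast0LessThan)
  finally show ?thesis .
qed

text \<open>There is a linear left inverse on tensors: different exponent lists give different
  powers of the indeterminate, so coefficients can be read off. Independence of the monomial tensors
  is a consequence, not an ingredient.\<close>

lemma tensor_point_generic_inj:
  assumes t: "t \<in> carrier (tensor_power m (symE l))"
    and zero: "tensor_point const_poly m l (generic l) (\<lambda>_. 1) t = 0"
  shows "t = \<zero>\<^bsub>tensor_power m (symE l)\<^esub>"
proof -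
  let ?T = "tensor_power m (symE l) :: ('a, _, _) rep"
  let ?R = "ring_rep const_poly :: ('a, _, 'a^2^2) rep"
  note T = vecspace_tensor_power[OF vecspace_symE] and R = vecspace_ring_rep[OF comm_ring_hom_const_poly]
  interpret T: Module.module scalars ?T by (rule T)
  define I where "I = {is. length is = m \<and> set is \<subseteq> {..l}}"
  define code where "code = horner_sum (\<lambda>n. n) (l + 2)"
  define b where "b is = tensor (symE l) (monomials l is :: 'a power_vec list)" for "is"
  \<comment> \<open>Reads the coefficient at the code of each exponent list and puts it on the
    matching monomial tensor.\<close>
  define \<rho> where "\<rho> q = (\<Oplus>\<^bsub>?T\<^esub>is\<in>I. poly.coeff q (code is) \<odot>\<^bsub>?T\<^esub> b is)" for q
  have fin: "finite I"
    using finite_lists_length_eq[of "{..l}" m] by (simp add: I_def conj_commute)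
  have b: "b is \<in> carrier ?T" if "is \<in> I" for "is"
    using that unfolding b_def I_def by (intro tensor_closed[OF vecspace_symE] monomials_tuples) auto
  have inj: "is = js" if "is \<in> I" "js \<in> I" "code is = code js" for "is" js
    using that unfolding code_def I_def by (intro horner_sum_inj[of "is" js "l + 2"]) auto
  have "(\<lambda>q. poly.coeff q (code is) \<odot>\<^bsub>?T\<^esub> b is) \<in> linear_maps ?R ?T" if "is \<in> I" for "is"
    by (rule linear_mapsI) (simp_all add: vecspace_simps[OF T b[OF that]])
  then have \<rho>: "\<rho> \<in> linear_maps ?R ?T"
    unfolding \<rho>_def by (rule linear_maps_finsum[OF R T fin])
  have \<rho>_monom: "\<rho> (monom 1 (code is)) = b is" if "is": "is \<in> I" for "is"
  proof -
    have "\<rho> (monom 1 (code is)) = (\<Oplus>\<^bsub>?T\<^esub>js\<in>I. if is = js then b js else \<zero>\<^bsub>?T\<^esub>)"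
      unfolding \<rho>_def
    proof (rule T.finsum_cong')
      fix js assume js: "js \<in> I"
      show "poly.coeff (monom 1 (code is)) (code js) \<odot>\<^bsub>?T\<^esub> b js = (if is = js then b js else \<zero>\<^bsub>?T\<^esub>)"
        using inj[OF "is" js] by (auto simp: vecspace_simps[OF T b[OF js]])
    qed (auto simp: b)
    also have "\<dots> = b is"
      using b by (intro T.add.finprod_singleton[OF "is" fin]) auto
    finally show ?thesis .
  qed
  have "\<rho> (tensor_point const_poly m l (generic l) (\<lambda>_. 1) t) = t"
  proof (rule spans_eqI[OF spans_tensor_monomials T T
        linear_maps_comp[OF tensor_point_linear[OF comm_ring_hom_const_poly] \<rho>] linear_maps_id _ t])
    fix s :: "('a power_vec list \<Rightarrow>\<^sub>0 'a) set"
    assume "s \<in> (\<lambda>is. tensor (symE l) (monomials l is)) ` {is. length is = m \<and> set is \<subseteq> {..l}}"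
    then obtain "is" where s: "s = b is" "is \<in> I" by (auto simp: I_def b_def)
    have "tensor_point const_poly m l (generic l) (\<lambda>_. 1) (b is) = monom 1 (code is)"
      using s(2) unfolding b_def code_def I_def by (intro tensor_point_generic_monomials) auto
    then show "\<rho> (tensor_point const_poly m l (generic l) (\<lambda>_. 1) s) = s"
      using \<rho>_monom[OF s(2)] by (simp add: s(1))
  qed
  then show ?thesis using zero linear_maps_zero[OF R T \<rho>] by simp
qed

text \<open>The base \<open>l + 2\<close> is at least 2 even when \<open>l = 0\<close>, so the
  exponents \<open>(l + 2) ^ j\<close> are pairwise distinct and every factor of the product formula
  is nonzero.\<close>

lemma hom_vandermonde_generic: "hom_vandermonde m (generic l :: nat \<Rightarrow> 'k::field poly) (\<lambda>_. 1) \<noteq> 0"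
proof -
  have "generic l j \<noteq> (generic l k :: 'k poly)" if "j < k" for j k
  proof
    assume "generic l j = (generic l k :: 'k poly)"
    then have "(l + 2) ^ j = (l + 2) ^ k"
      unfolding generic_def by (metis degree_monom_eq one_neq_zero)
    then show False using that power_inject_exp[of "l + 2" j k] by simp
  qed
  then show ?thesis by (simp add: hom_vandermonde_prod)
qed

lemma wronskian_inj:
  assumes t: "t \<in> carrier (sym_lower m (symE l))"
    and zero: "wronskian m l t = \<zero>\<^bsub>ext_power m (symE (l + m - 1))\<^esub>"
  shows "t = \<zero>\<^bsub>tensor_power m (symE l)\<^esub>"
proof (rule tensor_point_generic_inj)
  note \<iota> = comm_ring_hom_const_poly
  show "t \<in> carrier (tensor_power m (symE l))" using sym_lower_subset t by blast
  have "hom_vandermonde m (generic l) (\<lambda>_. 1) * tensor_point const_poly m l (generic l) (\<lambda>_. 1) t = 0"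
    unfolding ext_point_wronskian[OF \<iota> t, symmetric] zero
    using linear_maps_zero[OF vecspace_ext_power[OF vecspace_symE] vecspace_ring_rep[OF \<iota>] ext_point_linear[OF \<iota>]]
    by simp
  then show "tensor_point const_poly m l (generic l) (\<lambda>_. 1) t = 0"
    by (simp add: hom_vandermonde_generic)
qed

subsection \<open>Surjectivity\<close>

lemma permute_list_inj:
  assumes "\<sigma> permutes {..<length xs}" "length xs = length ys" "permute_list \<sigma> xs = permute_list \<sigma> ys"
  shows "xs = ys"
proof (rule nth_equalityI[OF assms(2)])
  fix i assume i: "i < length xs"
  then obtain k where k: "k < length xs" "\<sigma> k = i"
    using permutes_image[OF assms(1)] by (metis imageE lessThan_iff)
  then show "xs ! i = ys ! i"
    using assms permute_list_nth[of \<sigma> xs k] permute_list_nth[of \<sigma> ys k] by simp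
qed

text \<open>A place permutation permutes the rearrangements among themselves. Summing over distinct
  rearrangements, not over all permutations, keeps every coefficient equal to 1 when exponents
  repeat, whatever the characteristic.\<close>

lemma orbit_sum_invariant:
  assumes "length is = m" "set is \<subseteq> {..l}"
  shows "(\<Oplus>\<^bsub>tensor_power m (symE l)\<^esub>js\<in>permutations_of_multiset (mset is).
      tensor (symE l) (monomials l js :: ('k::field) power_vec list))
    \<in> carrier (sym_lower m (symE l))"
proof -
  let ?T = "tensor_power m (symE l) :: ('k, _, _) rep"
  let ?b = "\<lambda>js. tensor (symE l) (monomials l js :: 'k power_vec list)"
  define P where "P = permutations_of_multiset (mset is)"
  note T = vecspace_tensor_power[OF vecspace_symE]
  interpret T: Module.module scalars ?T by (rule T)
  have fin: "finite P" by (simp add: P_def)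
  have P: "js \<in> P \<longleftrightarrow> mset js = mset is" for js by (simp add: P_def permutations_of_multiset_def)
  have mono: "monomials l js \<in> tuples m (symE l)" if "js \<in> P" for js
    using mset_eq_length[of js "is"] mset_eq_setD[of js "is"] that assms
    by (intro monomials_tuples) (simp_all add: P)
  have b: "?b js \<in> carrier ?T" if "js \<in> P" for js
    by (rule tensor_closed[OF vecspace_symE mono[OF that]])
  have "place_perm m (symE l) \<sigma> (\<Oplus>\<^bsub>?T\<^esub>js\<in>P. ?b js) = (\<Oplus>\<^bsub>?T\<^esub>js\<in>P. ?b js)"
    if \<sigma>: "\<sigma> permutes {..<m}" for \<sigma>
  proof -
    have len: "length js = m" if "js \<in> P" for js
      using mset_eq_length[of js "is"] that assms(1) by (simp add: P)
    have inj: "inj_on (permute_list \<sigma>) P"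
    proof (rule inj_onI)
      fix js ks assume "js \<in> P" "ks \<in> P" "permute_list \<sigma> js = permute_list \<sigma> ks"
      then show "js = ks" using permute_list_inj[of \<sigma> js ks] \<sigma> len by simp
    qed
    have "permute_list \<sigma> ` P \<subseteq> P" using \<sigma> len by (auto simp: P)
    then have img: "permute_list \<sigma> ` P = P" by (rule endo_inj_surj[OF fin _ inj])
    have "place_perm m (symE l) \<sigma> (\<Oplus>\<^bsub>?T\<^esub>js\<in>P. ?b js) = (\<Oplus>\<^bsub>?T\<^esub>js\<in>P. place_perm m (symE l) \<sigma> (?b js))"
      using b by (intro linear_maps_finsum_apply[OF T T place_perm_tensor(1)[OF vecspace_symE \<sigma>] fin]) auto
    also have "\<dots> = (\<Oplus>\<^bsub>?T\<^esub>js\<in>P. ?b (permute_list \<sigma> js))"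
    proof (rule T.finsum_cong'[OF refl])
      show "(\<lambda>js. ?b (permute_list \<sigma> js)) \<in> P \<rightarrow> carrier ?T" using b img by auto
      fix js assume js: "js \<in> P"
      have "permute_list \<sigma> (monomials l js) =
          (monomials l (permute_list \<sigma> js) :: 'k power_vec list)"
        unfolding monomials_def using \<sigma> len[OF js] by (intro permute_list_map) simp
      then show "place_perm m (symE l) \<sigma> (?b js) = ?b (permute_list \<sigma> js)"
        by (simp add: place_perm_tensor(2)[OF vecspace_symE \<sigma> mono[OF js]])
    qed
    also have "\<dots> = (\<Oplus>\<^bsub>?T\<^esub>js\<in>permute_list \<sigma> ` P. ?b js)"
      using b img by (intro T.add.finprod_reindex[symmetric] inj) auto
    finally show ?thesis by (simp add: img)
  qed
  moreover have "(\<Oplus>\<^bsub>?T\<^esub>js\<in>P. ?b js) \<in> carrier ?T" using b by (intro T.finsum_closed) auto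
  ultimately show ?thesis by (simp add: carrier_sym_lower P_def)
qed

lemma submodule_wronskian_image:
  "submodule (wronskian m l ` carrier (sym_lower m (symE l))) scalars (ext_power m (symE (l + m - 1)))"
  by (rule submodule_image[OF vecspace_sym_lower[OF vecspace_symE] vecspace_ext_power[OF vecspace_symE]
        linear_maps_sym_lower[OF wronskian_linear] submodule_carrier[OF vecspace_sym_lower[OF vecspace_symE]]])

text \<open>The orbit sum of a weakly decreasing \<open>is\<close> is mapped to the wedge product with exponents
  \<open>stair is\<close> plus wedge products whose exponents have a smaller sum of squares.\<close>

lemma wedge_monomials_in_image:
  assumes "length b = m" "set b \<subseteq> {..l + m - 1}"
  shows "wedge (symE (l + m - 1)) (monomials (l + m - 1) b :: ('k::field) power_vec list)
    \<in> wronskian m l ` carrier (sym_lower m (symE l))"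
  using assms
proof (induction "square_sum b" arbitrary: b rule: less_induct)
  case less
  let ?n = "l + m - 1"
  let ?X = "ext_power m (symE ?n) :: ('k, _, _) rep"
  let ?T = "tensor_power m (symE l) :: ('k, _, _) rep"
  let ?w = "\<lambda>b. wedge (symE ?n) (monomials ?n b :: 'k power_vec list)"
  let ?t = "\<lambda>js. tensor (symE l) (monomials l js :: 'k power_vec list)"
  let ?H = "wronskian m l ` carrier (sym_lower m (symE l)) :: (('k power_vec list \<Rightarrow>\<^sub>0 'k) set set) set"
  note X = vecspace_ext_power[OF vecspace_symE]
  interpret X: Module.module scalars ?X by (rule X)
  note T = vecspace_tensor_power[OF vecspace_symE]
  note H = submodule_wronskian_image
  show ?case
  proof (cases "distinct b")
    case False
    then have "\<not> distinct (monomials ?n b)" by (auto simp: monomials_def distinct_map)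
    then have "?w b = \<zero>\<^bsub>?X\<^esub>"
      by (intro wedge_not_distinct[OF vecspace_symE] monomials_tuples less.prems)
    then show ?thesis using submodule_zero_closed[OF X H] by simp
  next
    case True
    \<comment> \<open>The claim is proved for the decreasing rearrangement and carried back at the
      end; both lists have the same \<open>square_sum\<close>, so the induction hypothesis covers
      the terms that arise.\<close>
    define a where "a = rev (sort b)"
    have mset: "mset a = mset b" by (simp add: a_def)
    have "sorted_wrt (<) (sort b)"
      using True by (simp add: strict_sorted_iff)
    then have "sorted_wrt (>) a" by (simp add: a_def sorted_wrt_rev)
    moreover have len: "length a = m" and set: "set a \<subseteq> {..?n}" using less.prems by (simp_all add: a_def)
    ultimately obtain "is" where "is": "length is = m" "set is \<subseteq> {..l}" "sorted (rev is)" "stair is = a"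
      by (rule strictly_decreasing_eq_stair)
    define P where "P = permutations_of_multiset (mset is)"
    have fin: "finite P" by (simp add: P_def)
    have P: "js \<in> P \<longleftrightarrow> mset js = mset is" for js by (simp add: P_def permutations_of_multiset_def)
    have js: "length js = m" "set js \<subseteq> {..l}" if "js \<in> P" for js
      using mset_eq_length[of js "is"] mset_eq_setD[of js "is"] that "is" by (simp_all add: P)
    have stair: "set (stair js) \<subseteq> {..?n}" if "js \<in> P" for js
    proof -
      have "js ! j + (m - 1 - j) \<le> ?n" if "j < m" for j
        using nth_le_of_set_subset[OF js(2)[OF \<open>js \<in> P\<close>], of j] js(1)[OF \<open>js \<in> P\<close>] that by simp
      then show ?thesis using js(1)[OF that] by (auto simp: stair_def)
    qed
    have w: "?w (stair js) \<in> carrier ?X" if "js \<in> P" for js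
      using js[OF that] stair[OF that]
      by (intro wedge_closed[OF vecspace_symE] monomials_tuples) simp_all
    \<comment> \<open>\<open>stair js\<close> need not be decreasing or even distinct; the induction
      runs over all exponent lists in range, so a smaller measure is enough.\<close>
    have small: "?w (stair js) \<in> ?H" if "js \<in> P - {is}" for js
    proof (rule less.hyps)
      have "square_sum (stair js) < square_sum (stair is)"
        using that "is"(3) by (intro square_sum_stair_less) (auto simp: P)
      also have "\<dots> = square_sum b" unfolding "is"(4) by (rule square_sum_mset_eq[OF mset])
      finally show "square_sum (stair js) < square_sum b" .
    qed (use that js stair in auto)
    define orb where "orb = (\<Oplus>\<^bsub>?T\<^esub>js\<in>P. ?t js)"
    define rest where "rest = (\<Oplus>\<^bsub>?X\<^esub>js\<in>P - {is}. ?w (stair js))"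
    have orb: "wronskian m l orb \<in> ?H"
      unfolding orb_def P_def by (intro imageI orbit_sum_invariant "is")
    have rest: "rest \<in> ?H"
      unfolding rest_def using small fin by (intro submodule_finsum[OF X H]) auto
    have "wronskian m l orb = (\<Oplus>\<^bsub>?X\<^esub>js\<in>P. wronskian m l (?t js))"
      unfolding orb_def using js
      by (intro linear_maps_finsum_apply[OF T X wronskian_linear fin] Pi_I
          tensor_closed[OF vecspace_symE] monomials_tuples)
    also have "\<dots> = (\<Oplus>\<^bsub>?X\<^esub>js\<in>P. ?w (stair js))"
      using js w by (intro X.finsum_cong' refl Pi_I wronskian_monomials) auto
    also have "\<dots> = (\<Oplus>\<^bsub>?X\<^esub>js\<in>insert is (P - {is}). ?w (stair js))"
      by (rule arg_cong[where f = "\<lambda>A. \<Oplus>\<^bsub>?X\<^esub>js\<in>A. ?w (stair js)"]) (auto simp: P)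
    also have "\<dots> = ?w a \<oplus>\<^bsub>?X\<^esub> rest"
      unfolding rest_def "is"(4)[symmetric] using w fin
      by (intro X.finsum_insert) (auto simp: P)
    finally have eq: "wronskian m l orb = ?w a \<oplus>\<^bsub>?X\<^esub> rest" .
    have wa: "?w a \<in> carrier ?X" using w[of "is"] "is"(4) by (simp add: P)
    have rest': "rest \<in> carrier ?X" using rest submodule_subset[OF H] by blast
    \<comment> \<open>The leading wedge enters with coefficient 1, so it can be solved for without
      dividing.\<close>
    have "?w a = wronskian m l orb \<ominus>\<^bsub>?X\<^esub> rest"
      unfolding eq using X.a_assoc[OF wa rest' X.a_inv_closed[OF rest']] X.r_neg[OF rest'] X.r_zero[OF wa]
      by (simp only: a_minus_def)
    also have "\<dots> \<in> ?H" by (rule submodule_minus[OF X H orb rest])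
    finally have a_mem: "?w a \<in> ?H" .
    obtain \<sigma> where \<sigma>: "\<sigma> permutes {..<m}" "permute_list \<sigma> a = b"
      using mset_eq_permutation[OF mset[symmetric]] len by metis
    have "permute_list \<sigma> (monomials ?n a) = (monomials ?n b :: 'k power_vec list)"
      unfolding monomials_def using \<sigma> len by (subst permute_list_map) auto
    then show ?thesis
      using wedge_permute_list_mem[OF vecspace_symE monomials_tuples[OF len set] \<sigma>(1) H a_mem] by simp
  qed
qed

lemma wronskian_surj:
  "carrier (ext_power m (symE (l + m - 1))) \<subseteq> wronskian m l ` carrier (sym_lower m (symE l))"
proof (rule spans_submodule[OF spans_wedge_monomials submodule_wronskian_image], rule image_subsetI)
  fix b assume "b \<in> {is. length is = m \<and> set is \<subseteq> {..l + m - 1}}"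
  then show "wedge (symE (l + m - 1)) (monomials (l + m - 1) b) \<in>
      wronskian m l ` carrier (sym_lower m (symE l))"
    by (intro wedge_monomials_in_image) simp_all
qed

subsection \<open>Equivariance\<close>

text \<open>\<open>u\<close> is lifted to a symmetric tensor \<open>t\<close>, and its value becomes
  a nonzero multiple of the value of \<open>t\<close>. Surjectivity thus stands in for a basis of
  the exterior power.\<close>

lemma ext_point_generic_inj:
  assumes u: "u \<in> carrier (ext_power m (symE (l + m - 1)))"
    and zero: "ext_point const_poly m (l + m - 1) (generic l) (\<lambda>_. 1) u = 0"
  shows "u = \<zero>\<^bsub>ext_power m (symE (l + m - 1))\<^esub>"
proof -
  obtain t where t: "t \<in> carrier (sym_lower m (symE l))" and u': "u = wronskian m l t"
    using u wronskian_surj by blast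
  have "tensor_point const_poly m l (generic l) (\<lambda>_. 1) t = 0"
    using zero ext_point_wronskian[OF comm_ring_hom_const_poly t, of "generic l" "\<lambda>_. 1"]
    by (simp add: u' hom_vandermonde_generic)
  then have "t = \<zero>\<^bsub>tensor_power m (symE l)\<^esub>"
    using t sym_lower_subset by (intro tensor_point_generic_inj) auto
  then show ?thesis
    using linear_maps_zero[OF vecspace_tensor_power[OF vecspace_symE] vecspace_ext_power[OF vecspace_symE]
        wronskian_linear] by (simp add: u')
qed

text \<open>Both sides are compared under \<open>ext_point\<close> at the generic point. Acting by
  \<open>g\<close> moves the point, which multiplies the Vandermonde factor by a power of
  \<open>det2 g\<close>, while the value of \<open>t\<close> at the moved point is the value of the
  transformed tensor at the original one.\<close>

lemma wronskian_act:
  assumes g: "g \<in> carrier GL2" and t: "t \<in> carrier (sym_lower m (symE l))"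
  shows "act (ext_power m (symE (l + m - 1))) g (wronskian m l t) =
    det2 g ^ (m * (m - 1) div 2) \<odot>\<^bsub>ext_power m (symE (l + m - 1))\<^esub>
      wronskian m l (act (tensor_power m (symE l)) g t)"
proof -
  let ?n = "l + m - 1" and ?N = "m * (m - 1) div 2"
  let ?X = "ext_power m (symE (l + m - 1)) :: ('a, _, _) rep"
  let ?T = "tensor_power m (symE l) :: ('a, _, _) rep"
  note \<iota> = comm_ring_hom_const_poly
  note rep = representation_sym_upper[OF representation_natE]
  note X = vecspace_ext_power[OF vecspace_symE] and R = vecspace_ring_rep[OF \<iota>]
  define a b c d where abcd: "a = vec_nth (vec_nth g 1) 1" "b = vec_nth (vec_nth g 1) 2"
    "c = vec_nth (vec_nth g 2) 1" "d = vec_nth (vec_nth g 2) 2"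
  let ?x = "generic l :: nat \<Rightarrow> 'a poly"
  let ?y = "\<lambda>_ :: nat. 1 :: 'a poly"
  let ?x' = "\<lambda>j. [:a:] * ?x j + [:c:] * ?y j" and ?y' = "\<lambda>j. [:b:] * ?x j + [:d:] * ?y j"
  have t': "t \<in> carrier ?T" using t sym_lower_subset by blast
  have gt: "act ?T g t \<in> carrier (sym_lower m (symE l))"
    using representation.act_closed[OF representation_sym_lower[OF rep] g t] by simp
  then have gt': "act ?T g t \<in> carrier ?T" using sym_lower_subset by blast
  have wt: "wronskian m l t \<in> carrier ?X" by (rule linear_maps_closed[OF wronskian_linear t'])
  have wgt: "wronskian m l (act ?T g t) \<in> carrier ?X" by (rule linear_maps_closed[OF wronskian_linear gt'])
  have gwt: "act ?X g (wronskian m l t) \<in> carrier ?X"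
    by (rule representation.act_closed[OF representation_ext_power[OF rep] g wt])
  \<comment> \<open>\<open>b\<close> and \<open>d\<close> are the coefficients at the exponents
    \<open>(l + 2) ^ j\<close> and 0, which differ, and the two entries do not both vanish.\<close>
  have nz: "?y' j \<noteq> 0" for j
  proof
    assume "?y' j = 0"
    then have "poly.coeff (?y' j) k = 0" for k by simp
    from this[of 0] this[of "(l + 2) ^ j"] show False
      using GL2_second_column[OF g] by (auto simp: generic_def abcd coeff_pCons split: nat.splits)
  qed
  have vand: "hom_vandermonde m ?x' ?y' = [:det2 g ^ ?N:] * hom_vandermonde m ?x ?y"
  proof -
    have "hom_vandermonde m ?x' ?y' = ([:a:] * [:d:] - [:b:] * [:c:]) ^ ?N * hom_vandermonde m ?x ?y"
      using nz by (intro hom_vandermonde_linear_substitution) auto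
    also have "([:a:] * [:d:] - [:b:] * [:c:]) ^ ?N = [:det2 g ^ ?N:]"
      by (simp add: det2_def abcd poly_const_pow mult.commute)
    finally show ?thesis .
  qed
  have "ext_point const_poly m ?n ?x ?y (act ?X g (wronskian m l t)) =
      ext_point const_poly m ?n ?x' ?y' (wronskian m l t)"
    unfolding abcd by (rule ext_point_act[OF \<iota> g wt])
  also have "\<dots> = hom_vandermonde m ?x' ?y' * tensor_point const_poly m l ?x' ?y' t"
    by (rule ext_point_wronskian[OF \<iota> t])
  also have "tensor_point const_poly m l ?x' ?y' t = tensor_point const_poly m l ?x ?y (act ?T g t)"
    unfolding abcd by (rule tensor_point_act[OF \<iota> g t', symmetric])
  also have "hom_vandermonde m ?x' ?y' * \<dots> =
      [:det2 g ^ ?N:] * ext_point const_poly m ?n ?x ?y (wronskian m l (act ?T g t))"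
    unfolding vand ext_point_wronskian[OF \<iota> gt] by (simp only: mult.assoc)
  also have "\<dots> = ext_point const_poly m ?n ?x ?y (det2 g ^ ?N \<odot>\<^bsub>?X\<^esub> wronskian m l (act ?T g t))"
    using linear_maps_smult[OF ext_point_linear[OF \<iota>] wgt] by simp
  finally have eq: "ext_point const_poly m ?n ?x ?y (act ?X g (wronskian m l t)) =
      ext_point const_poly m ?n ?x ?y (det2 g ^ ?N \<odot>\<^bsub>?X\<^esub> wronskian m l (act ?T g t))" .
  note dwgt = vecspace_simps(3)[OF X wgt, of "det2 g ^ ?N"]
  \<comment> \<open>Injectivity is available as triviality of the kernel, so it is applied to the
    difference.\<close>
  have "ext_point const_poly m ?n ?x ?y
      (act ?X g (wronskian m l t) \<ominus>\<^bsub>?X\<^esub> det2 g ^ ?N \<odot>\<^bsub>?X\<^esub> wronskian m l (act ?T g t)) = 0"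
    unfolding linear_maps_minus[OF X R ext_point_linear[OF \<iota>] gwt dwgt] eq
    by (rule ring_rep_minus_self[OF \<iota>])
  then have "act ?X g (wronskian m l t) \<ominus>\<^bsub>?X\<^esub> det2 g ^ ?N \<odot>\<^bsub>?X\<^esub> wronskian m l (act ?T g t) = \<zero>\<^bsub>?X\<^esub>"
    using gwt dwgt Module.module.axioms(2)[OF X]
    by (intro ext_point_generic_inj abelian_group.minus_closed) auto
  then show ?thesis using minus_eq_zero_iff[OF X gwt dwgt] by simp
qed

text \<open>The power of the determinant representation is a line with a coordinate, so maps out of
  the tensor product reduce to maps of its first factor. The scalar in \<open>wronskian_act\<close>
  is exactly the one by which the group acts on this line.\<close>

theorem theorem1p4:
  fixes m l :: nat
  defines "N \<equiv> m * (m - 1) div 2"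
  shows "\<exists>f :: ((('k::field^2) list \<Rightarrow>\<^sub>0 'k) set set list \<Rightarrow>\<^sub>0 'k) set \<Rightarrow> _.
    wronskian_map m l f \<and>
    (\<forall>f'. wronskian_map m l f' \<longrightarrow>
       (\<forall>t\<in>carrier (tensor_power m (sym_upper l natE)). f' t = f t)) \<and>
    (\<exists>\<Phi>. rep_iso GL2
         (tensor_prod (sym_lower m (sym_upper l natE)) (tensor_power N detE))
         (ext_power m (sym_upper (l + m - 1) natE)) \<Phi> \<and>
       (\<forall>t\<in>carrier (sym_lower m (sym_upper l natE)).
          \<Phi> (tensor2 (sym_lower m (sym_upper l natE)) (tensor_power N detE) t (det_generator N)) = f t))"
proof -
  let ?L = "sym_lower m (symE l) :: ('k, _, _) rep"
  let ?D = "tensor_power N detE :: ('k, _, _) rep"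
  let ?X = "ext_power m (symE (l + m - 1)) :: ('k, _, _) rep"
  let ?w = "wronskian m l :: ('k power_vec list \<Rightarrow>\<^sub>0 'k) set \<Rightarrow> _"
  let ?gen = "det_generator N :: ('k power_vec list \<Rightarrow>\<^sub>0 'k) set"
  note repE = representation_sym_upper[OF representation_natE]
  note repL = representation_sym_lower[OF repE] and repD = representation_tensor_power[OF representation_detE]
    and repX = representation_ext_power[OF repE]
  note L = representation_vecspace[OF repL] and D = representation_vecspace[OF repD]
    and X = representation_vecspace[OF repX]
  note LD = vecspace_tensor_prod[OF L D]
  note w = linear_maps_sym_lower[OF wronskian_linear]
  note gen = det_generator_closed
  \<comment> \<open>Forced by the prescribed value at the generator: an element of the determinant
    power is its coordinate times \<open>det_generator N\<close>.\<close>
  define \<phi> where "\<phi> t s = det_power_coord N s \<odot>\<^bsub>?X\<^esub> ?w t" for t s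
  have "bilinear ?L ?D ?X \<phi>"
    unfolding bilinear_def[OF L D] \<phi>_def
    using linear_maps_ring_rep_smult[OF X det_power_coord_linear linear_maps_closed[OF w]]
      linear_maps_smult_right[OF X w] by blast
  then obtain \<Phi> where \<Phi>: "\<Phi> \<in> linear_maps (tensor_prod ?L ?D) ?X"
    and \<Phi>_tensor2: "\<And>t s. t \<in> carrier ?L \<Longrightarrow> s \<in> carrier ?D \<Longrightarrow> \<Phi> (tensor2 ?L ?D t s) = \<phi> t s"
    using tensor_prod_induced[OF L D X] by metis
  have \<Phi>_gen: "\<Phi> (tensor2 ?L ?D t ?gen) = ?w t" if "t \<in> carrier ?L" for t
    using \<Phi>_tensor2[OF that gen] vecspace_simps(2)[OF X linear_maps_closed[OF w that]]
    by (simp add: \<phi>_def det_power_coord_generator)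
  note gen_lin = tensor2_linear_left[OF L D gen]
  \<comment> \<open>A scalar in the second factor moves to the first, and the tensors with the
    generator form a subspace; hence every element, not only a pure tensor, has this shape.
    Injectivity and equivariance are checked on it.\<close>
  have all_gen: "carrier (tensor_prod ?L ?D) \<subseteq> (\<lambda>t. tensor2 ?L ?D t ?gen) ` carrier ?L"
  proof (rule spans_submodule[OF spans_tensor_prod[OF L D]
        submodule_image[OF L LD gen_lin submodule_carrier[OF L]]], safe)
    fix t s assume t: "t \<in> carrier ?L" and s: "s \<in> carrier ?D"
    have "tensor2 ?L ?D t s = tensor2 ?L ?D t (det_power_coord N s \<odot>\<^bsub>?D\<^esub> ?gen)"
      using det_power_eq_smult_generator[OF s] by simp
    also have "\<dots> = tensor2 ?L ?D (det_power_coord N s \<odot>\<^bsub>?L\<^esub> t) ?gen"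
      using linear_maps_smult[OF tensor2_linear_right[OF L D t] gen] linear_maps_smult[OF gen_lin t] by simp
    finally show "tensor2 ?L ?D t s \<in> (\<lambda>t. tensor2 ?L ?D t ?gen) ` carrier ?L"
      using vecspace_simps(3)[OF L t] by blast
  qed
  have inj: "inj_on \<Phi> (carrier (tensor_prod ?L ?D))"
  proof (rule inj_onI)
    fix u v assume u: "u \<in> carrier (tensor_prod ?L ?D)" and v: "v \<in> carrier (tensor_prod ?L ?D)"
      and eq: "\<Phi> u = \<Phi> v"
    obtain t t' where t: "t \<in> carrier ?L" "u = tensor2 ?L ?D t ?gen"
      and t': "t' \<in> carrier ?L" "v = tensor2 ?L ?D t' ?gen" using u v all_gen by blast
    interpret L: Module.module scalars ?L by (rule L)
    have "?w (t \<ominus>\<^bsub>?L\<^esub> t') = ?w t \<ominus>\<^bsub>?X\<^esub> ?w t'" by (rule linear_maps_minus[OF L X w t(1) t'(1)])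
    also have "\<dots> = \<zero>\<^bsub>?X\<^esub>"
      using eq minus_eq_zero_iff[OF X linear_maps_closed[OF w t(1)] linear_maps_closed[OF w t'(1)]]
      by (simp add: t(2) t'(2) \<Phi>_gen t(1) t'(1))
    finally have "t \<ominus>\<^bsub>?L\<^esub> t' = \<zero>\<^bsub>?L\<^esub>"
      using wronskian_inj[OF L.minus_closed[OF t(1) t'(1)]] by simp
    then show "u = v" using minus_eq_zero_iff[OF L t(1) t'(1)] by (simp add: t(2) t'(2))
  qed
  have surj: "carrier ?X \<subseteq> \<Phi> ` carrier (tensor_prod ?L ?D)"
  proof
    fix u assume "u \<in> carrier ?X"
    then obtain t where t: "t \<in> carrier ?L" "u = ?w t" using wronskian_surj by blast
    then show "u \<in> \<Phi> ` carrier (tensor_prod ?L ?D)"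
      using \<Phi>_gen[OF t(1)] linear_maps_closed[OF gen_lin t(1)] by (metis image_eqI)
  qed
  have equiv: "\<Phi> (act (tensor_prod ?L ?D) g u) = act ?X g (\<Phi> u)"
    if g: "g \<in> carrier GL2" and u: "u \<in> carrier (tensor_prod ?L ?D)" for g u
  proof -
    note act = act_tensor_prod[OF repL repD g]
    obtain t where t: "t \<in> carrier ?L" "u = tensor2 ?L ?D t ?gen" using u all_gen by blast
    have gt: "act ?L g t \<in> carrier ?L" and gg: "act ?D g ?gen \<in> carrier ?D"
      using representation.act_closed[OF repL g t(1)] representation.act_closed[OF repD g gen] by auto
    have "\<Phi> (act (tensor_prod ?L ?D) g u) = \<phi> (act ?L g t) (act ?D g ?gen)"
      unfolding t(2) act(2)[OF t(1) gen] by (rule \<Phi>_tensor2[OF gt gg])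
    \<comment> \<open>Acting on the generator changes its coordinate from 1 to
      \<open>det2 g ^ N\<close>, the factor that \<open>wronskian_act\<close> calls for.\<close>
    also have "\<dots> = det2 g ^ N \<odot>\<^bsub>?X\<^esub> ?w (act ?L g t)"
      by (simp add: \<phi>_def det_power_coord_act[OF g gen] det_power_coord_generator)
    also have "\<dots> = act ?X g (?w t)" using wronskian_act[OF g t(1)] by (simp add: N_def)
    finally show ?thesis by (simp add: t(2) \<Phi>_gen[OF t(1)])
  qed
  have "rep_iso GL2 (tensor_prod ?L ?D) ?X \<Phi>"
    unfolding rep_iso_def bij_betw_def
    using representation_tensor_prod[OF repL repD] repX \<Phi> inj surj linear_maps_closed[OF \<Phi>] equiv by blast
  then show ?thesis
    using wronskian_map_wronskian[of m l] wronskian_map_unique[of m l] \<Phi>_gen by blast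
qed

end
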